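(* Let $p$ be an odd prime. (1) Let $G$ be a finite $p$-group with $G'\subseteq Z(G)$ and $Z(G)$ cyclic. If $G$ has a faithful irreducible projective representation, then $G\cong H_3(\mathbb{Z}/p^k\mathbb{Z})$ for some $k\ge1$; and for $G=H_3(\mathbb{Z}/p^k\mathbb{Z})$ one has $\tau_{irr}(G)=\tau(G)=p^k$. (2) If $G=H_{2n+1}(\mathbb{Z}/p^k\mathbb{Z})$ with $n>1$, then $G$ has no faithful irreducible projective representation, and $\tau(G)\le p^{k\lfloor n/2\rfloor}+p^{k\lceil n/2\rceil}$.
   Context: The Heisenberg group is $H_{2n+1}(\mathbb{Z}/p^k\mathbb{Z})=\langle x_i,y_i\ (1\le i\le n), z\mid [x_i,y_i]=z,\ x_i^{p^k}=y_i^{p^k}=z^{p^k}=1\rangle$, where all other pairs of generators commute and $[x,y]=x^{-1}y^{-1}xy$. A projective representation is an $\alpha$-representation for some cocycle $\alpha$: a map $\rho:G\to\mathrm{GL}_m(\mathbb{C})$ with $\rho(1)=I$ and $\rho(g)\rho(h)=\alpha(g,h)\rho(gh)$; it is faithful if the only $g$ with $\rho(g)$ scalar is $g=1$. $\tau(G)$ (resp. $\tau_{irr}(G)$) is the least degree of a faithful (resp. faithful irreducible) projective representation of $G$.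
   Formalization: In (1) G is additionally assumed nontrivial, since the trivial group has a faithful irreducible projective representation but is not isomorphic to any H_3(Z/p^kZ) with k≥1; in (2) k≥1 is assumed, since for k=0 the group is trivial and the claim fails. *)

theory Defs
  imports "HOL-Algebra.Algebra" "Jordan_Normal_Form.Matrix"
begin

definition p_group :: "nat \<Rightarrow> ('a, 'b) monoid_scheme \<Rightarrow> bool" where
  "p_group p G \<longleftrightarrow> group G \<and> finite (carrier G) \<and> (\<exists>e::nat. order G = p ^ e)"

definition group_center :: "('a, 'b) monoid_scheme \<Rightarrow> 'a set" where
  "group_center G = {z \<in> carrier G. \<forall>g \<in> carrier G. z \<otimes>\<^bsub>G\<^esub> g = g \<otimes>\<^bsub>G\<^esub> z}"

text \<open>Heisenberg group H_{2n+1}(Z/NZ), concrete model: triples (a,b,c) with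
  a, b in (Z/NZ)^n (functions on indices < n, zero elsewhere, values in 0..N-1),
  c in Z/NZ, and (a,b,c)(a',b',c') = (a+a', b+b', c+c'+ sum_i a_i b'_i).
  Here x_i = (e_i,0,0), y_i = (0,e_i,0), z = (0,0,1) and
  x_i^{-1} y_i^{-1} x_i y_i = z.\<close>

definition heis_vecs :: "nat \<Rightarrow> nat \<Rightarrow> (nat \<Rightarrow> int) set" where
  "heis_vecs n N = {a. (\<forall>i<n. 0 \<le> a i \<and> a i < int N) \<and> (\<forall>i\<ge>n. a i = 0)}"

definition heisenberg :: "nat \<Rightarrow> nat \<Rightarrow> ((nat \<Rightarrow> int) \<times> (nat \<Rightarrow> int) \<times> int) monoid" where
  "heisenberg n N = \<lparr>
     carrier = {t. fst t \<in> heis_vecs n N \<and> fst (snd t) \<in> heis_vecs n N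
                   \<and> 0 \<le> snd (snd t) \<and> snd (snd t) < int N},
     monoid.mult = (\<lambda>s t.
        ((\<lambda>i. if i < n then (fst s i + fst t i) mod int N else 0),
         (\<lambda>i. if i < n then (fst (snd s) i + fst (snd t) i) mod int N else 0),
         (snd (snd s) + snd (snd t) + (\<Sum>i<n. fst s i * fst (snd t) i)) mod int N)),
     one = ((\<lambda>_. 0), (\<lambda>_. 0), 0) \<rparr>"

definition cocycle :: "('a, 'b) monoid_scheme \<Rightarrow> ('a \<Rightarrow> 'a \<Rightarrow> complex) \<Rightarrow> bool" where
  "cocycle G \<alpha> \<longleftrightarrow>
     (\<forall>g \<in> carrier G. \<forall>h \<in> carrier G. \<alpha> g h \<noteq> 0) \<and>
     (\<forall>g \<in> carrier G. \<forall>h \<in> carrier G. \<forall>k \<in> carrier G.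
        \<alpha> g h * \<alpha> (g \<otimes>\<^bsub>G\<^esub> h) k = \<alpha> h k * \<alpha> g (h \<otimes>\<^bsub>G\<^esub> k))"

definition alpha_rep ::
  "('a, 'b) monoid_scheme \<Rightarrow> ('a \<Rightarrow> 'a \<Rightarrow> complex) \<Rightarrow> nat \<Rightarrow> ('a \<Rightarrow> complex mat) \<Rightarrow> bool" where
  "alpha_rep G \<alpha> m \<rho> \<longleftrightarrow>
     (\<forall>g \<in> carrier G. \<rho> g \<in> carrier_mat m m \<and> invertible_mat (\<rho> g)) \<and>
     \<rho> \<one>\<^bsub>G\<^esub> = 1\<^sub>m m \<and>
     (\<forall>g \<in> carrier G. \<forall>h \<in> carrier G. \<rho> g * \<rho> h = \<alpha> g h \<cdot>\<^sub>m \<rho> (g \<otimes>\<^bsub>G\<^esub> h))"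

definition proj_rep :: "('a, 'b) monoid_scheme \<Rightarrow> nat \<Rightarrow> ('a \<Rightarrow> complex mat) \<Rightarrow> bool" where
  "proj_rep G m \<rho> \<longleftrightarrow> 0 < m \<and> (\<exists>\<alpha>. cocycle G \<alpha> \<and> alpha_rep G \<alpha> m \<rho>)"

definition faithful_proj :: "('a, 'b) monoid_scheme \<Rightarrow> nat \<Rightarrow> ('a \<Rightarrow> complex mat) \<Rightarrow> bool" where
  "faithful_proj G m \<rho> \<longleftrightarrow>
     (\<forall>g \<in> carrier G. (\<exists>c::complex. \<rho> g = c \<cdot>\<^sub>m 1\<^sub>m m) \<longrightarrow> g = \<one>\<^bsub>G\<^esub>)"

definition invariant_subspace ::
  "('a, 'b) monoid_scheme \<Rightarrow> nat \<Rightarrow> ('a \<Rightarrow> complex mat) \<Rightarrow> complex vec set \<Rightarrow> bool" where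
  "invariant_subspace G m \<rho> W \<longleftrightarrow>
     W \<subseteq> carrier_vec m \<and> 0\<^sub>v m \<in> W \<and>
     (\<forall>v \<in> W. \<forall>w \<in> W. v + w \<in> W) \<and>
     (\<forall>c::complex. \<forall>v \<in> W. c \<cdot>\<^sub>v v \<in> W) \<and>
     (\<forall>g \<in> carrier G. \<forall>v \<in> W. \<rho> g *\<^sub>v v \<in> W)"

definition irreducible_proj :: "('a, 'b) monoid_scheme \<Rightarrow> nat \<Rightarrow> ('a \<Rightarrow> complex mat) \<Rightarrow> bool" where
  "irreducible_proj G m \<rho> \<longleftrightarrow>
     (\<forall>W. invariant_subspace G m \<rho> W \<longrightarrow> W = {0\<^sub>v m} \<or> W = carrier_vec m)"

definition has_faithful_proj_rep :: "('a, 'b) monoid_scheme \<Rightarrow> nat \<Rightarrow> bool" where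
  "has_faithful_proj_rep G m \<longleftrightarrow> (\<exists>\<rho>. proj_rep G m \<rho> \<and> faithful_proj G m \<rho>)"

definition has_faithful_irr_proj_rep :: "('a, 'b) monoid_scheme \<Rightarrow> nat \<Rightarrow> bool" where
  "has_faithful_irr_proj_rep G m \<longleftrightarrow>
     (\<exists>\<rho>. proj_rep G m \<rho> \<and> faithful_proj G m \<rho> \<and> irreducible_proj G m \<rho>)"

definition tau :: "('a, 'b) monoid_scheme \<Rightarrow> nat" where
  "tau G = (LEAST m. has_faithful_proj_rep G m)"

definition tau_irr :: "('a, 'b) monoid_scheme \<Rightarrow> nat" where
  "tau_irr G = (LEAST m. has_faithful_irr_proj_rep G m)"

end

(* For commuting g, h the scalar kappa(g, h) = alpha(g, h) / alpha(h, g) satisfies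
   rho(g) rho(h) = kappa(g, h) rho(h) rho(g) and is multiplicative in each argument. If rho is
   irreducible and faithful, Schur's lemma says that no z <> 1 in the centre has kappa(z, .) = 1.

   Classification. Let zeta generate Z(G), of order N = p^k, and K = {g. kappa(zeta, g) = 1}.
   The three subgroups lemma, applied in the central extension of G by C* defined by alpha, shows that
   K is abelian. Choose x with kappa(zeta, x) a primitive N-th root of unity, so that G = <x> K. If no
   commutator [x, y] with y in K had order N, then x^(N/p) would be central, against
   kappa(zeta, x^(N/p)) <> 1. So some t = [x, y] generates Z(G). For g with kappa(zeta, g)
   primitive, g^N is central and kappa(g^N, g) = 1, hence g^N = 1; applied to x and y x (p is odd) this
   gives x^N = y^N = 1, and G = {y^b x^a t^c} is the Heisenberg group.

   Lower bound. After a change of generators kappa(z, y) = 1, so Z = rho(z) and B = rho(y) commute, and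
   A = rho(x) maps their common eigenvectors to each other; some orbit of eigenvalue pairs has N elements.

   For n > 1 the generator z is the commutator of x_i and y_i for two different i, which forces
   kappa(z, .) = 1. The upper bound comes from a sum of two representations with the same cocycle:
   x_i, y_i act on the first one irreducibly for i < n div 2 and by scalars for the other i,
   and the other way round on the second one, while z acts by 1 on the first and by a primitive
   root of unity on the second. *)

theory Submission
  imports Defs "Jordan_Normal_Form.Spectral_Radius" "HOL-Number_Theory.Cong"
begin

section \<open>Roots of unity and commutator identities\<close>

text \<open>The lower bound has to cope with theta = kappa(z, x) having any order q that divides
  p^k. For q = p^k the eigenvalues of Z along an orbit are already distinct, for q = 1 they are all
  equal and B has to separate the vectors, and in between neither need suffice; hence the pairs. A
  step of A divides the eigenvalue of B by the current eigenvalue of Z, so powers of theta with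
  triangular exponents pile up, which is harmless for odd p. The orbit is long enough if it starts
  at an eigenvalue of Z of full order p^k, and faithfulness provides one: the p^(k-1)-th power of
  rho(z) is not scalar.

  For the upper bound, a block sum is a projective representation only if both blocks have literally
  the same cocycle; the signs of the phases are chosen for that.\<close>

lemma power_gcd_eq_1:
  fixes w :: "'a::field"
  assumes "w ^ i = 1" "w ^ j = 1"
  shows "w ^ gcd i j = 1"
proof (cases "i = 0")
  case True then show ?thesis using assms by simp
next
  case False
  then obtain x y where "i * x = j * y + gcd i j" using bezout_nat by blast
  then have "w ^ (i * x) = w ^ (j * y) * w ^ gcd i j" by (simp add: power_add)
  then show ?thesis using assms by (simp add: power_mult)
qed

text \<open>Every divisor of \<open>p ^ k\<close> is a power of \<open>p\<close>, so a proper one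
  divides \<open>p ^ (k - 1)\<close>. For \<open>k = 0\<close> the two hypotheses on
  \<open>w\<close> contradict each other, as \<open>k - 1\<close> is then 0 as well.\<close>

lemma prime_power_order:
  fixes w :: "'a::field"
  assumes "Factorial_Ring.prime p" "w ^ (p ^ k) = 1" "w ^ (p ^ (k - 1)) \<noteq> 1"
  shows "w ^ i = 1 \<longleftrightarrow> p ^ k dvd i"
proof
  assume "w ^ i = 1"
  then have 1: "w ^ gcd i (p ^ k) = 1" using assms(2) power_gcd_eq_1 by blast
  obtain e where e: "e \<le> k" "gcd i (p ^ k) = p ^ e"
    using divides_primepow_nat[OF assms(1), of "gcd i (p ^ k)" k] by auto
  have "e = k"
  proof (rule ccontr)
    assume "e \<noteq> k"
    then have "k - 1 = e + (k - 1 - e)" using e(1) by simp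
    then have "w ^ (p ^ (k - 1)) = (w ^ (p ^ e)) ^ (p ^ (k - 1 - e))"
      by (metis power_add power_mult)
    then show False using 1 e(2) assms(3) by simp
  qed
  then show "p ^ k dvd i" by (metis e(2) gcd_dvd1)
next
  assume "p ^ k dvd i"
  then show "w ^ i = 1" using assms(2) by (auto simp: power_mult elim!: dvdE)
qed

lemma power_eq_iff_cong:
  fixes w :: "'a::field"
  assumes "\<And>i. w ^ i = 1 \<longleftrightarrow> N dvd i" "w \<noteq> 0"
  shows "w ^ i = w ^ j \<longleftrightarrow> [i = j] (mod N)"
proof -
  have *: "w ^ i = w ^ j \<longleftrightarrow> [i = j] (mod N)" if "j \<le> i" for i j
  proof -
    have "w ^ i = w ^ (i - j) * w ^ j" using that by (simp flip: power_add)
    then have "w ^ i = w ^ j \<longleftrightarrow> N dvd (i - j)" using assms by auto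
    then show ?thesis using that cong_altdef_nat by blast
  qed
  show ?thesis
    using *[of i j] *[of j i] by (cases "j \<le> i") (auto simp: cong_sym_eq)
qed

lemma root_of_unity_eq_power:
  fixes w :: complex
  assumes w: "\<And>i. w ^ i = 1 \<longleftrightarrow> N dvd i" and N: "N > 0" and u: "u ^ N = 1"
  obtains a where "a < N" "u = w ^ a"
proof -
  have "w ^ N = 1" using w by simp
  then have w0: "w \<noteq> 0" using N by (metis power_0_left not_gr0 zero_neq_one)
  have inj: "inj_on (\<lambda>i. w ^ i) {..<N}"
    using power_eq_iff_cong[OF w w0] by (simp add: inj_on_def) (meson cong_less_modulus_unique_nat lessThan_iff)
  have "(\<lambda>i. w ^ i) ` {..<N} = {z. z ^ N = 1}"
  proof (rule card_subset_eq)
    show "finite {z::complex. z ^ N = 1}" using finite_roots_unity N by auto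
    show "(\<lambda>i. w ^ i) ` {..<N} \<subseteq> {z. z ^ N = 1}"
      using w by (auto simp flip: power_mult)
    show "card ((\<lambda>i. w ^ i) ` {..<N}) = card {z::complex. z ^ N = 1}"
      using card_roots_unity_eq N inj by (simp add: card_image)
  qed
  then show thesis using u that by (metis (mono_tags, lifting) imageE lessThan_iff mem_Collect_eq)
qed

text \<open>The groups of \<open>p ^ r\<close>-th roots of unity form a chain, so the smallest one
  containing both roots is generated by one of them. \<open>degree_bound\<close> uses this to decide
  which of two generators is to be modified.\<close>

lemma prime_power_cyclic:
  fixes w1 w2 :: complex
  assumes p: "Factorial_Ring.prime p" and "w1 ^ (p ^ k) = 1" "w2 ^ (p ^ k) = 1"
  obtains r j where "r \<le> k" "\<And>i. w1 ^ i = 1 \<longleftrightarrow> p ^ r dvd i" "w2 = w1 ^ j"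
        | r j where "r \<le> k" "\<And>i. w2 ^ i = 1 \<longleftrightarrow> p ^ r dvd i" "w1 = w2 ^ j"
proof -
  define r where "r = (LEAST r. w1 ^ (p ^ r) = 1 \<and> w2 ^ (p ^ r) = 1)"
  have r: "w1 ^ (p ^ r) = 1 \<and> w2 ^ (p ^ r) = 1"
    unfolding r_def by (rule LeastI) (use assms in auto)
  have rk: "r \<le> k" unfolding r_def by (rule Least_le) (use assms in auto)
  have pr: "p ^ r > 0" using p by (simp add: prime_gt_0_nat)
  show thesis
  proof (cases "r = 0")
    case True
    then have "w1 = 1" "w2 = 1" using r by auto
    then show thesis using that(1)[of 0 0] by simp
  next
    case False
    then have "r - 1 < r" by simp
    then have "w1 ^ (p ^ (r - 1)) \<noteq> 1 \<or> w2 ^ (p ^ (r - 1)) \<noteq> 1"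
      unfolding r_def using not_less_Least by blast
    then show thesis
    proof
      assume *: "w1 ^ (p ^ (r - 1)) \<noteq> 1"
      note o = prime_power_order[OF p conjunct1[OF r] *]
      obtain j where "w2 = w1 ^ j" using root_of_unity_eq_power[OF o pr] r by metis
      then show thesis using that(1) o rk by blast
    next
      assume *: "w2 ^ (p ^ (r - 1)) \<noteq> 1"
      note o = prime_power_order[OF p conjunct2[OF r] *]
      obtain j where "w1 = w2 ^ j" using root_of_unity_eq_power[OF o pr] r by metis
      then show thesis using that(2) o rk by blast
    qed
  qed
qed

context group
begin

lemma prime_power_pow_eq_one:
  assumes "Factorial_Ring.prime p" "x \<in> carrier G" "x [^] (p ^ k) = \<one>" "x [^] (p ^ (k - 1)) \<noteq> \<one>"
  shows "x [^] (i::nat) = \<one> \<longleftrightarrow> p ^ k dvd i"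
proof -
  obtain e where e: "e \<le> k" "ord x = p ^ e"
    using divides_primepow_nat[OF assms(1), of "ord x" k] assms(2,3) pow_eq_id by auto
  have "\<not> e \<le> k - 1"
    using e(2) assms(2,4) pow_eq_id le_imp_power_dvd by metis
  then have "e = k" using e(1) by simp
  then show ?thesis using e(2) assms(2) pow_eq_id by simp
qed

text \<open>The case of the three subgroups lemma in which two of the double commutators vanish.\<close>

lemma three_commutator:
  assumes c: "x \<in> carrier G" "g \<in> carrier G" "h \<in> carrier G" "u \<in> carrier G" "v \<in> carrier G" "z \<in> carrier G"
    and xg: "x \<otimes> g = g \<otimes> x \<otimes> u" and xh: "x \<otimes> h = h \<otimes> x \<otimes> v" and gh: "g \<otimes> h = h \<otimes> g \<otimes> z"
    and uh: "u \<otimes> h = h \<otimes> u" and vg: "v \<otimes> g = g \<otimes> v"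
    and uv: "u \<otimes> v = v \<otimes> u" and uz: "u \<otimes> z = z \<otimes> u" and vz: "v \<otimes> z = z \<otimes> v"
  shows "z \<otimes> x = x \<otimes> z"
proof -
  \<comment> \<open>Both computations bring \<open>h \<otimes> g\<close> to the front: here
    \<open>x\<close> passes \<open>g\<close> and \<open>h\<close> before these are swapped, in
    \<open>e2\<close> afterwards.\<close>
  have e1: "x \<otimes> (g \<otimes> h) = h \<otimes> g \<otimes> (z \<otimes> x) \<otimes> (u \<otimes> v)"
  proof -
    have "x \<otimes> (g \<otimes> h) = g \<otimes> x \<otimes> (u \<otimes> h)" using xg c by (metis m_assoc m_closed)
    also have "\<dots> = g \<otimes> (x \<otimes> h) \<otimes> u" using uh c by (simp add: m_assoc)
    also have "\<dots> = (g \<otimes> h) \<otimes> (x \<otimes> (v \<otimes> u))" using xh c by (simp add: m_assoc)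
    also have "\<dots> = h \<otimes> g \<otimes> (z \<otimes> x) \<otimes> (u \<otimes> v)" using gh uv c by (simp add: m_assoc)
    finally show ?thesis .
  qed
  have e2: "x \<otimes> (g \<otimes> h) = h \<otimes> g \<otimes> (x \<otimes> z) \<otimes> (u \<otimes> v)"
  proof -
    have "x \<otimes> (g \<otimes> h) = (x \<otimes> h) \<otimes> g \<otimes> z" using gh c by (simp add: m_assoc)
    also have "\<dots> = h \<otimes> x \<otimes> (v \<otimes> g) \<otimes> z" using xh c by (simp add: m_assoc)
    also have "\<dots> = h \<otimes> (x \<otimes> g) \<otimes> (v \<otimes> z)" using vg c by (simp add: m_assoc)
    also have "\<dots> = h \<otimes> g \<otimes> x \<otimes> ((u \<otimes> z) \<otimes> v)" using xg vz c by (simp add: m_assoc)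
    also have "\<dots> = h \<otimes> g \<otimes> (x \<otimes> z) \<otimes> (u \<otimes> v)" using uz c by (simp add: m_assoc)
    finally show ?thesis .
  qed
  show ?thesis using e1 e2 c by (metis l_cancel r_cancel m_closed)
qed

lemma pow_commute_twist:
  assumes c: "x \<in> carrier G" "g \<in> carrier G" "t \<in> carrier G"
    and xg: "x \<otimes> g = g \<otimes> x \<otimes> t" and tx: "t \<otimes> x = x \<otimes> t"
  shows "x [^] (n::nat) \<otimes> g = g \<otimes> x [^] n \<otimes> t [^] n"
proof (induction n)
  case (Suc n)
  have "x [^] Suc n \<otimes> g = x [^] n \<otimes> (g \<otimes> x \<otimes> t)" using c xg by (simp add: m_assoc)
  also have "\<dots> = g \<otimes> x [^] n \<otimes> (t [^] n \<otimes> x) \<otimes> t" using c Suc by (simp flip: m_assoc)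
  also have "\<dots> = g \<otimes> x [^] n \<otimes> (x \<otimes> t [^] n) \<otimes> t" using c tx group_commutes_pow by simp
  finally show ?case using c by (simp add: m_assoc)
qed (use c in simp)

text \<open>For odd \<open>n\<close> the exponent of \<open>t\<close> is a multiple of
  \<open>n\<close>; this is where oddness of \<open>p\<close> enters the classification, with
  \<open>n = N\<close> and \<open>t\<close> of order \<open>N\<close>.\<close>

lemma pow_mult_twist:
  assumes c: "x \<in> carrier G" "y \<in> carrier G" "t \<in> carrier G"
    and xy: "x \<otimes> y = y \<otimes> x \<otimes> t" and tx: "t \<otimes> x = x \<otimes> t" and ty: "t \<otimes> y = y \<otimes> t"
  shows "(y \<otimes> x) [^] (n::nat) = y [^] n \<otimes> x [^] n \<otimes> t [^] (n * (n - 1) div 2)"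
proof (induction n)
  case (Suc n)
  have cm: "t [^] i \<otimes> x = x \<otimes> t [^] i" "t [^] i \<otimes> y = y \<otimes> t [^] i" for i :: nat
    using c tx ty group_commutes_pow by simp_all
  have cm': "t [^] i \<otimes> (x \<otimes> w) = x \<otimes> (t [^] i \<otimes> w)" if "w \<in> carrier G" for i :: nat and w
    using c cm that by (metis m_assoc nat_pow_closed)
  have ar: "Suc n * (Suc n - 1) div 2 = n * (n - 1) div 2 + n"
    by (cases n) (simp_all add: algebra_simps)
  let ?T = "n * (n - 1) div 2"
  have "(y \<otimes> x) [^] Suc n = y [^] n \<otimes> x [^] n \<otimes> (t [^] ?T \<otimes> y) \<otimes> x"
    using c Suc by (simp add: m_assoc)
  also have "\<dots> = y [^] n \<otimes> (x [^] n \<otimes> y) \<otimes> (t [^] ?T \<otimes> x)" using c cm by (simp add: m_assoc)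
  also have "\<dots> = y [^] Suc n \<otimes> x [^] n \<otimes> (t [^] n \<otimes> x) \<otimes> t [^] ?T"
    using c cm cm' pow_commute_twist[OF c xy tx] by (simp add: m_assoc)
  also have "\<dots> = y [^] Suc n \<otimes> x [^] Suc n \<otimes> (t [^] n \<otimes> t [^] ?T)"
    using c cm' by (simp add: m_assoc)
  also have "t [^] n \<otimes> t [^] ?T = t [^] (Suc n * (Suc n - 1) div 2)"
    using c ar by (simp add: nat_pow_mult add.commute)
  finally show ?case .
qed simp

end

section \<open>Heisenberg groups and cocycles\<close>

lemma heisenberg_simps:
  "s \<otimes>\<^bsub>heisenberg n N\<^esub> t =
     ((\<lambda>i. if i < n then (fst s i + fst t i) mod int N else 0),
      (\<lambda>i. if i < n then (fst (snd s) i + fst (snd t) i) mod int N else 0),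
      (snd (snd s) + snd (snd t) + (\<Sum>i<n. fst s i * fst (snd t) i)) mod int N)"
  "\<one>\<^bsub>heisenberg n N\<^esub> = ((\<lambda>_. 0), (\<lambda>_. 0), 0)"
  by (simp_all add: heisenberg_def)

lemma heisenberg_carrier:
  "t \<in> carrier (heisenberg n N) \<longleftrightarrow>
     (\<forall>i<n. 0 \<le> fst t i \<and> fst t i < int N) \<and> (\<forall>i\<ge>n. fst t i = 0) \<and>
     (\<forall>i<n. 0 \<le> fst (snd t) i \<and> fst (snd t) i < int N) \<and> (\<forall>i\<ge>n. fst (snd t) i = 0) \<and>
     0 \<le> snd (snd t) \<and> snd (snd t) < int N"
  by (auto simp: heisenberg_def heis_vecs_def)

lemma mod_sum_mult_mod:
  fixes f g :: "nat \<Rightarrow> int"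
  shows "(\<Sum>i<n. (if i < n then f i mod M else z) * g i) mod M = (\<Sum>i<n. f i * g i) mod M"
    and "(\<Sum>i<n. g i * (if i < n then f i mod M else z)) mod M = (\<Sum>i<n. g i * f i) mod M"
proof -
  have "[(\<Sum>i<n. (if i < n then f i mod M else z) * g i) = (\<Sum>i<n. f i * g i)] (mod M)"
    by (rule cong_sum) (auto simp: cong_def mod_mult_left_eq)
  then show "(\<Sum>i<n. (if i < n then f i mod M else z) * g i) mod M = (\<Sum>i<n. f i * g i) mod M"
    by (simp add: cong_def)
  then show "(\<Sum>i<n. g i * (if i < n then f i mod M else z)) mod M = (\<Sum>i<n. g i * f i) mod M"
    by (simp add: mult.commute)
qed

lemma group_heisenberg:
  assumes N: "N > 0"
  shows "group (heisenberg n N)"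
proof (rule groupI)
  fix x y z
  assume x: "x \<in> carrier (heisenberg n N)" and y: "y \<in> carrier (heisenberg n N)"
    and z: "z \<in> carrier (heisenberg n N)"
  show "x \<otimes>\<^bsub>heisenberg n N\<^esub> y \<in> carrier (heisenberg n N)"
    using N by (auto simp: heisenberg_carrier heisenberg_simps)
  let ?xy = "\<Sum>i<n. fst x i * fst (snd y) i"
  let ?yz = "\<Sum>i<n. fst y i * fst (snd z) i"
  let ?xz = "\<Sum>i<n. fst x i * fst (snd z) i"
  let ?c = "snd (snd x) + snd (snd y) + snd (snd z)"
  have 1: "((snd (snd x) + snd (snd y) + ?xy) mod int N + snd (snd z) +
     (\<Sum>i<n. (if i < n then (fst x i + fst y i) mod int N else 0) * fst (snd z) i)) mod int N
     = (?c + ?xy + ?xz + ?yz) mod int N"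
  proof -
    have "((snd (snd x) + snd (snd y) + ?xy) mod int N + snd (snd z) +
     (\<Sum>i<n. (if i < n then (fst x i + fst y i) mod int N else 0) * fst (snd z) i)) mod int N
     = ((snd (snd x) + snd (snd y) + ?xy) + snd (snd z) + (\<Sum>i<n. (fst x i + fst y i) * fst (snd z) i)) mod int N"
      by (rule mod_add_cong) (simp add: mod_simps, rule mod_sum_mult_mod(1))
    then show ?thesis by (simp add: algebra_simps sum.distrib)
  qed
  have 2: "(snd (snd x) + (snd (snd y) + snd (snd z) + ?yz) mod int N +
     (\<Sum>i<n. fst x i * (if i < n then (fst (snd y) i + fst (snd z) i) mod int N else 0))) mod int N
     = (?c + ?xy + ?xz + ?yz) mod int N"
  proof -
    have "(snd (snd x) + (snd (snd y) + snd (snd z) + ?yz) mod int N +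
     (\<Sum>i<n. fst x i * (if i < n then (fst (snd y) i + fst (snd z) i) mod int N else 0))) mod int N
     = (snd (snd x) + (snd (snd y) + snd (snd z) + ?yz) + (\<Sum>i<n. fst x i * (fst (snd y) i + fst (snd z) i))) mod int N"
      by (rule mod_add_cong) (simp add: mod_simps, rule mod_sum_mult_mod(2))
    then show ?thesis by (simp add: algebra_simps sum.distrib)
  qed
  show "x \<otimes>\<^bsub>heisenberg n N\<^esub> y \<otimes>\<^bsub>heisenberg n N\<^esub> z =
    x \<otimes>\<^bsub>heisenberg n N\<^esub> (y \<otimes>\<^bsub>heisenberg n N\<^esub> z)"
    unfolding heisenberg_simps fst_conv snd_conv 1 2
    by (auto simp: fun_eq_iff mod_simps ac_simps)
next
  fix x assume x: "x \<in> carrier (heisenberg n N)"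
  show "\<one>\<^bsub>heisenberg n N\<^esub> \<otimes>\<^bsub>heisenberg n N\<^esub> x = x"
    using x by (auto simp: heisenberg_simps heisenberg_carrier fun_eq_iff prod_eq_iff not_less)
  \<comment> \<open>The left inverse of (a, b, c): the bilinear term of the product contributes
    minus the sum of the a_i * b_i, which the last coordinate compensates.\<close>
  define y where "y = ((\<lambda>i. if i < n then (- fst x i) mod int N else 0),
      (\<lambda>i. if i < n then (- fst (snd x) i) mod int N else 0),
      (- snd (snd x) + (\<Sum>i<n. fst x i * fst (snd x) i)) mod int N)"
  have "y \<in> carrier (heisenberg n N)"
    using N by (auto simp: y_def heisenberg_carrier)
  moreover have "y \<otimes>\<^bsub>heisenberg n N\<^esub> x = \<one>\<^bsub>heisenberg n N\<^esub>"
  proof -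
    have "((- snd (snd x) + (\<Sum>i<n. fst x i * fst (snd x) i)) mod int N + snd (snd x) +
        (\<Sum>i<n. (if i < n then (- fst x i) mod int N else 0) * fst (snd x) i)) mod int N
      = ((- snd (snd x) + (\<Sum>i<n. fst x i * fst (snd x) i)) + snd (snd x) +
        (\<Sum>i<n. (- fst x i) * fst (snd x) i)) mod int N"
      by (rule mod_add_cong) (simp add: mod_simps, rule mod_sum_mult_mod(1))
    then show ?thesis
      by (auto simp: y_def heisenberg_simps fun_eq_iff mod_simps sum_negf)
  qed
  ultimately show "\<exists>y\<in>carrier (heisenberg n N). y \<otimes>\<^bsub>heisenberg n N\<^esub> x = \<one>\<^bsub>heisenberg n N\<^esub>"
    by blast
qed (use N in \<open>auto simp: heisenberg_carrier heisenberg_simps\<close>)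

section \<open>Cocycles, their commutator scalars and the associated central extension\<close>

definition comm_scalar :: "('a \<Rightarrow> 'a \<Rightarrow> complex) \<Rightarrow> 'a \<Rightarrow> 'a \<Rightarrow> complex" where
  "comm_scalar \<alpha> g h = \<alpha> g h / \<alpha> h g"

text \<open>The extension of G by the nonzero complex numbers with class \<open>\<alpha>\<close>.
  Cocycles need not be normalised, which explains the first component of the unit.\<close>

definition central_ext :: "('a, 'b) monoid_scheme \<Rightarrow> ('a \<Rightarrow> 'a \<Rightarrow> complex) \<Rightarrow> (complex \<times> 'a) monoid" where
  "central_ext G \<alpha> = \<lparr>
     carrier = {c. c \<noteq> 0} \<times> carrier G,
     monoid.mult = (\<lambda>s t. (fst s * fst t * \<alpha> (snd s) (snd t), snd s \<otimes>\<^bsub>G\<^esub> snd t)),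
     one = (1 / \<alpha> \<one>\<^bsub>G\<^esub> \<one>\<^bsub>G\<^esub>, \<one>\<^bsub>G\<^esub>)\<rparr>"

locale group_cocycle = group G for G (structure) +
  fixes \<alpha> :: "'a \<Rightarrow> 'a \<Rightarrow> complex"
  assumes coc: "cocycle G \<alpha>"
begin

text \<open>Meaningful for commuting arguments only, where it is the commutator of their lifts to
  \<open>central_ext\<close>.\<close>

abbreviation \<kappa> where "\<kappa> \<equiv> comm_scalar \<alpha>"

lemma cocycle_nonzero: "g \<in> carrier G \<Longrightarrow> h \<in> carrier G \<Longrightarrow> \<alpha> g h \<noteq> 0"
  using coc by (auto simp: cocycle_def)

lemma cocycle_eq:
  "g \<in> carrier G \<Longrightarrow> h \<in> carrier G \<Longrightarrow> k \<in> carrier G \<Longrightarrow>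
     \<alpha> g h * \<alpha> (g \<otimes> h) k = \<alpha> h k * \<alpha> g (h \<otimes> k)"
  using coc by (auto simp: cocycle_def)

lemma cocycle_one:
  assumes "g \<in> carrier G"
  shows "\<alpha> \<one> g = \<alpha> \<one> \<one>" "\<alpha> g \<one> = \<alpha> \<one> \<one>"
  using cocycle_eq[of \<one> \<one> g] cocycle_eq[of g \<one> \<one>] cocycle_nonzero assms by auto

lemma comm_scalar_nonzero: "g \<in> carrier G \<Longrightarrow> h \<in> carrier G \<Longrightarrow> \<kappa> g h \<noteq> 0"
  using cocycle_nonzero by (simp add: comm_scalar_def)

lemma comm_scalar_self: "g \<in> carrier G \<Longrightarrow> \<kappa> g g = 1"
  using cocycle_nonzero by (simp add: comm_scalar_def)

lemma comm_scalar_swap: "\<kappa> g h = inverse (\<kappa> h g)"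
  by (simp add: comm_scalar_def)

text \<open>Obtained by comparing the cocycle identities with \<open>z\<close> before, between and
  after \<open>g\<close> and \<open>h\<close>. Only \<open>z\<close> has to commute with the other
  two, so \<open>\<kappa> z\<close> is a character of the whole centralizer of \<open>z\<close>,
  abelian or not.\<close>

lemma comm_scalar_mult_right:
  assumes c: "z \<in> carrier G" "g \<in> carrier G" "h \<in> carrier G"
    and zg: "z \<otimes> g = g \<otimes> z" and zh: "z \<otimes> h = h \<otimes> z"
  shows "\<kappa> z (g \<otimes> h) = \<kappa> z g * \<kappa> z h"
proof -
  have 1: "\<alpha> z g * \<alpha> (g \<otimes> z) h = \<alpha> g h * \<alpha> z (g \<otimes> h)" using cocycle_eq[of z g h] c zg by simp
  have 2: "\<alpha> g z * \<alpha> (g \<otimes> z) h = \<alpha> z h * \<alpha> g (h \<otimes> z)" using cocycle_eq[of g z h] c zh by simp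
  have 3: "\<alpha> g h * \<alpha> (g \<otimes> h) z = \<alpha> h z * \<alpha> g (h \<otimes> z)" using cocycle_eq[of g h z] c by simp
  note n = cocycle_nonzero[of g h] cocycle_nonzero[of z g] cocycle_nonzero[of g z] cocycle_nonzero[of z h] cocycle_nonzero[of h z] cocycle_nonzero[of "g \<otimes> h" z] cocycle_nonzero[of z "g \<otimes> h"]
     cocycle_nonzero[of "g \<otimes> z" h] cocycle_nonzero[of g "h \<otimes> z"]
  have "(\<alpha> g h * \<alpha> z (g \<otimes> h)) * (\<alpha> h z * \<alpha> g (h \<otimes> z)) * (\<alpha> g z * \<alpha> (g \<otimes> z) h)
      = (\<alpha> z g * \<alpha> (g \<otimes> z) h) * (\<alpha> g h * \<alpha> (g \<otimes> h) z) * (\<alpha> z h * \<alpha> g (h \<otimes> z))"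
    using 1 2 3 by simp
  then have "\<alpha> z (g \<otimes> h) * \<alpha> h z * \<alpha> g z = \<alpha> z g * \<alpha> (g \<otimes> h) z * \<alpha> z h"
    using n c by (simp add: ac_simps)
  then show ?thesis using n c by (simp add: comm_scalar_def field_simps)
qed

lemma comm_scalar_one_right: "z \<in> carrier G \<Longrightarrow> \<kappa> z \<one> = 1"
  using cocycle_nonzero cocycle_one[of z] by (simp add: comm_scalar_def)

lemma comm_scalar_pow_right:
  assumes "z \<in> carrier G" "g \<in> carrier G" "z \<otimes> g = g \<otimes> z"
  shows "\<kappa> z (g [^] (n::nat)) = \<kappa> z g ^ n"
proof (induction n)
  case 0 then show ?case using assms comm_scalar_one_right by simp
next
  case (Suc n)
  have "z \<otimes> g [^] n = g [^] n \<otimes> z" using group_commutes_pow assms by metis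
  then show ?case using assms Suc comm_scalar_mult_right[of z "g [^] n" g] by (simp add: mult.commute)
qed

lemma comm_scalar_mult_left:
  assumes "z \<in> carrier G" "w \<in> carrier G" "g \<in> carrier G" "z \<otimes> g = g \<otimes> z" "w \<otimes> g = g \<otimes> w"
  shows "\<kappa> (z \<otimes> w) g = \<kappa> z g * \<kappa> w g"
  using comm_scalar_mult_right[of g z w] assms comm_scalar_swap[of _ g] by simp

lemma comm_scalar_pow_left:
  assumes "z \<in> carrier G" "g \<in> carrier G" "z \<otimes> g = g \<otimes> z"
  shows "\<kappa> (z [^] (n::nat)) g = \<kappa> z g ^ n"
  using comm_scalar_pow_right[of g z n] assms comm_scalar_swap[of _ g] by (simp add: power_inverse)

text \<open>A character of the centralizer of \<open>g\<close> kills the commutators in it. The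
  point is that \<open>x\<close> and \<open>y\<close>, not only \<open>z\<close>, commute with
  \<open>g\<close>.\<close>

lemma comm_scalar_commutator:
  assumes "g \<in> carrier G" "x \<in> carrier G" "y \<in> carrier G" "z \<in> carrier G"
    and "x \<otimes> y = y \<otimes> x \<otimes> z" and c: "x \<otimes> g = g \<otimes> x" "y \<otimes> g = g \<otimes> y" "z \<otimes> g = g \<otimes> z"
  shows "\<kappa> z g = 1"
proof -
  have "y \<otimes> x \<otimes> g = g \<otimes> (y \<otimes> x)" using assms by (metis m_assoc)
  then have "\<kappa> (x \<otimes> y) g = \<kappa> y g * \<kappa> x g * \<kappa> z g"
    using assms comm_scalar_mult_left by simp
  then have "\<kappa> x g * \<kappa> y g = \<kappa> y g * \<kappa> x g * \<kappa> z g"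
    using comm_scalar_mult_left[OF assms(2,3,1) c(1,2)] by simp
  then show ?thesis using comm_scalar_nonzero[OF assms(2,1)] comm_scalar_nonzero[OF assms(3,1)] by simp
qed

lemma group_central_ext: "group (central_ext G \<alpha>)"
proof (rule groupI)
  fix s assume s: "s \<in> carrier (central_ext G \<alpha>)"
  let ?t = "(1 / (\<alpha> \<one> \<one> * fst s * \<alpha> (inv (snd s)) (snd s)), inv (snd s))"
  show "\<one>\<^bsub>central_ext G \<alpha>\<^esub> \<otimes>\<^bsub>central_ext G \<alpha>\<^esub> s = s"
    using s cocycle_nonzero cocycle_one[of "snd s"] by (auto simp: central_ext_def)
  show "\<exists>t\<in>carrier (central_ext G \<alpha>). t \<otimes>\<^bsub>central_ext G \<alpha>\<^esub> s = \<one>\<^bsub>central_ext G \<alpha>\<^esub>"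
    using s cocycle_nonzero by (intro bexI[of _ ?t]) (auto simp: central_ext_def field_simps)
next
  fix s t u
  assume c: "s \<in> carrier (central_ext G \<alpha>)" "t \<in> carrier (central_ext G \<alpha>)" "u \<in> carrier (central_ext G \<alpha>)"
  show "s \<otimes>\<^bsub>central_ext G \<alpha>\<^esub> t \<otimes>\<^bsub>central_ext G \<alpha>\<^esub> u
     = s \<otimes>\<^bsub>central_ext G \<alpha>\<^esub> (t \<otimes>\<^bsub>central_ext G \<alpha>\<^esub> u)"
    using c cocycle_eq[of "snd s" "snd t" "snd u"]
    by (auto simp: central_ext_def m_assoc algebra_simps)
qed (use cocycle_nonzero in \<open>auto simp: central_ext_def\<close>)

text \<open>The value of the scalar is immaterial: scalars are central in the extension and do not
  affect which lifts commute.\<close>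

lemma central_ext_commutator_lift:
  assumes "x \<in> carrier G" "g \<in> carrier G" "u \<in> carrier G" "x \<otimes> g = g \<otimes> x \<otimes> u"
  obtains c where "c \<noteq> 0"
    "(1, x) \<otimes>\<^bsub>central_ext G \<alpha>\<^esub> (1, g) = (1, g) \<otimes>\<^bsub>central_ext G \<alpha>\<^esub> (1, x) \<otimes>\<^bsub>central_ext G \<alpha>\<^esub> (c, u)"
proof
  show "\<alpha> x g / (\<alpha> g x * \<alpha> (g \<otimes> x) u) \<noteq> 0" using assms cocycle_nonzero by simp
qed (use assms cocycle_nonzero in \<open>auto simp: central_ext_def\<close>)

lemma central_ext_commute_iff:
  assumes "g \<in> carrier G" "h \<in> carrier G" "g \<otimes> h = h \<otimes> g" "c \<noteq> 0" "d \<noteq> 0"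
  shows "(c, g) \<otimes>\<^bsub>central_ext G \<alpha>\<^esub> (d, h) = (d, h) \<otimes>\<^bsub>central_ext G \<alpha>\<^esub> (c, g) \<longleftrightarrow> \<kappa> g h = 1"
  using assms cocycle_nonzero by (auto simp: central_ext_def comm_scalar_def)

text \<open>In G itself commutators are central and a double commutator says nothing, so
  \<open>three_commutator\<close> is applied to lifts. For arbitrary \<open>x\<close>, the
  commutators of \<open>x\<close> with \<open>g\<close> and with \<open>h\<close> lie in
  \<open>Z\<close>, and their lifts commute with those of \<open>h\<close> and \<open>g\<close> by
  the choice of \<open>g\<close> and \<open>h\<close>. Hence the lift of \<open>z\<close>, the
  commutator of \<open>g\<close> and \<open>h\<close>, commutes with the lift of \<open>x\<close>,
  that is, \<open>\<kappa> z x = 1\<close>.\<close>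

lemma kernel_commutative:
  assumes Z: "Z \<subseteq> group_center G"
    and Zab: "\<And>u v. u \<in> Z \<Longrightarrow> v \<in> Z \<Longrightarrow> \<kappa> u v = 1"
    and com: "\<And>g h. g \<in> carrier G \<Longrightarrow> h \<in> carrier G \<Longrightarrow> \<exists>u\<in>Z. g \<otimes> h = h \<otimes> g \<otimes> u"
    and nondeg: "\<And>z. z \<in> Z \<Longrightarrow> (\<And>g. g \<in> carrier G \<Longrightarrow> \<kappa> z g = 1) \<Longrightarrow> z = \<one>"
    and g: "g \<in> carrier G" "\<And>u. u \<in> Z \<Longrightarrow> \<kappa> u g = 1"
    and h: "h \<in> carrier G" "\<And>u. u \<in> Z \<Longrightarrow> \<kappa> u h = 1"
  shows "g \<otimes> h = h \<otimes> g"
proof -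
  let ?E = "central_ext G \<alpha>"
  interpret E: group ?E by (rule group_central_ext)
  have Zc: "u \<in> carrier G" "\<And>k. k \<in> carrier G \<Longrightarrow> u \<otimes> k = k \<otimes> u" if "u \<in> Z" for u
    using that Z by (auto simp: group_center_def)
  obtain z where z: "z \<in> Z" "g \<otimes> h = h \<otimes> g \<otimes> z" using com g h by blast
  have "\<kappa> z x = 1" if x: "x \<in> carrier G" for x
  proof -
    obtain u where u: "u \<in> Z" "x \<otimes> g = g \<otimes> x \<otimes> u" using com g x by blast
    obtain v where v: "v \<in> Z" "x \<otimes> h = h \<otimes> x \<otimes> v" using com h x by blast
    obtain c where c: "c \<noteq> 0" "(1, x) \<otimes>\<^bsub>?E\<^esub> (1, g) = (1, g) \<otimes>\<^bsub>?E\<^esub> (1, x) \<otimes>\<^bsub>?E\<^esub> (c, u)"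
      using central_ext_commutator_lift[OF x g(1) Zc(1) u(2)] u by blast
    obtain d where d: "d \<noteq> 0" "(1, x) \<otimes>\<^bsub>?E\<^esub> (1, h) = (1, h) \<otimes>\<^bsub>?E\<^esub> (1, x) \<otimes>\<^bsub>?E\<^esub> (d, v)"
      using central_ext_commutator_lift[OF x h(1) Zc(1) v(2)] v by blast
    obtain e where e: "e \<noteq> 0" "(1, g) \<otimes>\<^bsub>?E\<^esub> (1, h) = (1, h) \<otimes>\<^bsub>?E\<^esub> (1, g) \<otimes>\<^bsub>?E\<^esub> (e, z)"
      using central_ext_commutator_lift[OF g(1) h(1) Zc(1) z(2)] z by blast
    have "(e, z) \<otimes>\<^bsub>?E\<^esub> (1, x) = (1, x) \<otimes>\<^bsub>?E\<^esub> (e, z)"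
    proof (rule E.three_commutator[of "(1,x)" "(1,g)" "(1,h)" "(c,u)" "(d,v)" "(e,z)", OF _ _ _ _ _ _ c(2) d(2) e(2)])
      show "(c, u) \<otimes>\<^bsub>?E\<^esub> (1, h) = (1, h) \<otimes>\<^bsub>?E\<^esub> (c, u)"
        using central_ext_commute_iff c u h Zc by auto
      show "(d, v) \<otimes>\<^bsub>?E\<^esub> (1, g) = (1, g) \<otimes>\<^bsub>?E\<^esub> (d, v)"
        using central_ext_commute_iff d v g Zc by auto
      show "(c, u) \<otimes>\<^bsub>?E\<^esub> (d, v) = (d, v) \<otimes>\<^bsub>?E\<^esub> (c, u)"
        using central_ext_commute_iff c d u v Zab Zc by auto
      show "(c, u) \<otimes>\<^bsub>?E\<^esub> (e, z) = (e, z) \<otimes>\<^bsub>?E\<^esub> (c, u)"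
        using central_ext_commute_iff c e u z Zab Zc by auto
      show "(d, v) \<otimes>\<^bsub>?E\<^esub> (e, z) = (e, z) \<otimes>\<^bsub>?E\<^esub> (d, v)"
        using central_ext_commute_iff d e v z Zab Zc by auto
    qed (use c d e u v z g h x Zc in \<open>auto simp: central_ext_def\<close>)
    then show ?thesis using central_ext_commute_iff[of z x e 1] e z x Zc by simp
  qed
  then have "z = \<one>" using nondeg z by blast
  then show ?thesis using z g h by simp
qed

end

section \<open>The classification\<close>

context group
begin

lemma pow_pow_commute_twist:
  assumes c: "x \<in> carrier G" "y \<in> carrier G" "t \<in> carrier G"
    and xy: "x \<otimes> y = y \<otimes> x \<otimes> t" and tx: "t \<otimes> x = x \<otimes> t" and ty: "t \<otimes> y = y \<otimes> t"
  shows "x [^] (i::nat) \<otimes> y [^] (j::nat) = y [^] j \<otimes> x [^] i \<otimes> t [^] (i * j)"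
proof (induction j)
  case (Suc j)
  have cm: "t [^] k \<otimes> x = x \<otimes> t [^] k" "t [^] k \<otimes> y = y \<otimes> t [^] k" for k :: nat
    using c tx ty group_commutes_pow by simp_all
  have "x [^] i \<otimes> y [^] Suc j = y [^] j \<otimes> x [^] i \<otimes> (t [^] (i * j) \<otimes> y)"
    using Suc c by (simp flip: m_assoc)
  also have "\<dots> = y [^] j \<otimes> (x [^] i \<otimes> y) \<otimes> t [^] (i * j)" using c cm by (simp add: m_assoc)
  also have "\<dots> = y [^] Suc j \<otimes> x [^] i \<otimes> (t [^] i \<otimes> t [^] (i * j))"
    using c pow_commute_twist[OF c xy tx] by (simp add: m_assoc)
  finally show ?case using c by (simp add: nat_pow_mult)
qed (use c in simp)

lemma pow_mod:
  assumes "x \<in> carrier G" "x [^] N = \<one>"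
  shows "x [^] ((i::nat) mod N) = x [^] i"
proof -
  have "x [^] i = (x [^] N) [^] (i div N) \<otimes> x [^] (i mod N)"
    using assms(1) by (simp add: nat_pow_pow nat_pow_mult)
  then show ?thesis using assms by simp
qed

text \<open>The order of the factors in the normal form is dictated by the model: moving
  \<open>x [^] a\<close> past \<open>y [^] b'\<close> produces \<open>t [^] (a * b')\<close>, the
  bilinear term of \<open>heisenberg\<close>.\<close>

lemma iso_heisenberg:
  assumes N: "N > 0"
    and c: "x \<in> carrier G" "y \<in> carrier G" "t \<in> carrier G"
    and xy: "x \<otimes> y = y \<otimes> x \<otimes> t" and tx: "t \<otimes> x = x \<otimes> t" and ty: "t \<otimes> y = y \<otimes> t"
    and exps: "x [^] N = \<one>" "y [^] N = \<one>" "t [^] N = \<one>"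
    and inj: "\<And>(a::nat) (b::nat) (c::nat). y [^] b \<otimes> x [^] a \<otimes> t [^] c = \<one> \<Longrightarrow> N dvd a \<and> N dvd b \<and> N dvd c"
    and surj: "\<And>g. g \<in> carrier G \<Longrightarrow> \<exists>(a::nat) (b::nat) (c::nat). g = y [^] b \<otimes> x [^] a \<otimes> t [^] c"
  shows "G \<cong> heisenberg 1 N"
proof -
  let ?H = "heisenberg 1 N"
  define \<Phi> where "\<Phi> = (\<lambda>s::(nat \<Rightarrow> int) \<times> (nat \<Rightarrow> int) \<times> int.
     y [^] nat (fst (snd s) 0) \<otimes> x [^] nat (fst s 0) \<otimes> t [^] nat (snd (snd s)))"
  interpret H: group ?H using N by (rule group_heisenberg)
  have cm: "t [^] k \<otimes> x [^] l = x [^] l \<otimes> t [^] k" "t [^] k \<otimes> y [^] l = y [^] l \<otimes> t [^] k" for k l :: nat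
    using c tx ty group_commutes_pow by (metis nat_pow_closed)+
  have normal: "(y [^] b \<otimes> x [^] a \<otimes> t [^] e) \<otimes> (y [^] b' \<otimes> x [^] a' \<otimes> t [^] e')
      = y [^] (b + b') \<otimes> x [^] (a + a') \<otimes> t [^] (e + e' + a * b')" for a b e a' b' e' :: nat
  proof -
    have "(y [^] b \<otimes> x [^] a \<otimes> t [^] e) \<otimes> (y [^] b' \<otimes> x [^] a' \<otimes> t [^] e')
       = y [^] b \<otimes> x [^] a \<otimes> (t [^] e \<otimes> y [^] b') \<otimes> x [^] a' \<otimes> t [^] e'"
      using c by (simp add: m_assoc)
    also have "\<dots> = y [^] b \<otimes> (x [^] a \<otimes> y [^] b') \<otimes> (t [^] e \<otimes> x [^] a') \<otimes> t [^] e'"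
      unfolding cm(2)[of e b'] using c by (simp add: m_assoc)
    also have "\<dots> = y [^] b \<otimes> y [^] b' \<otimes> x [^] a \<otimes> (t [^] (a * b') \<otimes> x [^] a') \<otimes> t [^] e \<otimes> t [^] e'"
      unfolding cm(1)[of e a'] using pow_pow_commute_twist[OF c xy tx ty] c by (simp add: m_assoc)
    also have "\<dots> = (y [^] b \<otimes> y [^] b') \<otimes> (x [^] a \<otimes> x [^] a') \<otimes> (t [^] (a * b') \<otimes> t [^] e \<otimes> t [^] e')"
      unfolding cm(1)[of "a * b'" a'] using c by (simp add: m_assoc)
    finally show ?thesis using c by (simp add: nat_pow_mult ac_simps)
  qed
  have "\<Phi> \<in> hom ?H G"
  proof (rule homI)
    fix s s' assume s: "s \<in> carrier ?H" "s' \<in> carrier ?H"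
    obtain a b e where abe: "fst s 0 = int a" "fst (snd s) 0 = int b" "snd (snd s) = int e"
      using s nonneg_int_cases by (metis One_nat_def heisenberg_carrier lessI)
    obtain a' b' e' where abe': "fst s' 0 = int a'" "fst (snd s') 0 = int b'" "snd (snd s') = int e'"
      using s nonneg_int_cases by (metis One_nat_def heisenberg_carrier lessI)
    have "nat ((int a + int a') mod int N) = (a + a') mod N"
      "nat ((int b + int b') mod int N) = (b + b') mod N"
      "nat ((int e + int e' + int a * int b') mod int N) = (e + e' + a * b') mod N"
      by (metis nat_int of_nat_add of_nat_mod of_nat_mult)+
    then show "\<Phi> (s \<otimes>\<^bsub>?H\<^esub> s') = \<Phi> s \<otimes> \<Phi> s'"
      using exps c abe abe' by (simp add: \<Phi>_def heisenberg_simps normal pow_mod)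
  qed (use c in \<open>simp add: \<Phi>_def\<close>)
  moreover have "carrier G \<subseteq> \<Phi> ` carrier ?H"
  proof
    fix g assume "g \<in> carrier G"
    from surj[OF this] obtain a b e :: nat where g: "g = y [^] b \<otimes> x [^] a \<otimes> t [^] e" by blast
    let ?s = "((\<lambda>i::nat. if i = 0 then int (a mod N) else 0), (\<lambda>i::nat. if i = 0 then int (b mod N) else 0), int (e mod N))"
    have "?s \<in> carrier ?H" using N by (simp add: heisenberg_carrier)
    moreover have "\<Phi> ?s = g" using c exps g by (simp add: \<Phi>_def pow_mod)
    ultimately show "g \<in> \<Phi> ` carrier ?H" by blast
  qed
  moreover have "s = \<one>\<^bsub>?H\<^esub>" if s: "s \<in> carrier ?H" "\<Phi> s = \<one>" for s
  proof -
    have *: "0 \<le> fst s 0" "fst s 0 < int N" "0 \<le> fst (snd s) 0" "fst (snd s) 0 < int N"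
       "0 \<le> snd (snd s)" "snd (snd s) < int N" "\<forall>i\<ge>1. fst s i = 0" "\<forall>i\<ge>1. fst (snd s) i = 0"
      using s by (auto simp: heisenberg_carrier)
    have "N dvd nat (fst s 0)" "N dvd nat (fst (snd s) 0)" "N dvd nat (snd (snd s))"
      using inj s(2) unfolding \<Phi>_def by blast+
    then have z: "fst s 0 = 0" "fst (snd s) 0 = 0" "snd (snd s) = 0"
      using * by (auto dest!: dvd_imp_le)
    have "fst s = (\<lambda>_. 0)" "fst (snd s) = (\<lambda>_. 0)"
      using z * by (auto simp: fun_eq_iff) (metis One_nat_def Suc_leI not_gr0)+
    then show ?thesis using z(3) by (simp add: heisenberg_simps prod_eq_iff)
  qed
  ultimately have "\<Phi> \<in> iso ?H G"
    using group_hom.iso_iff[of ?H G \<Phi>] is_group H.is_group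
    by (auto simp: group_hom_def group_hom_axioms_def)
  then have "?H \<cong> G" by (auto simp: is_iso_def)
  then show ?thesis by (rule H.iso_sym)
qed

end

context group_cocycle
begin

text \<open>The representation enters only through \<open>nondeg\<close>, and the class of the group
  only through \<open>com\<close>. The trivial group is excluded because it would be the case
  \<open>k = 0\<close>.\<close>

lemma classification:
  assumes p: "Factorial_Ring.prime p" "odd p"
    and fin: "finite (carrier G)" "Coset.order G = p ^ e" and nontriv: "carrier G \<noteq> {\<one>}"
    and \<zeta>: "\<zeta> \<in> carrier G" and Z: "group_center G = range (\<lambda>n::nat. \<zeta> [^] n)"
    and com: "\<And>g h. g \<in> carrier G \<Longrightarrow> h \<in> carrier G \<Longrightarrow> \<exists>u\<in>group_center G. g \<otimes> h = h \<otimes> g \<otimes> u"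
    and nondeg: "\<And>z. z \<in> group_center G \<Longrightarrow> (\<And>g. g \<in> carrier G \<Longrightarrow> \<kappa> z g = 1) \<Longrightarrow> z = \<one>"
  shows "\<exists>k\<ge>1. G \<cong> heisenberg 1 (p ^ k)"
proof -
  let ?Z = "group_center G"
  have Zc: "u \<in> carrier G" "\<And>g. g \<in> carrier G \<Longrightarrow> u \<otimes> g = g \<otimes> u" if "u \<in> ?Z" for u
    using that by (auto simp: group_center_def)
  have Zpow: "\<exists>n::nat. u = \<zeta> [^] n" if "u \<in> ?Z" for u using that Z by blast
  have \<zeta>Z: "\<zeta> [^] n \<in> ?Z" for n :: nat using Z by blast
  have \<zeta>c: "\<zeta> \<otimes> g = g \<otimes> \<zeta>" if "g \<in> carrier G" for g
    using Zc(2)[OF \<zeta>Z[of 1]] that \<zeta> by simp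
  obtain k where k: "ord \<zeta> = p ^ k"
    using ord_dvd_group_order[OF \<zeta>] fin(2) divides_primepow_nat[OF p(1)] by auto
  define N where "N = p ^ k"
  have p0: "p > 0" using p by (simp add: prime_gt_0_nat)
  then have N0: "N > 0" by (simp add: N_def)
  have oddN: "odd N" using p by (simp add: N_def)
  have \<zeta>N: "\<zeta> [^] N = \<one>" using pow_eq_id[OF \<zeta>] k N_def by simp
  have ZN: "u [^] N = \<one>" if u: "u \<in> ?Z" for u
  proof -
    obtain n :: nat where "u = \<zeta> [^] n" using Zpow[OF u] by blast
    then show ?thesis using \<zeta> \<zeta>N by (metis mult.commute nat_pow_one nat_pow_pow)
  qed
  \<comment> \<open>With trivial centre all commutators vanish, so G equals its centre and is itself
    trivial.\<close>
  have k1: "k \<ge> 1"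
  proof (rule ccontr)
    assume "\<not> k \<ge> 1"
    then have "\<zeta> = \<one>" using k ord_eq_1 \<zeta> by (simp add: not_le)
    then have Z1: "?Z = {\<one>}" using Z by auto
    have "g \<otimes> h = h \<otimes> g" if "g \<in> carrier G" "h \<in> carrier G" for g h
      using com[OF that] Z1 that by simp
    then have "carrier G = ?Z" by (auto simp: group_center_def)
    then show False using Z1 nontriv by simp
  qed
  have k1lt: "\<not> p ^ k dvd p ^ (k - 1)"
    using k1 prime_gt_1_nat[OF p(1)] by (auto dest!: dvd_imp_le simp: not_le p0)
  let ?M = "p ^ (k - 1)"
  \<comment> \<open>\<open>\<zeta> [^] ?M\<close> generates the subgroup of order \<open>p\<close>
    of the centre. An \<open>x\<close> that pairs nontrivially with it has
    \<open>\<chi> x ^ ?M \<noteq> 1\<close>, so \<open>\<chi> x\<close> is a primitive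
    \<open>N\<close>-th root of unity.\<close>
  have \<zeta>M: "\<zeta> [^] ?M \<noteq> \<one>" using pow_eq_id[OF \<zeta>] k k1lt by simp
  then obtain x where x: "x \<in> carrier G" "\<kappa> (\<zeta> [^] ?M) x \<noteq> 1"
    using nondeg[OF \<zeta>Z] by blast
  define \<chi> where "\<chi> g = \<kappa> \<zeta> g" for g
  have \<chi>_mult: "\<chi> (g \<otimes> h) = \<chi> g * \<chi> h" if "g \<in> carrier G" "h \<in> carrier G" for g h
    using comm_scalar_mult_right that \<zeta> \<zeta>c by (simp add: \<chi>_def)
  have \<chi>_pow: "\<chi> (g [^] n) = \<chi> g ^ n" if "g \<in> carrier G" for g and n :: nat
    using comm_scalar_pow_right that \<zeta> \<zeta>c by (simp add: \<chi>_def)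
  have \<chi>_nz: "\<chi> g \<noteq> 0" if "g \<in> carrier G" for g
    using comm_scalar_nonzero that \<zeta> by (simp add: \<chi>_def)
  have \<chi>_inv: "\<chi> (inv g) = inverse (\<chi> g)" if "g \<in> carrier G" for g
  proof -
    have "\<chi> (inv g) * \<chi> g = 1" using \<chi>_mult[of "inv g" g] comm_scalar_one_right that \<zeta> by (simp add: \<chi>_def)
    then show ?thesis by (metis inverse_unique mult.commute)
  qed
  have \<kappa>pow: "\<kappa> (\<zeta> [^] n) g = \<chi> g ^ n" if "g \<in> carrier G" for g and n :: nat
    using comm_scalar_pow_left that \<zeta> \<zeta>c by (simp add: \<chi>_def)
  have \<chi>\<zeta>: "\<chi> \<zeta> = 1" using comm_scalar_self \<zeta> by (simp add: \<chi>_def)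
  have \<chi>Z: "\<chi> u = 1" if "u \<in> ?Z" for u using Zpow[OF that] \<chi>_pow \<chi>\<zeta> \<zeta> by auto
  have \<chi>N: "\<chi> g ^ N = 1" if "g \<in> carrier G" for g
    using \<kappa>pow[OF that, of N] \<zeta>N comm_scalar_swap[of \<one> g] comm_scalar_one_right[OF that] by simp
  have xprim: "\<chi> x ^ i = 1 \<longleftrightarrow> N dvd i" for i
    unfolding N_def by (rule prime_power_order[OF p(1)]) (use \<chi>N x \<kappa>pow N_def in auto)
  define K where "K = {g \<in> carrier G. \<chi> g = 1}"
  have Kc: "g \<in> carrier G" if "g \<in> K" for g using that by (simp add: K_def)
  have ZK: "?Z \<subseteq> K" using \<chi>Z Zc by (auto simp: K_def)
  have Kab: "g \<otimes> h = h \<otimes> g" if gh: "g \<in> K" "h \<in> K" for g h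
  proof (rule kernel_commutative[of ?Z, OF order_refl _ com nondeg])
    have tr: "\<kappa> u g = 1" if "u \<in> ?Z" "\<chi> g = 1" "g \<in> carrier G" for u g
      using Zpow[OF that(1)] \<kappa>pow that by auto
    show "\<kappa> u v = 1" if "u \<in> ?Z" "v \<in> ?Z" for u v using that tr \<chi>Z Zc by blast
    show "\<kappa> u g = 1" "\<kappa> u h = 1" if "u \<in> ?Z" for u using that tr gh by (auto simp: K_def)
  qed (use gh K_def in auto)
  have decomp: "\<exists>a::nat. g \<otimes> inv (x [^] a) \<in> K" if g: "g \<in> carrier G" for g
  proof -
    obtain a where "\<chi> g = \<chi> x ^ a" using root_of_unity_eq_power[OF xprim N0 \<chi>N[OF g]] by blast
    then have "\<chi> (g \<otimes> inv (x [^] a)) = 1"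
      using \<chi>_mult \<chi>_inv \<chi>_pow \<chi>_nz g x by simp
    then show ?thesis using g x by (auto simp: K_def)
  qed
  have centralI: "w \<in> ?Z" if w: "w \<in> carrier G" "w \<otimes> x = x \<otimes> w" "\<And>g. g \<in> K \<Longrightarrow> w \<otimes> g = g \<otimes> w" for w
  proof -
    have "w \<otimes> g = g \<otimes> w" if g: "g \<in> carrier G" for g
    proof -
      obtain a :: nat where a: "g \<otimes> inv (x [^] a) \<in> K" using decomp g by blast
      define h where "h = g \<otimes> inv (x [^] a)"
      have h: "h \<in> carrier G" "w \<otimes> h = h \<otimes> w" "g = h \<otimes> x [^] a"
        using a w Kc g x by (auto simp: h_def m_assoc)
      have "w \<otimes> x [^] a = x [^] a \<otimes> w" using group_commutes_pow[of x w a] w x by simp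
      then show ?thesis using h w x by (metis m_assoc nat_pow_closed)
    qed
    then show ?thesis using w by (simp add: group_center_def)
  qed
  have twist: "g [^] n \<otimes> h = h \<otimes> g [^] n \<otimes> u [^] n"
    if "g \<in> carrier G" "h \<in> carrier G" "u \<in> ?Z" "g \<otimes> h = h \<otimes> g \<otimes> u" for g h u and n :: nat
    using pow_commute_twist[of g h u n] that Zc by simp
  have expo: "g [^] N = \<one>" if g: "g \<in> carrier G" "\<chi> g = \<chi> x" for g
  proof -
    have "g [^] N \<otimes> h = h \<otimes> g [^] N" if h: "h \<in> carrier G" for h
    proof -
      obtain u where u: "u \<in> ?Z" "g \<otimes> h = h \<otimes> g \<otimes> u" using com g h by blast
      then show ?thesis using twist[OF g(1) h u, of N] ZN[OF u(1)] g h by simp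
    qed
    then have "g [^] N \<in> ?Z" using g by (simp add: group_center_def)
    then obtain n where n: "g [^] N = \<zeta> [^] (n::nat)" using Zpow by blast
    have "\<chi> x ^ n = \<kappa> (g [^] N) g" using n g \<kappa>pow by simp
    also have "\<dots> = 1" using comm_scalar_pow_left[of g g N] g comm_scalar_self by simp
    finally have "N dvd n" using xprim by simp
    then show ?thesis using n pow_eq_id \<zeta> k N_def by simp
  qed
  have "\<exists>y\<in>K. \<exists>t\<in>?Z. x \<otimes> y = y \<otimes> x \<otimes> t \<and> t [^] ?M \<noteq> \<one>"
  proof (rule ccontr)
    assume neg: "\<not> ?thesis"
    have "x [^] ?M \<otimes> g = g \<otimes> x [^] ?M" if g: "g \<in> K" for g
    proof -
      obtain u where u: "u \<in> ?Z" "x \<otimes> g = g \<otimes> x \<otimes> u" using com g x Kc by blast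
      then have "u [^] ?M = \<one>" using neg g by blast
      then show ?thesis using twist[OF x(1) Kc[OF g] u, of ?M] g x Kc by simp
    qed
    moreover have "x [^] ?M \<otimes> x = x \<otimes> x [^] ?M" using group_commutes_pow x by blast
    ultimately have "x [^] ?M \<in> ?Z" using centralI x by simp
    then have "\<chi> x ^ ?M = 1" using \<chi>Z \<chi>_pow x by metis
    then show False using xprim k1lt N_def by simp
  qed
  then obtain y t where y: "y \<in> K" and t: "t \<in> ?Z" and xy: "x \<otimes> y = y \<otimes> x \<otimes> t" and tM: "t [^] ?M \<noteq> \<one>"
    by blast
  note c = x(1) Kc[OF y] Zc(1)[OF t]
  note tx = Zc(2)[OF t c(1)] and ty = Zc(2)[OF t c(2)]
  have t1: "t [^] i = \<one> \<longleftrightarrow> N dvd i" for i :: nat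
    unfolding N_def by (rule prime_power_pow_eq_one[OF p(1) c(3) _ tM]) (use ZN t N_def in simp)
  have tgen: "\<exists>n::nat. u = t [^] n" if u: "u \<in> ?Z" for u
  proof -
    have ordt: "ord t = N" using t1 pow_eq_id[OF c(3)] by (metis dvd_antisym dvd_refl)
    have "generate G {t} = generate G {\<zeta>}"
    proof (rule card_subset_eq)
      show "finite (generate G {\<zeta>})"
        using fin generate_in_carrier[of "{\<zeta>}"] \<zeta> by (auto intro: finite_subset[of _ "carrier G"])
      show "generate G {t} \<subseteq> generate G {\<zeta>}"
      proof (rule generate_subgroup_incl)
        show "subgroup (generate G {\<zeta>}) G" using \<zeta> by (simp add: generate_is_subgroup)
        show "{t} \<subseteq> generate G {\<zeta>}"
          using Zpow[OF t] generate_pow_on_finite_carrier[OF fin(1) \<zeta>] by auto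
      qed
      show "card (generate G {t}) = card (generate G {\<zeta>})"
        using generate_pow_card[of t] generate_pow_card[of \<zeta>] ordt k N_def c \<zeta> by simp
    qed
    then show ?thesis
      using generate_pow_on_finite_carrier[OF fin(1) \<zeta>] generate_pow_on_finite_carrier[OF fin(1) c(3)] Zpow[OF u]
      by blast
  qed
  have xN: "x [^] N = \<one>" using expo x by blast
  have "\<chi> (y \<otimes> x) = \<chi> x" using \<chi>_mult c y by (simp add: K_def)
  then have "\<one> = (y \<otimes> x) [^] N" using expo c by simp
  also have "\<dots> = y [^] N \<otimes> x [^] N \<otimes> t [^] (N * (N - 1) div 2)"
    by (rule pow_mult_twist[OF c xy tx ty])
  also have "t [^] (N * (N - 1) div 2) = \<one>"
  proof -
    have "N * (N - 1) div 2 = N * ((N - 1) div 2)" using oddN by (auto elim!: oddE)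
    then show ?thesis using t1 by simp
  qed
  finally have yN: "y [^] N = \<one>" using xN c by simp
  have "G \<cong> heisenberg 1 N"
  proof (rule iso_heisenberg[OF N0 c xy tx ty xN yN])
    show "t [^] N = \<one>" using t1 by simp
    show "N dvd a \<and> N dvd b \<and> N dvd e" if 1: "y [^] b \<otimes> x [^] a \<otimes> t [^] e = \<one>" for a b e :: nat
    proof -
      have "\<chi> (y [^] b \<otimes> x [^] a \<otimes> t [^] e) = \<chi> x ^ a"
        using \<chi>_mult \<chi>_pow c y t \<chi>Z by (simp add: K_def)
      moreover have "\<chi> \<one> = 1" using comm_scalar_one_right \<zeta> by (simp add: \<chi>_def)
      ultimately have a: "N dvd a" using 1 xprim by simp
      then have "x [^] a = \<one>" using xN c by (auto simp flip: nat_pow_pow elim!: dvdE)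
      then have yt: "y [^] b \<otimes> t [^] e = \<one>" using 1 c by simp
      \<comment> \<open>The product \<open>y [^] b \<otimes> t [^] e\<close> is
        \<open>\<one>\<close>, yet moving \<open>x\<close> across it produces
        \<open>t [^] b\<close>, which must therefore be trivial.\<close>
      have "x \<otimes> (y [^] b \<otimes> t [^] e) = y [^] b \<otimes> x \<otimes> t [^] b \<otimes> t [^] e"
        using pow_pow_commute_twist[OF c xy tx ty, of 1 b] c by (simp flip: m_assoc)
      also have "\<dots> = y [^] b \<otimes> (t [^] b \<otimes> t [^] e \<otimes> x)"
        using group_commutes_pow[OF tx, of "b + e"] c by (simp add: m_assoc nat_pow_mult)
      also have "\<dots> = y [^] b \<otimes> t [^] e \<otimes> t [^] b \<otimes> x"
        using c by (simp add: m_assoc nat_pow_mult add.commute flip: m_assoc[of "t [^] _" "t [^] _" x])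
      finally have "t [^] b = \<one>" using yt c by simp
      then have b: "N dvd b" using t1 by simp
      then have "y [^] b = \<one>" using yN c by (auto simp flip: nat_pow_pow elim!: dvdE)
      then have "t [^] e = \<one>" using yt c by simp
      then show ?thesis using a b t1 by simp
    qed
    show "\<exists>(a::nat) (b::nat) (e::nat). g = y [^] b \<otimes> x [^] a \<otimes> t [^] e" if g: "g \<in> carrier G" for g
    proof -
      obtain a :: nat where a: "g \<otimes> inv (x [^] a) \<in> K" using decomp g by blast
      define h where "h = g \<otimes> inv (x [^] a)"
      have h: "h \<in> K" "h \<in> carrier G" using a Kc by (auto simp: h_def)
      obtain u where u: "u \<in> ?Z" "x \<otimes> h = h \<otimes> x \<otimes> u" using com x h by blast
      obtain b :: nat where b: "u = t [^] b" using tgen u by blast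
      \<comment> \<open>\<open>h\<close> and \<open>y [^] b\<close> have the same commutator with
        \<open>x\<close>, so their quotient commutes with \<open>x\<close>; it also lies in the
        abelian \<open>K\<close> and is therefore central.\<close>
      define w where "w = inv (y [^] b) \<otimes> h"
      have w: "w \<in> carrier G" "h = y [^] b \<otimes> w" using h c by (auto simp: w_def simp flip: m_assoc)
      have "w \<in> ?Z"
      proof (rule centralI[OF w(1)])
        have tb: "t [^] b \<otimes> v = v \<otimes> t [^] b" if "v \<in> carrier G" for v
          using u b Zc that by blast
        have "y [^] b \<otimes> x \<otimes> t [^] b \<otimes> w = x \<otimes> h"
          using pow_pow_commute_twist[OF c xy tx ty, of 1 b] c w by (simp flip: m_assoc)
        also have "\<dots> = y [^] b \<otimes> w \<otimes> x \<otimes> t [^] b" using u b w by simp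
        finally have "y [^] b \<otimes> (x \<otimes> w) \<otimes> t [^] b = y [^] b \<otimes> (w \<otimes> x) \<otimes> t [^] b"
          using tb[of w] c w by (simp add: m_assoc)
        then show "w \<otimes> x = x \<otimes> w" using c w by simp
        have "w \<in> K"
          using \<chi>_mult \<chi>_inv \<chi>_pow h y c w(1) by (simp add: K_def w_def)
        then show "w \<otimes> g = g \<otimes> w" if "g \<in> K" for g using Kab that by blast
      qed
      then obtain e :: nat where e: "w = t [^] e" using tgen by blast
      have "x [^] a \<otimes> t [^] e = t [^] e \<otimes> x [^] a"
        using group_commutes_pow[of "t [^] e" x a] group_commutes_pow[OF tx, of e] c
        by (simp add: group_commutes_pow)
      moreover have "g = h \<otimes> x [^] a" using g c by (simp add: h_def m_assoc)
      ultimately have "g = y [^] b \<otimes> x [^] a \<otimes> t [^] e"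
        using w e c by (simp add: m_assoc)
      then show ?thesis by blast
    qed
  qed
  then show ?thesis using k1 N_def by blast
qed

end

section \<open>Common eigenvectors of commuting matrices\<close>

text \<open>This is f(M) v, evaluated by Horner's scheme on vectors. Polynomial identities then hold
  vector by vector, and iterates of multiplication by \<open>M\<close> replace matrix
  powers.\<close>

definition poly_act :: "'a::field mat \<Rightarrow> 'a poly \<Rightarrow> 'a vec \<Rightarrow> 'a vec" where
  "poly_act M f v = fold_coeffs (\<lambda>a w. a \<cdot>\<^sub>v v + M *\<^sub>v w) f (0\<^sub>v (dim_vec v))"

definition lin_subspace :: "nat \<Rightarrow> 'a::field vec set \<Rightarrow> bool" where
  "lin_subspace m W \<longleftrightarrow> W \<subseteq> carrier_vec m \<and> 0\<^sub>v m \<in> W \<and>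
     (\<forall>v\<in>W. \<forall>w\<in>W. v + w \<in> W) \<and> (\<forall>c. \<forall>v\<in>W. c \<cdot>\<^sub>v v \<in> W)"

lemma mult_mat_zero_vec: "(M::'a::field mat) \<in> carrier_mat m m \<Longrightarrow> M *\<^sub>v 0\<^sub>v m = 0\<^sub>v m"
  by (intro eq_vecI) auto

context
  fixes M :: "'a::field mat" and m :: nat
  assumes M: "M \<in> carrier_mat m m"
begin

lemma poly_act_0: "v \<in> carrier_vec m \<Longrightarrow> poly_act M 0 v = 0\<^sub>v m"
  by (simp add: poly_act_def)

lemma poly_act_pCons:
  assumes v: "v \<in> carrier_vec m"
  shows "poly_act M (pCons a f) v = a \<cdot>\<^sub>v v + M *\<^sub>v poly_act M f v"
proof (cases "a = 0 \<and> f = 0")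
  case True
  have "0 \<cdot>\<^sub>v v + M *\<^sub>v 0\<^sub>v m = 0\<^sub>v m" using v mult_mat_zero_vec[OF M] by auto
  then show ?thesis using True v by (simp add: poly_act_def)
next
  case False
  then show ?thesis using v by (cases "a = 0") (simp_all add: poly_act_def)
qed

lemma poly_act_carrier:
  assumes v: "v \<in> carrier_vec m"
  shows "poly_act M f v \<in> carrier_vec m"
  by (induction f) (use M v in \<open>simp_all add: poly_act_0 poly_act_pCons\<close>)

lemma poly_act_mem:
  assumes W: "lin_subspace m W" and inv: "\<And>w. w \<in> W \<Longrightarrow> M *\<^sub>v w \<in> W" and v: "v \<in> W"
  shows "poly_act M f v \<in> W"
proof -
  have "v \<in> carrier_vec m" using W v by (auto simp: lin_subspace_def)
  then show ?thesis
    by (induction f) (use W v inv in \<open>simp_all add: poly_act_0 poly_act_pCons lin_subspace_def\<close>)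
qed

lemma poly_act_add:
  assumes v: "v \<in> carrier_vec m"
  shows "poly_act M (f + g) v = poly_act M f v + poly_act M g v"
proof (induction f g rule: poly_induct2)
  case (pCons a f b g)
  note c = poly_act_carrier[OF v, of f] poly_act_carrier[OF v, of g]
  have "poly_act M (pCons a f + pCons b g) v
      = (a + b) \<cdot>\<^sub>v v + (M *\<^sub>v poly_act M f v + M *\<^sub>v poly_act M g v)"
    using v M pCons c by (simp add: poly_act_pCons mult_add_distrib_mat_vec)
  also have "\<dots> = (a \<cdot>\<^sub>v v + M *\<^sub>v poly_act M f v) + (b \<cdot>\<^sub>v v + M *\<^sub>v poly_act M g v)"
    using v M c by (intro eq_vecI) (auto simp: algebra_simps simp del: index_mult_mat_vec)
  finally show ?case using v by (simp add: poly_act_pCons)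
qed (use v in \<open>simp add: poly_act_0\<close>)

lemma poly_act_smult:
  assumes v: "v \<in> carrier_vec m"
  shows "poly_act M (smult c f) v = c \<cdot>\<^sub>v poly_act M f v"
proof (induction f)
  case (pCons a f)
  note c = poly_act_carrier[OF v, of f]
  then show ?case using v M pCons
    by (simp add: poly_act_pCons mult_mat_vec smult_add_distrib_vec[of _ m] smult_smult_assoc)
qed (use v in \<open>auto simp: poly_act_0\<close>)

lemma poly_act_mult:
  assumes v: "v \<in> carrier_vec m"
  shows "poly_act M (f * g) v = poly_act M f (poly_act M g v)"
proof (induction f)
  case (pCons a f)
  note c = poly_act_carrier[OF v, of g]
  have 0: "0 \<cdot>\<^sub>v v + M *\<^sub>v w = M *\<^sub>v w" if "w \<in> carrier_vec m" for w
    using v M that by (intro eq_vecI) (auto simp del: index_mult_mat_vec)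
  show ?case using v c poly_act_carrier[OF v, of "f * g"] pCons
    by (simp add: poly_act_add poly_act_smult poly_act_pCons 0 del: smult_0_left)
qed (use v poly_act_carrier[OF v, of g] in \<open>simp add: poly_act_0\<close>)

lemma poly_act_add_vec:
  assumes v: "v \<in> carrier_vec m" "w \<in> carrier_vec m"
  shows "poly_act M f (v + w) = poly_act M f v + poly_act M f w"
proof (induction f)
  case (pCons a f)
  note c = poly_act_carrier[OF v(1), of f] poly_act_carrier[OF v(2), of f]
  have "poly_act M (pCons a f) (v + w)
      = a \<cdot>\<^sub>v (v + w) + (M *\<^sub>v poly_act M f v + M *\<^sub>v poly_act M f w)"
    using v M pCons c by (simp add: poly_act_pCons mult_add_distrib_mat_vec)
  also have "\<dots> = (a \<cdot>\<^sub>v v + M *\<^sub>v poly_act M f v) + (a \<cdot>\<^sub>v w + M *\<^sub>v poly_act M f w)"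
    using v M c by (intro eq_vecI) (auto simp: algebra_simps simp del: index_mult_mat_vec)
  finally show ?case using v by (simp add: poly_act_pCons)
qed (use v in \<open>simp add: poly_act_0\<close>)

lemma poly_act_commute:
  assumes v: "v \<in> carrier_vec m" and B: "B \<in> carrier_mat m m"
    and com: "\<And>v. v \<in> carrier_vec m \<Longrightarrow> M *\<^sub>v (B *\<^sub>v v) = B *\<^sub>v (M *\<^sub>v v)"
  shows "poly_act M f (B *\<^sub>v v) = B *\<^sub>v poly_act M f v"
proof (induction f)
  case 0
  then show ?case using v B mult_mat_zero_vec[OF B] by (simp add: poly_act_0)
next
  case (pCons a f)
  note c = poly_act_carrier[OF v, of f]
  then show ?case using v B M pCons com
    by (simp add: poly_act_pCons mult_mat_vec mult_add_distrib_mat_vec[OF B])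
qed

lemma poly_act_smult_vec:
  assumes v: "v \<in> carrier_vec m"
  shows "poly_act M f (c \<cdot>\<^sub>v v) = c \<cdot>\<^sub>v poly_act M f v"
proof (induction f)
  case (pCons a f)
  note c = poly_act_carrier[OF v, of f]
  then show ?case using v M pCons
    by (simp add: poly_act_pCons mult_mat_vec smult_add_distrib_vec[of _ m] smult_smult_assoc mult.commute)
qed (use v in \<open>auto simp: poly_act_0\<close>)

lemma poly_act_eigenvector:
  assumes v: "v \<in> carrier_vec m" and ev: "M *\<^sub>v v = \<mu> \<cdot>\<^sub>v v"
  shows "poly_act M f v = poly f \<mu> \<cdot>\<^sub>v v"
proof (induction f)
  case 0
  then show ?case using v by (auto simp: poly_act_0)
next
  case (pCons a f)
  then show ?case using v M ev
    by (simp add: poly_act_pCons mult_mat_vec add_smult_distrib_vec smult_smult_assoc mult.commute)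
qed

lemma funpow_mult_mat_vec_carrier:
  "v \<in> carrier_vec m \<Longrightarrow> ((*\<^sub>v) M ^^ n) v \<in> carrier_vec m"
  by (induction n) (use M in auto)

lemma poly_act_monom:
  assumes v: "v \<in> carrier_vec m"
  shows "poly_act M (monom 1 n) v = ((*\<^sub>v) M ^^ n) v"
proof (induction n)
  case 0
  then show ?case using v mult_mat_zero_vec[OF M] by (simp add: monom_0 poly_act_0 poly_act_pCons)
next
  case (Suc n)
  have "0 \<cdot>\<^sub>v v + M *\<^sub>v w = M *\<^sub>v w" if "w \<in> carrier_vec m" for w
    using v M that by (intro eq_vecI) (auto simp del: index_mult_mat_vec)
  then show ?case using Suc v funpow_mult_mat_vec_carrier[OF v, of n]
    by (simp add: monom_Suc poly_act_pCons)
qed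

lemma poly_act_const:
  assumes v: "v \<in> carrier_vec m"
  shows "poly_act M [:c:] v = c \<cdot>\<^sub>v v"
  using v mult_mat_zero_vec[OF M] by (simp add: poly_act_0 poly_act_pCons)

lemma poly_act_binomial:
  assumes v: "v \<in> carrier_vec m"
  shows "poly_act M (monom 1 n - [:d:]) v = ((*\<^sub>v) M ^^ n) v + (- d) \<cdot>\<^sub>v v"
proof -
  have "monom 1 n - [:d:] = monom 1 n + [:- d:]" by simp
  then show ?thesis using v by (simp only: poly_act_add poly_act_monom poly_act_const)
qed

end

lemma funpow_eigenvector:
  fixes M :: "'a::field mat"
  assumes M: "M \<in> carrier_mat m m" and v: "v \<in> carrier_vec m" and ev: "M *\<^sub>v v = \<mu> \<cdot>\<^sub>v v"
  shows "((*\<^sub>v) M ^^ n) v = \<mu> ^ n \<cdot>\<^sub>v v"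
  using poly_act_monom[OF M v, of n] poly_act_eigenvector[OF M v ev, of "monom 1 n"]
  by (simp add: poly_monom)

lemma smult_vec_eq_zero:
  assumes "c \<cdot>\<^sub>v v = 0\<^sub>v m" "v \<in> carrier_vec m" "v \<noteq> 0\<^sub>v m"
  shows "(c::'a::field) = 0"
proof (rule ccontr)
  assume "c \<noteq> 0"
  have "v = 0\<^sub>v m"
  proof (rule eq_vecI)
    fix i assume i: "i < dim_vec (0\<^sub>v m :: 'a vec)"
    then have "c * v $ i = 0" using assms by (metis carrier_vecD index_smult_vec(1) index_zero_vec)
    then show "v $ i = 0\<^sub>v m $ i" using \<open>c \<noteq> 0\<close> i by simp
  qed (use assms in auto)
  then show False using assms by simp
qed

lemma smult_vec_cancel:
  assumes "c \<cdot>\<^sub>v v = d \<cdot>\<^sub>v v" "v \<in> carrier_vec m" "v \<noteq> 0\<^sub>v m"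
  shows "(c::'a::field) = d"
proof -
  have "(c - d) \<cdot>\<^sub>v v = 0\<^sub>v m"
  proof (rule eq_vecI)
    fix i assume "i < dim_vec (0\<^sub>v m :: 'a vec)"
    then have "c * v $ i = d * v $ i" using assms by (metis carrier_vecD index_smult_vec(1) index_zero_vec(2))
    then show "((c - d) \<cdot>\<^sub>v v) $ i = 0\<^sub>v m $ i"
      using \<open>i < _\<close> assms(2) by (simp add: algebra_simps)
  qed (use assms in auto)
  then show ?thesis using smult_vec_eq_zero assms by fastforce
qed

text \<open>A polynomial of minimal degree annihilating a vector of \<open>W\<close> has a root, and the
  complementary factor maps the vector to an eigenvector.\<close>

lemma eigenvector_in_subspace:
  fixes M :: "complex mat"
  assumes M: "M \<in> carrier_mat m m" and W: "lin_subspace m W"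
    and inv: "\<And>w. w \<in> W \<Longrightarrow> M *\<^sub>v w \<in> W"
    and fin: "\<And>w. w \<in> W \<Longrightarrow> ((*\<^sub>v) M ^^ N) w = d \<cdot>\<^sub>v w" and N: "N > 0"
    and w: "w \<in> W" "w \<noteq> 0\<^sub>v m"
  obtains v \<mu> where "v \<in> W" "v \<noteq> 0\<^sub>v m" "M *\<^sub>v v = \<mu> \<cdot>\<^sub>v v"
proof -
  have wc: "w \<in> carrier_vec m" using W w by (auto simp: lin_subspace_def)
  let ?P = "\<lambda>f. f \<noteq> 0 \<and> poly_act M f w = 0\<^sub>v m"
  \<comment> \<open>\<open>X ^ N - d\<close> is an annihilating polynomial known in advance, which
    spares a dimension argument for the existence of one.\<close>
  have P0: "?P (monom 1 N - [:d:])"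
  proof
    have "coeff (monom 1 N - [:d:]) N = 1" using N by (simp add: coeff_pCons split: nat.split)
    then show "monom 1 N - [:d:] \<noteq> 0" by (metis coeff_0 zero_neq_one)
    show "poly_act M (monom 1 N - [:d:]) w = 0\<^sub>v m"
      using poly_act_binomial[OF M wc] fin[OF w(1)] wc by auto
  qed
  obtain f where f: "?P f" "\<And>g. ?P g \<Longrightarrow> degree f \<le> degree g"
    using ex_has_least_nat[of ?P, OF P0, of degree] by blast
  have "degree f \<noteq> 0"
  proof
    assume "degree f = 0"
    then obtain a where "f = [:a:]" by (metis degree_eq_zeroE)
    then show False using f(1) poly_act_const[OF M wc] smult_vec_eq_zero[of a w] wc w by auto
  qed
  then obtain c where "poly f c = 0" using fundamental_theorem_of_algebra constant_degree by metis
  then obtain g where g: "f = [:-c, 1:] * g" using poly_eq_0_iff_dvd by (metis dvdE)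
  have "g \<noteq> 0" using f(1) g by auto
  then have "degree f = Suc (degree g)" using degree_mult_eq[of "[:-c, 1:]" g] g by simp
  then have "poly_act M g w \<noteq> 0\<^sub>v m" using f(2)[of g] \<open>g \<noteq> 0\<close> by auto
  moreover have "M *\<^sub>v poly_act M g w = c \<cdot>\<^sub>v poly_act M g w"
  proof -
    let ?v = "poly_act M g w"
    have v: "?v \<in> carrier_vec m" by (rule poly_act_carrier[OF M wc])
    have "[:-c, 1:] = monom 1 1 - [:c:]" by (simp add: monom_Suc)
    then have "0\<^sub>v m = M *\<^sub>v ?v + (- c) \<cdot>\<^sub>v ?v"
      using f(1) g poly_act_mult[OF M wc, of "[:-c, 1:]" g] poly_act_binomial[OF M v, of 1 c] by simp
    then have "0 = (M *\<^sub>v ?v) $ i + (- c) * ?v $ i" if "i < m" for i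
      using that v M by (metis (no_types, lifting) carrier_vecD index_add_vec(1) index_smult_vec index_zero_vec(1))
    then show ?thesis using v M by (intro eq_vecI) (auto simp del: index_mult_mat_vec)
  qed
  moreover have "poly_act M g w \<in> W" by (rule poly_act_mem[OF M W inv w(1)])
  ultimately show thesis using that by blast
qed

text \<open>The eigenspace of \<open>Z\<close> inside \<open>W\<close> is stable under the commuting
  \<open>B\<close>, so \<open>eigenvector_in_subspace\<close> applies to \<open>B\<close> on
  it.\<close>

lemma common_eigenvector:
  fixes Z B :: "complex mat"
  assumes Z: "Z \<in> carrier_mat m m" and B: "B \<in> carrier_mat m m" and W: "lin_subspace m W"
    and invZ: "\<And>w. w \<in> W \<Longrightarrow> Z *\<^sub>v w \<in> W" and invB: "\<And>w. w \<in> W \<Longrightarrow> B *\<^sub>v w \<in> W"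
    and com: "\<And>v. v \<in> carrier_vec m \<Longrightarrow> Z *\<^sub>v (B *\<^sub>v v) = B *\<^sub>v (Z *\<^sub>v v)"
    and finZ: "\<And>w. w \<in> W \<Longrightarrow> ((*\<^sub>v) Z ^^ N) w = d \<cdot>\<^sub>v w"
    and finB: "\<And>w. w \<in> W \<Longrightarrow> ((*\<^sub>v) B ^^ N) w = b \<cdot>\<^sub>v w" and N: "N > 0"
    and w: "w \<in> W" "w \<noteq> 0\<^sub>v m"
  obtains v \<mu> \<beta> where "v \<in> W" "v \<noteq> 0\<^sub>v m" "Z *\<^sub>v v = \<mu> \<cdot>\<^sub>v v" "B *\<^sub>v v = \<beta> \<cdot>\<^sub>v v"
proof -
  obtain u \<mu> where u: "u \<in> W" "u \<noteq> 0\<^sub>v m" "Z *\<^sub>v u = \<mu> \<cdot>\<^sub>v u"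
    using eigenvector_in_subspace[OF Z W invZ finZ N w] by blast
  let ?V = "{v \<in> W. Z *\<^sub>v v = \<mu> \<cdot>\<^sub>v v}"
  have WC: "v \<in> carrier_vec m" if "v \<in> W" for v using that W by (auto simp: lin_subspace_def)
  have "lin_subspace m ?V"
    using W mult_mat_zero_vec[OF Z] mult_add_distrib_mat_vec[OF Z WC WC] mult_mat_vec[OF Z WC]
      smult_add_distrib_vec[OF WC WC]
    by (auto simp: lin_subspace_def smult_smult_assoc mult.commute)
  moreover have "B *\<^sub>v v \<in> ?V" if "v \<in> ?V" for v
    using that invB com WC mult_mat_vec[OF B WC] by auto
  ultimately obtain v \<beta> where "v \<in> ?V" "v \<noteq> 0\<^sub>v m" "B *\<^sub>v v = \<beta> \<cdot>\<^sub>v v"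
    using eigenvector_in_subspace[OF B, of ?V N b u] finB N u by blast
  then show thesis using that by blast
qed

text \<open>For all but finitely many \<open>t\<close> the single matrix \<open>Z + tB\<close>
  separates the pairs of eigenvalues, and an \<open>m\<close> by \<open>m\<close> matrix has at most
  \<open>m\<close> eigenvalues.\<close>

lemma joint_eigenvalues_card_le:
  fixes Z B :: "complex mat"
  assumes Z: "Z \<in> carrier_mat m m" and B: "B \<in> carrier_mat m m"
    and ev: "\<And>j. j < N \<Longrightarrow> v j \<in> carrier_vec m \<and> v j \<noteq> 0\<^sub>v m \<and>
        Z *\<^sub>v v j = \<mu> j \<cdot>\<^sub>v v j \<and> B *\<^sub>v v j = \<beta> j \<cdot>\<^sub>v v j"
    and inj: "inj_on (\<lambda>j. (\<mu> j, \<beta> j)) {..<N}"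
  shows "N \<le> m"
proof -
  \<comment> \<open>The values of \<open>t\<close> at which two combined eigenvalues collide.
    Distinct indices with equal \<open>\<beta>\<close> contribute only 0, division by 0 being 0;
    there \<open>\<mu>\<close> already differs.\<close>
  let ?bad = "(\<lambda>(i, j). (\<mu> i - \<mu> j) / (\<beta> j - \<beta> i)) ` ({..<N} \<times> {..<N})"
  have "finite ?bad" by simp
  then obtain t where t: "t \<notin> ?bad" using ex_new_if_finite[OF infinite_UNIV_char_0] by blast
  let ?C = "Z + t \<cdot>\<^sub>m B"
  have C: "?C \<in> carrier_mat m m" using Z B by simp
  have "(\<lambda>j. \<mu> j + t * \<beta> j) ` {..<N} \<subseteq> spectrum ?C"
  proof (rule image_subsetI)
    fix j assume j: "j \<in> {..<N}"
    have "(t \<cdot>\<^sub>m B) *\<^sub>v v j = t \<cdot>\<^sub>v (B *\<^sub>v v j)"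
    proof (rule eq_vecI)
      fix i assume "i < dim_vec (t \<cdot>\<^sub>v (B *\<^sub>v v j))"
      then have "i < m" using B by simp
      then show "((t \<cdot>\<^sub>m B) *\<^sub>v v j) $ i = (t \<cdot>\<^sub>v (B *\<^sub>v v j)) $ i"
        using conjunct1[OF ev[of j]] j B by simp
    qed (use B in simp)
    then have "?C *\<^sub>v v j = \<mu> j \<cdot>\<^sub>v v j + t \<cdot>\<^sub>v (\<beta> j \<cdot>\<^sub>v v j)"
      using ev[of j] j Z B by (simp add: add_mult_distrib_mat_vec[OF Z smult_carrier_mat[OF B]])
    also have "\<dots> = (\<mu> j + t * \<beta> j) \<cdot>\<^sub>v v j" by (simp add: add_smult_distrib_vec smult_smult_assoc)
    finally show "\<mu> j + t * \<beta> j \<in> spectrum ?C"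
      using ev[of j] j Z B C unfolding spectrum_def eigenvalue_def eigenvector_def by auto
  qed
  moreover have "inj_on (\<lambda>j. \<mu> j + t * \<beta> j) {..<N}"
  proof (rule inj_onI)
    fix i j assume ij: "i \<in> {..<N}" "j \<in> {..<N}" and eq: "\<mu> i + t * \<beta> i = \<mu> j + t * \<beta> j"
    have "\<beta> i = \<beta> j"
    proof (rule ccontr)
      assume "\<beta> i \<noteq> \<beta> j"
      then have "t = (\<mu> i - \<mu> j) / (\<beta> j - \<beta> i)" using eq by (simp add: field_simps)
      then show False using t ij by force
    qed
    then show "i = j" using eq inj ij by (auto simp: inj_on_def)
  qed
  ultimately have "N \<le> card (spectrum ?C)"
    using card_finite_spectrum(1)[OF C] by (metis card_image card_lessThan card_mono)
  then show ?thesis using card_finite_spectrum(2)[OF C] by simp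
qed

section \<open>Triangular numbers and the orbit of eigenvalue pairs\<close>

lemma double_sum_lessThan_nat: "2 * (\<Sum>{..<n::nat}) = n * (n - 1)"
  by (induction n) (auto simp: algebra_simps)

text \<open>Triangular numbers are kept as sums over \<open>{..<j}\<close>, which avoids division.
  The formula compares the exponents of \<open>\<theta>\<close> at two points of an orbit that are
  \<open>s\<close> steps apart.\<close>

lemma sum_lessThan_nat_add: "\<Sum>{..<i + s::nat} = \<Sum>{..<i} + s * i + \<Sum>{..<s}"
  by (induction s) auto

lemma odd_dvd_sum_lessThan_nat:
  assumes "odd q" "q dvd (s::nat)"
  shows "q dvd \<Sum>{..<s}"
proof -
  have "q dvd 2 * (\<Sum>{..<s})" using assms by (simp add: double_sum_lessThan_nat)
  then show ?thesis using assms(1) by (simp add: coprime_dvd_mult_right_iff)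
qed

text \<open>\<open>A\<close> moves a common eigenvector of \<open>Z\<close> and \<open>B\<close> with eigenvalues \<open>(\<mu>, \<beta>)\<close> to one with
  eigenvalues \<open>(\<theta> \<mu>, \<beta> / \<mu>)\<close>. If \<open>\<mu>\<close> has order \<open>p ^ k\<close>, then so has the orbit of this pair.\<close>

lemma twisted_degree_bound:
  fixes A B Z :: "complex mat"
  assumes p: "Factorial_Ring.prime p" "odd p"
    and carr: "A \<in> carrier_mat m m" "B \<in> carrier_mat m m" "Z \<in> carrier_mat m m"
    and AB: "\<And>v. v \<in> carrier_vec m \<Longrightarrow> A *\<^sub>v (B *\<^sub>v v) = B *\<^sub>v (A *\<^sub>v (Z *\<^sub>v v))"
    and ZB: "\<And>v. v \<in> carrier_vec m \<Longrightarrow> Z *\<^sub>v (B *\<^sub>v v) = B *\<^sub>v (Z *\<^sub>v v)"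
    and ZA: "\<And>v. v \<in> carrier_vec m \<Longrightarrow> Z *\<^sub>v (A *\<^sub>v v) = \<theta> \<cdot>\<^sub>v (A *\<^sub>v (Z *\<^sub>v v))"
    and \<theta>: "\<And>i. \<theta> ^ i = 1 \<longleftrightarrow> q dvd i" and q: "q dvd p ^ k" and k: "k \<ge> 1"
    and finA: "\<And>v. v \<in> carrier_vec m \<Longrightarrow> ((*\<^sub>v) A ^^ (p ^ k)) v = a \<cdot>\<^sub>v v" and a: "a \<noteq> 0"
    and finB: "\<And>v. v \<in> carrier_vec m \<Longrightarrow> ((*\<^sub>v) B ^^ (p ^ k)) v = b \<cdot>\<^sub>v v" and b: "b \<noteq> 0"
    and finZ: "\<And>v. v \<in> carrier_vec m \<Longrightarrow> ((*\<^sub>v) Z ^^ (p ^ k)) v = d \<cdot>\<^sub>v v" and d: "d \<noteq> 0"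
    and nonscalar: "\<And>c. \<exists>v\<in>carrier_vec m. ((*\<^sub>v) Z ^^ (p ^ (k - 1))) v \<noteq> c \<cdot>\<^sub>v v"
  shows "p ^ k \<le> m"
proof -
  define N M where "N = p ^ k" and "M = p ^ (k - 1)"
  have p0: "p > 0" using p by (simp add: prime_gt_0_nat)
  have NM: "N = M * p" using k by (simp add: N_def M_def power_eq_if mult.commute)
  have N0: "N > 0" using p0 by (simp add: N_def)
  have qodd: "odd q" using q p by (metis dvd_trans even_power)
  define V where "V = (carrier_vec m :: complex vec set)"
  have V: "lin_subspace m V" by (auto simp: V_def lin_subspace_def)
  let ?T = "\<lambda>j. \<Sum>{..<j::nat}"
  have eigval: "\<mu> ^ N = d \<and> \<mu> \<noteq> 0" if "Z *\<^sub>v v = \<mu> \<cdot>\<^sub>v v" "v \<in> V" "v \<noteq> 0\<^sub>v m" for v \<mu>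
  proof -
    have "\<mu> ^ N \<cdot>\<^sub>v v = d \<cdot>\<^sub>v v"
      using funpow_eigenvector[OF carr(3) _ that(1), of N] finZ[of v] that by (simp add: V_def N_def)
    then have "\<mu> ^ N = d" using smult_vec_cancel that V_def by blast
    then show ?thesis using d N0 by auto
  qed
  have eigvalB: "\<beta> \<noteq> 0" if "B *\<^sub>v v = \<beta> \<cdot>\<^sub>v v" "v \<in> V" "v \<noteq> 0\<^sub>v m" for v \<beta>
  proof -
    have "\<beta> ^ N \<cdot>\<^sub>v v = b \<cdot>\<^sub>v v"
      using funpow_eigenvector[OF carr(2) _ that(1), of N] finB[of v] that by (simp add: V_def N_def)
    then have "\<beta> ^ N = b" using smult_vec_cancel that V_def by blast
    then show ?thesis using b N0 by auto
  qed
  have \<theta>0: "\<theta> \<noteq> 0"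
  proof
    assume "\<theta> = 0"
    moreover have "\<theta> ^ N = 1" using \<theta> q by (simp add: N_def)
    ultimately show False using N0 by (simp add: zero_power)
  qed
  \<comment> \<open>Each application of \<open>A\<close> divides the eigenvalue of \<open>B\<close>
    by the current eigenvalue of \<open>Z\<close>, which is \<open>\<theta> ^ i * \<mu>\<close>
    after \<open>i\<close> steps; the product over \<open>i < j\<close> gives the triangular
    exponent.\<close>
  have orbit: "(((*\<^sub>v) A ^^ j) v \<in> V \<and> ((*\<^sub>v) A ^^ j) v \<noteq> 0\<^sub>v m) \<and>
      Z *\<^sub>v ((*\<^sub>v) A ^^ j) v = (\<theta> ^ j * \<mu>) \<cdot>\<^sub>v ((*\<^sub>v) A ^^ j) v \<and>
      B *\<^sub>v ((*\<^sub>v) A ^^ j) v = (\<beta> / (\<mu> ^ j * \<theta> ^ ?T j)) \<cdot>\<^sub>v ((*\<^sub>v) A ^^ j) v"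
    if v: "v \<in> V" "v \<noteq> 0\<^sub>v m" and ev: "Z *\<^sub>v v = \<mu> \<cdot>\<^sub>v v" "B *\<^sub>v v = \<beta> \<cdot>\<^sub>v v" for v \<mu> \<beta> j
  proof (induction j)
    case 0
    then show ?case using v ev by simp
  next
    case (Suc j)
    let ?u = "((*\<^sub>v) A ^^ j) v"
    have u: "?u \<in> carrier_vec m" "?u \<noteq> 0\<^sub>v m" using Suc by (auto simp: V_def)
    have \<mu>0: "\<mu> \<noteq> 0" using eigval v ev by blast
    have Au: "A *\<^sub>v ?u \<in> carrier_vec m" using carr u by simp
    have Z': "Z *\<^sub>v (A *\<^sub>v ?u) = (\<theta> ^ Suc j * \<mu>) \<cdot>\<^sub>v (A *\<^sub>v ?u)"
      using ZA[OF u(1)] Suc u carr by (simp add: mult_mat_vec[of _ m m] smult_smult_assoc mult.assoc)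
    let ?b = "\<beta> / (\<mu> ^ j * \<theta> ^ ?T j)"
    have "?b \<cdot>\<^sub>v (A *\<^sub>v ?u) = A *\<^sub>v (B *\<^sub>v ?u)"
      using Suc u carr by (simp add: mult_mat_vec[of _ m m])
    also have "\<dots> = B *\<^sub>v (A *\<^sub>v ((\<theta> ^ j * \<mu>) \<cdot>\<^sub>v ?u))" using AB[OF u(1)] Suc by simp
    also have "\<dots> = (\<theta> ^ j * \<mu>) \<cdot>\<^sub>v (B *\<^sub>v (A *\<^sub>v ?u))"
      using Au u carr by (simp add: mult_mat_vec[of _ m m])
    finally have e: "?b \<cdot>\<^sub>v (A *\<^sub>v ?u) = (\<theta> ^ j * \<mu>) \<cdot>\<^sub>v (B *\<^sub>v (A *\<^sub>v ?u))" .
    have "B *\<^sub>v (A *\<^sub>v ?u) = (inverse (\<theta> ^ j * \<mu>) * (\<theta> ^ j * \<mu>)) \<cdot>\<^sub>v (B *\<^sub>v (A *\<^sub>v ?u))"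
      using \<mu>0 \<theta>0 by (subst left_inverse) simp_all
    also have "\<dots> = inverse (\<theta> ^ j * \<mu>) \<cdot>\<^sub>v (?b \<cdot>\<^sub>v (A *\<^sub>v ?u))"
      using e by (simp only: smult_smult_assoc)
    also have "\<dots> = (\<beta> / (\<mu> ^ Suc j * \<theta> ^ ?T (Suc j))) \<cdot>\<^sub>v (A *\<^sub>v ?u)"
      using \<mu>0 \<theta>0 by (simp add: smult_smult_assoc field_simps power_add)
    finally have B': "B *\<^sub>v (A *\<^sub>v ?u) = (\<beta> / (\<mu> ^ Suc j * \<theta> ^ ?T (Suc j))) \<cdot>\<^sub>v (A *\<^sub>v ?u)" .
    have "A *\<^sub>v ?u \<noteq> 0\<^sub>v m"
    proof
      assume "A *\<^sub>v ?u = 0\<^sub>v m"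
      have "((*\<^sub>v) A ^^ n) (0\<^sub>v m) = 0\<^sub>v m" for n
        by (induction n) (use mult_mat_zero_vec[OF carr(1)] in auto)
      then have "((*\<^sub>v) A ^^ Suc (N - 1)) ?u = 0\<^sub>v m"
        using \<open>A *\<^sub>v ?u = 0\<^sub>v m\<close> by (simp add: funpow_Suc_right del: funpow.simps)
      then have "((*\<^sub>v) A ^^ N) ?u = 0\<^sub>v m" using N0 by (simp only: Suc_diff_1)
      then have "a \<cdot>\<^sub>v ?u = 0\<^sub>v m" using finA[OF u(1)] by (simp add: N_def)
      then show False using smult_vec_eq_zero u a by blast
    qed
    then show ?case using Au Z' B' by (simp add: V_def)
  qed
  \<comment> \<open>The \<open>N\<close>-th power of \<open>A\<close> is a scalar, so after
    \<open>N\<close> steps the orbit is back on the line of \<open>v\<close>. Equating eigenvalues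
    of \<open>B\<close> there gives the claim once \<open>\<theta> ^ ?T N = 1\<close>, which uses
    that \<open>q\<close> is odd.\<close>
  have order1: "\<mu> ^ N = 1" if v: "v \<in> V" "v \<noteq> 0\<^sub>v m" and ev: "Z *\<^sub>v v = \<mu> \<cdot>\<^sub>v v" "B *\<^sub>v v = \<beta> \<cdot>\<^sub>v v" for v \<mu> \<beta>
  proof -
    have A: "((*\<^sub>v) A ^^ N) v = a \<cdot>\<^sub>v v" using finA v by (simp add: V_def N_def)
    have "q dvd ?T N" using odd_dvd_sum_lessThan_nat[OF qodd] q by (simp add: N_def)
    then have \<theta>T: "\<theta> ^ ?T N = 1" using \<theta> by blast
    have n0: "a \<cdot>\<^sub>v v \<in> carrier_vec m" "a \<cdot>\<^sub>v v \<noteq> 0\<^sub>v m" 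
      using v a smult_vec_eq_zero[of a v m] by (auto simp: V_def)
    have "B *\<^sub>v (a \<cdot>\<^sub>v v) = \<beta> \<cdot>\<^sub>v (a \<cdot>\<^sub>v v)"
      using mult_mat_vec[OF carr(2), of v a] v ev by (simp add: V_def smult_smult_assoc mult.commute)
    then have "\<beta> / \<mu> ^ N = \<beta>"
      using orbit[OF v ev, of N] A \<theta>T smult_vec_cancel[OF _ n0] by simp
    then show ?thesis using eigvalB[OF ev(2) v] eigval[OF ev(1) v] by (auto simp: field_simps)
  qed
  \<comment> \<open>The scalar 0 in \<open>nonscalar\<close> shows that the space is
    nonzero.\<close>
  obtain v0 where v0: "v0 \<in> V" "v0 \<noteq> 0\<^sub>v m"
  proof -
    obtain v where v: "v \<in> V" "((*\<^sub>v) Z ^^ M) v \<noteq> 0 \<cdot>\<^sub>v v" using nonscalar[of 0] by (auto simp: V_def M_def)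
    moreover have "((*\<^sub>v) Z ^^ M) (0\<^sub>v m) = 0\<^sub>v m"
      by (induction M) (use mult_mat_zero_vec[OF carr(3)] in auto)
    moreover have "0 \<cdot>\<^sub>v 0\<^sub>v m = (0\<^sub>v m :: complex vec)" by auto
    ultimately show thesis using that by metis
  qed
  have invs: "Z *\<^sub>v w \<in> V" "B *\<^sub>v w \<in> V" if "w \<in> V" for w using that carr by (auto simp: V_def)
  have "d = 1"
  proof -
    obtain v \<mu> \<beta> where "v \<in> V" "v \<noteq> 0\<^sub>v m" "Z *\<^sub>v v = \<mu> \<cdot>\<^sub>v v" "B *\<^sub>v v = \<beta> \<cdot>\<^sub>v v"
      using common_eigenvector[OF carr(3,2) V invs(1) invs(2) ZB finZ finB _ v0] N0 by (auto simp: V_def N_def)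
    then show ?thesis using order1 eigval by blast
  qed
  \<comment> \<open>Since \<open>X ^ N - 1 = Q * (X ^ M - 1)\<close>, the roots of \<open>Q\<close>
    are the roots of unity of exact order \<open>N\<close>. An eigenvector of \<open>Z\<close> in
    the kernel of Q(Z) thus has an eigenvalue of full order.\<close>
  define Q :: "complex poly" where "Q = (\<Sum>j<p. monom 1 M ^ j)"
  define W where "W = {w \<in> V. poly_act Z Q w = 0\<^sub>v m}"
  have QN: "Q * (monom 1 M - [:1:]) = monom 1 N - [:1:]"
  proof -
    have "(monom 1 M - 1) * Q = (monom 1 M :: complex poly) ^ p - 1"
      unfolding Q_def by (rule power_diff_1_eq[symmetric])
    also have "(monom 1 M :: complex poly) ^ p = monom 1 N" by (simp add: monom_power NM)
    finally show ?thesis by (simp add: mult.commute one_pCons)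
  qed
  have "poly_act Z Q (0\<^sub>v m) = 0\<^sub>v m"
  proof -
    have "poly_act Z Q (0 \<cdot>\<^sub>v 0\<^sub>v m) = 0 \<cdot>\<^sub>v poly_act Z Q (0\<^sub>v m)"
      by (rule poly_act_smult_vec[OF carr(3) zero_carrier_vec])
    moreover have "0 \<cdot>\<^sub>v w = (0\<^sub>v m :: complex vec)" if "w \<in> carrier_vec m" for w using that by auto
    ultimately show ?thesis using poly_act_carrier[OF carr(3) zero_carrier_vec, of Q] by simp
  qed
  then have W: "lin_subspace m W"
    using V poly_act_add_vec[OF carr(3)] poly_act_smult_vec[OF carr(3)]
    by (auto simp: W_def V_def lin_subspace_def)
  have WV: "w \<in> V" if "w \<in> W" for w using that by (simp add: W_def)
  have invW: "Z *\<^sub>v w \<in> W" "B *\<^sub>v w \<in> W" if "w \<in> W" for w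
    using that invs[OF WV[OF that]] poly_act_commute[OF carr(3) _ carr(2) ZB, of w Q]
      poly_act_commute[OF carr(3) _ carr(3), of w Q] mult_mat_zero_vec[OF carr(2)] mult_mat_zero_vec[OF carr(3)]
    by (auto simp: W_def V_def)
  obtain w where w: "w \<in> W" "w \<noteq> 0\<^sub>v m"
  proof -
    \<comment> \<open>The scalar 1 in \<open>nonscalar\<close> gives a vector moved by the
      \<open>M\<close>-th power of \<open>Z\<close>; its image under Z^M - 1 is a nonzero element of
      \<open>W\<close>, because Z^N is the scalar \<open>d = 1\<close>.\<close>
    obtain v where v: "v \<in> V" "((*\<^sub>v) Z ^^ M) v \<noteq> v" using nonscalar[of 1] by (auto simp: V_def M_def)
    then have vc: "v \<in> carrier_vec m" by (simp add: V_def)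
    let ?w = "poly_act Z (monom 1 M - [:1:]) v"
    have wc: "?w \<in> carrier_vec m" by (rule poly_act_carrier[OF carr(3) vc])
    have "poly_act Z Q ?w = poly_act Z (monom 1 N - [:1:]) v"
      using poly_act_mult[OF carr(3) vc, of Q "monom 1 M - [:1:]"] by (simp only: QN)
    also have "\<dots> = ((*\<^sub>v) Z ^^ N) v + (- 1) \<cdot>\<^sub>v v" by (rule poly_act_binomial[OF carr(3) vc])
    also have "\<dots> = 0\<^sub>v m" using finZ[OF vc] \<open>d = 1\<close> vc by (auto simp: N_def)
    finally have "?w \<in> W" using wc by (simp add: W_def V_def)
    moreover have "?w \<noteq> 0\<^sub>v m"
    proof
      assume "?w = 0\<^sub>v m"
      then have 0: "((*\<^sub>v) Z ^^ M) v + (- 1) \<cdot>\<^sub>v v = 0\<^sub>v m"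
        using poly_act_binomial[OF carr(3) vc, of M 1] by simp
      have zc: "((*\<^sub>v) Z ^^ M) v \<in> carrier_vec m" by (rule funpow_mult_mat_vec_carrier[OF carr(3) vc])
      have "((*\<^sub>v) Z ^^ M) v = v"
      proof (rule eq_vecI)
        fix i assume i: "i < dim_vec v"
        have "(((*\<^sub>v) Z ^^ M) v + (- 1) \<cdot>\<^sub>v v) $ i = 0\<^sub>v m $ i" by (simp only: 0)
        then show "((*\<^sub>v) Z ^^ M) v $ i = v $ i" using i vc zc by simp
      qed (use vc zc in simp)
      then show False using v by simp
    qed
    ultimately show thesis using that by blast
  qed
  obtain v \<mu> \<beta> where v: "v \<in> W" "v \<noteq> 0\<^sub>v m" and ev: "Z *\<^sub>v v = \<mu> \<cdot>\<^sub>v v" "B *\<^sub>v v = \<beta> \<cdot>\<^sub>v v"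
  proof (rule common_eigenvector[OF carr(3,2) W invW ZB _ _ N0 w])
    show "((*\<^sub>v) Z ^^ N) w = d \<cdot>\<^sub>v w" "((*\<^sub>v) B ^^ N) w = b \<cdot>\<^sub>v w" if "w \<in> W" for w
      using finZ finB WV[OF that] by (auto simp: V_def N_def)
  qed
  have vV: "v \<in> V" using v WV by blast
  have vc: "v \<in> carrier_vec m" using vV by (simp add: V_def)
  have "poly Q \<mu> \<cdot>\<^sub>v v = 0\<^sub>v m"
    using poly_act_eigenvector[OF carr(3) vc ev(1), of Q] v by (simp add: W_def)
  then have Q0: "poly Q \<mu> = 0" using smult_vec_eq_zero vc v by blast
  have \<mu>N: "\<mu> ^ N = 1" by (rule order1[OF vV v(2) ev])
  have "\<mu> ^ M \<noteq> 1"
  proof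
    assume "\<mu> ^ M = 1"
    then have "poly Q \<mu> = of_nat p" by (simp add: Q_def poly_sum poly_monom poly_power)
    then show False using Q0 p0 by simp
  qed
  then have \<mu>ord: "\<mu> ^ i = 1 \<longleftrightarrow> N dvd i" for i
    unfolding N_def by (intro prime_power_order[OF p(1)]) (use \<mu>N in \<open>auto simp: N_def M_def\<close>)
  have \<mu>0: "\<mu> \<noteq> 0" and \<beta>0: "\<beta> \<noteq> 0" using eigval[OF ev(1) vV v(2)] eigvalB[OF ev(2) vV v(2)] by auto
  have "N \<le> m"
  proof (rule joint_eigenvalues_card_le[OF carr(3,2), where v = "\<lambda>j. ((*\<^sub>v) A ^^ j) v"
        and \<mu> = "\<lambda>j. \<theta> ^ j * \<mu>" and \<beta> = "\<lambda>j. \<beta> / (\<mu> ^ j * \<theta> ^ ?T j)"])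
    show "((*\<^sub>v) A ^^ j) v \<in> carrier_vec m \<and> ((*\<^sub>v) A ^^ j) v \<noteq> 0\<^sub>v m \<and>
      Z *\<^sub>v ((*\<^sub>v) A ^^ j) v = (\<theta> ^ j * \<mu>) \<cdot>\<^sub>v ((*\<^sub>v) A ^^ j) v \<and>
      B *\<^sub>v ((*\<^sub>v) A ^^ j) v = (\<beta> / (\<mu> ^ j * \<theta> ^ ?T j)) \<cdot>\<^sub>v ((*\<^sub>v) A ^^ j) v" for j
      using orbit[OF vV v(2) ev, of j] by (simp add: V_def)
    \<comment> \<open>A coincidence \<open>s\<close> steps apart forces \<open>q\<close> to divide
      \<open>s\<close>, by the first coordinate. Then, \<open>q\<close> being odd, the triangular
      powers of \<open>\<theta>\<close> in the second coordinate agree, which leaves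
      \<open>\<mu> ^ s = 1\<close>, impossible for \<open>0 < s < N\<close>.\<close>
    have aux: "\<not> (\<theta> ^ i * \<mu> = \<theta> ^ (i + s) * \<mu> \<and> \<beta> / (\<mu> ^ i * \<theta> ^ ?T i) = \<beta> / (\<mu> ^ (i + s) * \<theta> ^ ?T (i + s)))"
      if s: "0 < s" "s < N" for i s
    proof
      assume eq: "\<theta> ^ i * \<mu> = \<theta> ^ (i + s) * \<mu> \<and> \<beta> / (\<mu> ^ i * \<theta> ^ ?T i) = \<beta> / (\<mu> ^ (i + s) * \<theta> ^ ?T (i + s))"
      then have "\<theta> ^ s = 1" using \<mu>0 \<theta>0 by (simp add: power_add)
      then have qs: "q dvd s" using \<theta> by blast
      then have "q dvd s * i + ?T s" using odd_dvd_sum_lessThan_nat[OF qodd] by simp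
      then have "\<theta> ^ (s * i + ?T s) = 1" using \<theta> by blast
      then have "\<theta> ^ ?T (i + s) = \<theta> ^ ?T i"
        unfolding sum_lessThan_nat_add add.assoc power_add[of \<theta> "?T i"] by simp
      then have "\<mu> ^ i = \<mu> ^ (i + s)" using eq \<beta>0 \<mu>0 \<theta>0 by (simp add: field_simps)
      then have "\<mu> ^ s = 1" using \<mu>0 by (simp add: power_add)
      then show False using \<mu>ord s by (auto dest: dvd_imp_le)
    qed
    show "inj_on (\<lambda>j. (\<theta> ^ j * \<mu>, \<beta> / (\<mu> ^ j * \<theta> ^ ?T j))) {..<N}"
    proof (rule linorder_inj_onI)
      fix i j assume "i < j" "i \<in> {..<N}" "j \<in> {..<N}"
      then show "(\<theta> ^ i * \<mu>, \<beta> / (\<mu> ^ i * \<theta> ^ ?T i)) \<noteq> (\<theta> ^ j * \<mu>, \<beta> / (\<mu> ^ j * \<theta> ^ ?T j))"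
        using aux[of "j - i" i] by auto
    qed auto
  qed
  then show ?thesis by (simp add: N_def)
qed

section \<open>Projective representations\<close>

lemma smult_invertible_mat_cancel:
  fixes A :: "'a::field mat"
  assumes A: "A \<in> carrier_mat m m" "invertible_mat A" and m: "0 < m" and eq: "c \<cdot>\<^sub>m A = d \<cdot>\<^sub>m A"
  shows "c = d"
proof -
  obtain B where B: "A * B = 1\<^sub>m m" "B * A = 1\<^sub>m (dim_row B)"
    using A by (auto simp: invertible_mat_def inverts_mat_def)
  have "dim_col B = m" using arg_cong[OF B(1), of dim_col] by simp
  moreover have "dim_row B = m" using arg_cong[OF B(2), of dim_col] A(1) by simp
  ultimately have Bc: "B \<in> carrier_mat m m" by blast
  have "c \<cdot>\<^sub>m 1\<^sub>m m = (c \<cdot>\<^sub>m A) * B" using mult_smult_assoc_mat[OF A(1) Bc] B by simp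
  also have "\<dots> = d \<cdot>\<^sub>m 1\<^sub>m m" using mult_smult_assoc_mat[OF A(1) Bc] B eq by simp
  finally have "(c \<cdot>\<^sub>m 1\<^sub>m m) $$ (0, 0) = (d \<cdot>\<^sub>m 1\<^sub>m m) $$ (0, 0)" by simp
  then show ?thesis using m by simp
qed

lemma smult_mat_mult_vec:
  fixes A :: "'a::field mat"
  assumes "A \<in> carrier_mat m m" "v \<in> carrier_vec m"
  shows "(c \<cdot>\<^sub>m A) *\<^sub>v v = c \<cdot>\<^sub>v (A *\<^sub>v v)"
  using assms by (intro eq_vecI) auto

lemma smult_smult_mat: "c \<cdot>\<^sub>m (d \<cdot>\<^sub>m A) = (c * d) \<cdot>\<^sub>m (A :: 'a::field mat)"
  by (intro eq_matI) auto

lemma scalar_matI: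
  fixes A :: "'a::field mat"
  assumes A: "A \<in> carrier_mat m m" and eq: "\<And>v. v \<in> carrier_vec m \<Longrightarrow> A *\<^sub>v v = c \<cdot>\<^sub>v v"
  shows "A = c \<cdot>\<^sub>m 1\<^sub>m m"
proof (rule eq_matI)
  fix i j assume "i < dim_row (c \<cdot>\<^sub>m 1\<^sub>m m :: 'a mat)" "j < dim_col (c \<cdot>\<^sub>m 1\<^sub>m m :: 'a mat)"
  then have ij: "i < m" "j < m" by auto
  then have "A $$ (i, j) = (A *\<^sub>v unit_vec m j) $ i" using A by simp
  also have "\<dots> = (c \<cdot>\<^sub>v unit_vec m j) $ i" using eq[of "unit_vec m j"] by simp
  finally show "A $$ (i, j) = (c \<cdot>\<^sub>m 1\<^sub>m m) $$ (i, j)" using ij by auto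
qed (use A in auto)

lemma funpow_smult_mat:
  fixes M :: "'a::field mat"
  assumes M: "M \<in> carrier_mat m m" and v: "v \<in> carrier_vec m"
  shows "((*\<^sub>v) (c \<cdot>\<^sub>m M) ^^ n) v = c ^ n \<cdot>\<^sub>v ((*\<^sub>v) M ^^ n) v"
proof (induction n)
  case (Suc n)
  have "((*\<^sub>v) M ^^ n) v \<in> carrier_vec m" by (rule funpow_mult_mat_vec_carrier[OF M v])
  then show ?case using Suc M by (simp add: smult_mat_mult_vec[OF M] mult_mat_vec[OF M] smult_smult_assoc)
qed simp

text \<open>Associativity of the matrix product forces the cocycle identity, since scalars in front
  of an invertible matrix can be compared. Constructions of representations therefore need not check
  it.\<close>

lemma (in group) cocycle_alpha_rep:
  assumes rep: "alpha_rep G \<alpha> m \<rho>" and m: "0 < m"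
    and cocycle_nonzero: "\<And>g h. g \<in> carrier G \<Longrightarrow> h \<in> carrier G \<Longrightarrow> \<alpha> g h \<noteq> 0"
  shows "cocycle G \<alpha>"
proof -
  have c: "\<rho> g \<in> carrier_mat m m" "invertible_mat (\<rho> g)" if "g \<in> carrier G" for g
    using rep that by (auto simp: alpha_rep_def)
  have mu: "\<rho> g * \<rho> h = \<alpha> g h \<cdot>\<^sub>m \<rho> (g \<otimes> h)" if "g \<in> carrier G" "h \<in> carrier G" for g h
    using rep that by (auto simp: alpha_rep_def)
  have "\<alpha> g h * \<alpha> (g \<otimes> h) k = \<alpha> h k * \<alpha> g (h \<otimes> k)"
    if g: "g \<in> carrier G" "h \<in> carrier G" "k \<in> carrier G" for g h k
  proof (rule smult_invertible_mat_cancel[OF _ _ m])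
    have "(\<alpha> g h * \<alpha> (g \<otimes> h) k) \<cdot>\<^sub>m \<rho> (g \<otimes> h \<otimes> k) = (\<rho> g * \<rho> h) * \<rho> k"
      using g mu c by (simp add: mult_smult_assoc_mat[of _ m m _ m] smult_smult_mat)
    also have "\<dots> = \<rho> g * (\<rho> h * \<rho> k)"
      using g c by (intro assoc_mult_mat[of _ m m _ m _ m]) auto
    also have "\<dots> = (\<alpha> h k * \<alpha> g (h \<otimes> k)) \<cdot>\<^sub>m \<rho> (g \<otimes> h \<otimes> k)"
      using g mu c by (simp add: mult_smult_distrib[of _ m m _ m] smult_smult_mat m_assoc)
    finally show "(\<alpha> g h * \<alpha> (g \<otimes> h) k) \<cdot>\<^sub>m \<rho> (g \<otimes> h \<otimes> k)
      = (\<alpha> h k * \<alpha> g (h \<otimes> k)) \<cdot>\<^sub>m \<rho> (g \<otimes> h \<otimes> k)" .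
  qed (use c g in auto)
  then show ?thesis using cocycle_nonzero by (simp add: cocycle_def)
qed

locale proj_representation = group_cocycle G \<alpha> for G (structure) and \<alpha> +
  fixes m :: nat and \<rho> :: "'a \<Rightarrow> complex mat"
  assumes m0: "0 < m" and rep: "alpha_rep G \<alpha> m \<rho>"
begin

lemma rep_carrier [simp]: "g \<in> carrier G \<Longrightarrow> \<rho> g \<in> carrier_mat m m"
  using rep by (simp add: alpha_rep_def)

lemma rep_mult:
  "g \<in> carrier G \<Longrightarrow> h \<in> carrier G \<Longrightarrow> \<rho> g * \<rho> h = \<alpha> g h \<cdot>\<^sub>m \<rho> (g \<otimes> h)"
  using rep by (simp add: alpha_rep_def)

lemma rep_one: "\<rho> \<one> = 1\<^sub>m m"
  using rep by (simp add: alpha_rep_def)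

lemma rep_vec_carrier [simp]:
  "g \<in> carrier G \<Longrightarrow> v \<in> carrier_vec m \<Longrightarrow> \<rho> g *\<^sub>v v \<in> carrier_vec m"
  using rep_carrier mult_mat_vec_carrier by blast

lemma rep_mult_vec:
  assumes "g \<in> carrier G" "h \<in> carrier G" "v \<in> carrier_vec m"
  shows "\<rho> g *\<^sub>v (\<rho> h *\<^sub>v v) = \<alpha> g h \<cdot>\<^sub>v (\<rho> (g \<otimes> h) *\<^sub>v v)"
proof -
  have "\<rho> g *\<^sub>v (\<rho> h *\<^sub>v v) = (\<rho> g * \<rho> h) *\<^sub>v v"
    using assms by (simp add: assoc_mult_mat_vec[of _ m m _ m])
  then show ?thesis using assms by (simp add: rep_mult smult_mat_mult_vec[of _ m])
qed

lemma rep_commute_vec: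
  assumes "z \<in> carrier G" "g \<in> carrier G" "v \<in> carrier_vec m" "z \<otimes> g = g \<otimes> z"
  shows "\<rho> z *\<^sub>v (\<rho> g *\<^sub>v v) = \<kappa> z g \<cdot>\<^sub>v (\<rho> g *\<^sub>v (\<rho> z *\<^sub>v v))"
  using assms cocycle_nonzero by (simp add: rep_mult_vec smult_smult_assoc comm_scalar_def)

text \<open>Turns \<open>g [^] n = \<one>\<close> into the statement that the \<open>n\<close>-th
  power of \<open>\<rho> g\<close> is a nonzero scalar; this scalar, a product of values of
  \<open>\<alpha>\<close>, need not be 1.\<close>

lemma rep_funpow:
  assumes g: "g \<in> carrier G"
  shows "\<exists>c. c \<noteq> 0 \<and> (\<forall>v\<in>carrier_vec m. ((*\<^sub>v) (\<rho> g) ^^ n) v = c \<cdot>\<^sub>v (\<rho> (g [^] n) *\<^sub>v v))"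
proof (induction n)
  case 0
  then show ?case by (intro exI[of _ 1]) (simp add: rep_one)
next
  case (Suc n)
  then obtain c where c: "c \<noteq> 0" "\<And>v. v\<in>carrier_vec m \<Longrightarrow> ((*\<^sub>v) (\<rho> g) ^^ n) v = c \<cdot>\<^sub>v (\<rho> (g [^] n) *\<^sub>v v)"
    by blast
  have "((*\<^sub>v) (\<rho> g) ^^ Suc n) v = (c * \<alpha> g (g [^] n)) \<cdot>\<^sub>v (\<rho> (g [^] Suc n) *\<^sub>v v)" if "v \<in> carrier_vec m" for v
    using c(2)[OF that] g that nat_pow_Suc2[OF g, of n]
    by (simp add: mult_mat_vec[of _ m m] rep_mult_vec smult_smult_assoc)
  then show ?case using c(1) cocycle_nonzero[of g "g [^] n"] g by (intro exI[of _ "c * \<alpha> g (g [^] n)"]) simp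
qed

lemma schur:
  assumes irr: "irreducible_proj G m \<rho>" and M: "M \<in> carrier_mat m m"
    and com: "\<And>g v. g \<in> carrier G \<Longrightarrow> v \<in> carrier_vec m \<Longrightarrow> M *\<^sub>v (\<rho> g *\<^sub>v v) = \<rho> g *\<^sub>v (M *\<^sub>v v)"
  shows "\<exists>c. M = c \<cdot>\<^sub>m 1\<^sub>m m"
proof -
  obtain c v where v: "v \<in> carrier_vec m" "v \<noteq> 0\<^sub>v m" "M *\<^sub>v v = c \<cdot>\<^sub>v v"
    using spectrum_non_empty[OF M m0] M unfolding spectrum_def eigenvalue_def eigenvector_def by auto
  let ?W = "{v \<in> carrier_vec m. M *\<^sub>v v = c \<cdot>\<^sub>v v}"
  have "invariant_subspace G m \<rho> ?W"
    unfolding invariant_subspace_def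
    using mult_mat_zero_vec[OF M] mult_add_distrib_mat_vec[OF M] mult_mat_vec[OF M] com
      mult_mat_vec[OF rep_carrier]
    by (auto simp: smult_add_distrib_vec[of _ m] smult_smult_assoc mult.commute)
  then have "?W = carrier_vec m" using irr v by (auto simp: irreducible_proj_def)
  then show ?thesis using scalar_matI[OF M, of c] by blast
qed

lemma nondegenerate:
  assumes irr: "irreducible_proj G m \<rho>" and fa: "faithful_proj G m \<rho>"
    and z: "z \<in> group_center G" and \<kappa>: "\<And>g. g \<in> carrier G \<Longrightarrow> \<kappa> z g = 1"
  shows "z = \<one>"
proof -
  have zc: "z \<in> carrier G" "\<And>g. g \<in> carrier G \<Longrightarrow> z \<otimes> g = g \<otimes> z"
    using z by (auto simp: group_center_def)
  have "\<exists>c. \<rho> z = c \<cdot>\<^sub>m 1\<^sub>m m"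
  proof (rule schur[OF irr rep_carrier[OF zc(1)]])
    show "\<rho> z *\<^sub>v (\<rho> g *\<^sub>v v) = \<rho> g *\<^sub>v (\<rho> z *\<^sub>v v)" if "g \<in> carrier G" "v \<in> carrier_vec m" for g v
      using rep_commute_vec[OF zc(1) that zc(2)[OF that(1)]] \<kappa>[OF that(1)] by simp
  qed
  then show ?thesis using fa zc by (auto simp: faithful_proj_def)
qed

text \<open>As \<open>\<kappa> z y = 1\<close>, the matrices \<open>\<rho> z\<close> and
  \<open>\<rho> y\<close> commute, and \<open>twisted_degree_bound\<close> applies with
  \<open>\<theta> = \<kappa> z x\<close> of order \<open>q = p ^ r\<close>.\<close>

lemma degree_bound_aux:
  assumes p: "Factorial_Ring.prime p" "odd p" and k: "k \<ge> 1"
    and c: "x \<in> carrier G" "y \<in> carrier G" "z \<in> carrier G"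
    and xy: "x \<otimes> y = y \<otimes> x \<otimes> z" and zx: "z \<otimes> x = x \<otimes> z" and zy: "z \<otimes> y = y \<otimes> z"
    and zM: "z [^] (p ^ (k - 1)) \<noteq> \<one>"
    and expo: "\<And>g. g \<in> carrier G \<Longrightarrow> g [^] (p ^ k) = \<one>"
    and fa: "faithful_proj G m \<rho>"
    and \<kappa>y: "\<kappa> z y = 1" and \<kappa>x: "\<And>i. \<kappa> z x ^ i = 1 \<longleftrightarrow> p ^ r dvd i" and r: "r \<le> k"
  shows "p ^ k \<le> m"
proof -
  \<comment> \<open>\<open>\<rho> x * \<rho> y\<close> and
    \<open>\<rho> y * \<rho> x * \<rho> z\<close> differ by this scalar. Absorbing it into the third
    matrix makes the relation of \<open>twisted_degree_bound\<close> exact.\<close>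
  define c0 where "c0 = \<alpha> x y / (\<alpha> x z * \<alpha> y (x \<otimes> z))"
  have c00: "c0 \<noteq> 0" using cocycle_nonzero c by (simp add: c0_def)
  have fin: "\<exists>e. e \<noteq> 0 \<and> (\<forall>v\<in>carrier_vec m. ((*\<^sub>v) (\<rho> g) ^^ (p ^ k)) v = e \<cdot>\<^sub>v v)" if "g \<in> carrier G" for g
    using rep_funpow[OF that, of "p ^ k"] expo[OF that] by (auto simp: rep_one)
  obtain a where a: "a \<noteq> 0" "\<And>v. v\<in>carrier_vec m \<Longrightarrow> ((*\<^sub>v) (\<rho> x) ^^ (p ^ k)) v = a \<cdot>\<^sub>v v"
    using fin[OF c(1)] by blast
  obtain b where b: "b \<noteq> 0" "\<And>v. v\<in>carrier_vec m \<Longrightarrow> ((*\<^sub>v) (\<rho> y) ^^ (p ^ k)) v = b \<cdot>\<^sub>v v"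
    using fin[OF c(2)] by blast
  obtain d where d: "d \<noteq> 0" "\<And>v. v\<in>carrier_vec m \<Longrightarrow> ((*\<^sub>v) (\<rho> z) ^^ (p ^ k)) v = d \<cdot>\<^sub>v v"
    using fin[OF c(3)] by blast
  let ?Z = "c0 \<cdot>\<^sub>m \<rho> z"
  note sv = smult_mat_mult_vec[OF rep_carrier[OF c(3)]]
  show ?thesis
  proof (rule twisted_degree_bound[OF p _ _ _ _ _ _ \<kappa>x _ k a(2,1) b(2,1)])
    show "\<rho> x *\<^sub>v (\<rho> y *\<^sub>v v) = \<rho> y *\<^sub>v (\<rho> x *\<^sub>v (?Z *\<^sub>v v))" if v: "v \<in> carrier_vec m" for v
    proof -
      have "\<rho> y *\<^sub>v (\<rho> x *\<^sub>v (?Z *\<^sub>v v)) = (c0 * (\<alpha> x z * \<alpha> y (x \<otimes> z))) \<cdot>\<^sub>v (\<rho> (y \<otimes> (x \<otimes> z)) *\<^sub>v v)"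
        using c v by (simp add: sv mult_mat_vec[of _ m m] rep_mult_vec smult_smult_assoc mult.assoc)
      then show ?thesis using c v cocycle_nonzero xy by (simp add: rep_mult_vec c0_def m_assoc)
    qed
    show "?Z *\<^sub>v (\<rho> y *\<^sub>v v) = \<rho> y *\<^sub>v (?Z *\<^sub>v v)" if v: "v \<in> carrier_vec m" for v
      using c v \<kappa>y by (simp add: sv mult_mat_vec[of _ m m] rep_commute_vec[OF c(3,2) v zy])
    show "?Z *\<^sub>v (\<rho> x *\<^sub>v v) = \<kappa> z x \<cdot>\<^sub>v (\<rho> x *\<^sub>v (?Z *\<^sub>v v))" if v: "v \<in> carrier_vec m" for v
      using c v by (simp add: sv mult_mat_vec[of _ m m] rep_commute_vec[OF c(3,1) v zx] smult_smult_assoc mult.commute)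
    show "((*\<^sub>v) ?Z ^^ (p ^ k)) v = (c0 ^ (p ^ k) * d) \<cdot>\<^sub>v v" if v: "v \<in> carrier_vec m" for v
      using funpow_smult_mat[OF rep_carrier[OF c(3)] v] d(2)[OF v] by (simp add: smult_smult_assoc)
    \<comment> \<open>Rescaling does not affect being scalar, so a scalar power here would make
      \<open>\<rho> (z [^] ?M)\<close> scalar for \<open>?M = p ^ (k - 1)\<close>, against
      faithfulness.\<close>
    show "\<exists>v\<in>carrier_vec m. ((*\<^sub>v) ?Z ^^ (p ^ (k - 1))) v \<noteq> e \<cdot>\<^sub>v v" for e
    proof (rule ccontr)
      assume neg: "\<not> ?thesis"
      let ?M = "p ^ (k - 1)"
      obtain f where f: "f \<noteq> 0" "\<And>v. v\<in>carrier_vec m \<Longrightarrow> ((*\<^sub>v) (\<rho> z) ^^ ?M) v = f \<cdot>\<^sub>v (\<rho> (z [^] ?M) *\<^sub>v v)"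
        using rep_funpow[OF c(3), of ?M] by blast
      let ?u = "c0 ^ ?M * f"
      have u0: "?u \<noteq> 0" using c00 f by simp
      have "\<rho> (z [^] ?M) = (inverse ?u * e) \<cdot>\<^sub>m 1\<^sub>m m"
      proof (rule scalar_matI)
        fix v :: "complex vec" assume v: "v \<in> carrier_vec m"
        have "?u \<cdot>\<^sub>v (\<rho> (z [^] ?M) *\<^sub>v v) = ((*\<^sub>v) ?Z ^^ ?M) v"
          unfolding funpow_smult_mat[OF rep_carrier[OF c(3)] v] f(2)[OF v] by (simp only: smult_smult_assoc)
        also have "\<dots> = e \<cdot>\<^sub>v v" using neg v by blast
        finally have "(inverse ?u * ?u) \<cdot>\<^sub>v (\<rho> (z [^] ?M) *\<^sub>v v) = (inverse ?u * e) \<cdot>\<^sub>v v"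
          by (simp only: smult_smult_assoc[symmetric])
        then show "\<rho> (z [^] ?M) *\<^sub>v v = (inverse ?u * e) \<cdot>\<^sub>v v" unfolding left_inverse[OF u0] by simp
      qed (use c in simp)
      then show False using fa c zM by (auto simp: faithful_proj_def)
    qed
  qed (use c c00 d r le_imp_power_dvd in auto)
qed

lemma degree_bound:
  assumes p: "Factorial_Ring.prime p" "odd p" and k: "k \<ge> 1"
    and c: "x \<in> carrier G" "y \<in> carrier G" "z \<in> carrier G"
    and xy: "x \<otimes> y = y \<otimes> x \<otimes> z" and zx: "z \<otimes> x = x \<otimes> z" and zy: "z \<otimes> y = y \<otimes> z"
    and zM: "z [^] (p ^ (k - 1)) \<noteq> \<one>"
    and expo: "\<And>g. g \<in> carrier G \<Longrightarrow> g [^] (p ^ k) = \<one>"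
    and fa: "faithful_proj G m \<rho>"
  shows "p ^ k \<le> m"
proof -
  let ?N = "p ^ k"
  have p0: "p > 0" using p by (simp add: prime_gt_0_nat)
  then have N0: "?N > 0" by simp
  have pow1: "\<kappa> z g ^ ?N = 1" if "g \<in> carrier G" "z \<otimes> g = g \<otimes> z" for g
    using comm_scalar_pow_right[of z g ?N] comm_scalar_one_right that c expo by simp
  have cm: "z \<otimes> x [^] l = x [^] l \<otimes> z" "z \<otimes> y [^] l = y [^] l \<otimes> z" for l :: nat
    using group_commutes_pow[of x z l] group_commutes_pow[of y z l] c zx zy by simp_all
  \<comment> \<open>Exponents are natural numbers, so \<open>(?N - 1) * j\<close> plays the part of
    \<open>- j\<close>. Multiplying one generator by this power of the other makes its
    \<open>\<kappa> z\<close> trivial.\<close>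
  have cancel: "w ^ j * w ^ ((?N - 1) * j) = 1" if "w ^ ?N = 1" for w :: complex and j
  proof -
    have "j + (?N - 1) * j = ?N * j" using N0 by (cases ?N) auto
    then show ?thesis using that by (metis power_add power_mult power_one)
  qed
  note pows = comm_scalar_mult_right comm_scalar_pow_right
  show ?thesis
  proof (rule prime_power_cyclic[OF p(1) pow1[OF c(1) zx] pow1[OF c(2) zy]])
    fix r j assume r: "r \<le> k" "\<And>i. \<kappa> z x ^ i = 1 \<longleftrightarrow> p ^ r dvd i" and j: "\<kappa> z y = \<kappa> z x ^ j"
    let ?l = "(?N - 1) * j"
    let ?y = "y \<otimes> x [^] ?l"
    show ?thesis
    proof (rule degree_bound_aux[OF p k c(1) _ c(3) _ zx _ zM expo fa _ r(2,1)])
      have "x \<otimes> ?y = y \<otimes> x \<otimes> (z \<otimes> x [^] ?l)" using c xy by (simp flip: m_assoc)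
      also have "\<dots> = y \<otimes> (x \<otimes> x [^] ?l) \<otimes> z" using c cm by (simp add: m_assoc)
      also have "x \<otimes> x [^] ?l = x [^] ?l \<otimes> x" using group_commutes_pow[of x x ?l] c by simp
      finally show "x \<otimes> ?y = ?y \<otimes> x \<otimes> z" using c by (simp add: m_assoc)
      have "z \<otimes> ?y = y \<otimes> (z \<otimes> x [^] ?l)" using c zy by (simp flip: m_assoc)
      then show "z \<otimes> ?y = ?y \<otimes> z" using c cm by (simp add: m_assoc)
      show "\<kappa> z ?y = 1" using c zx zy cm j cancel[OF pow1[OF c(1) zx]] by (simp add: pows)
    qed (use c in auto)
  next
    \<comment> \<open>The roles of \<open>x\<close> and \<open>y\<close> are exchanged, which
      replaces the commutator \<open>z\<close> by its inverse; hence the facts about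
      \<open>inv z\<close>.\<close>
    fix r j assume r: "r \<le> k" "\<And>i. \<kappa> z y ^ i = 1 \<longleftrightarrow> p ^ r dvd i" and j: "\<kappa> z x = \<kappa> z y ^ j"
    let ?l = "(?N - 1) * j"
    let ?y = "x \<otimes> y [^] ?l"
    have iz: "inv z \<otimes> g = g \<otimes> inv z" if "g \<in> carrier G" "z \<otimes> g = g \<otimes> z" for g
    proof -
      have "inv z \<otimes> g = inv z \<otimes> (g \<otimes> z) \<otimes> inv z" using that c by (simp add: m_assoc)
      also have "\<dots> = inv z \<otimes> (z \<otimes> g) \<otimes> inv z" by (simp only: that(2))
      also have "\<dots> = g \<otimes> inv z" using that(1) c by (simp flip: m_assoc)
      finally show ?thesis .
    qed
    have \<kappa>i: "\<kappa> (inv z) g = inverse (\<kappa> z g)" if g: "g \<in> carrier G" "z \<otimes> g = g \<otimes> z" for g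
    proof -
      have "\<kappa> (inv z) g * \<kappa> z g = \<kappa> \<one> g" using comm_scalar_mult_left[of "inv z" z g] g iz[OF g] c by simp
      also have "\<dots> = 1" using comm_scalar_swap[of \<one> g] comm_scalar_one_right g by simp
      finally show ?thesis by (metis inverse_unique mult.commute)
    qed
    have zy': "z \<otimes> ?y = ?y \<otimes> z"
    proof -
      have "z \<otimes> ?y = x \<otimes> (z \<otimes> y [^] ?l)" using c zx by (simp flip: m_assoc)
      then show ?thesis using c cm by (simp add: m_assoc)
    qed
    have yc: "?y \<in> carrier G" using c by simp
    show ?thesis
    proof (rule degree_bound_aux[OF p k c(2) yc _ _ iz[OF c(2) zy] iz[OF yc zy'] _ expo fa _ _ r(1)])
      have yx: "y \<otimes> x = x \<otimes> y \<otimes> inv z" using xy c by (simp add: m_assoc)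
      have "y \<otimes> ?y = (y \<otimes> x) \<otimes> y [^] ?l" using c by (simp add: m_assoc)
      also have "\<dots> = x \<otimes> y \<otimes> (inv z \<otimes> y [^] ?l)" using c unfolding yx by (simp add: m_assoc)
      also have "inv z \<otimes> y [^] ?l = y [^] ?l \<otimes> inv z" using iz[OF _ cm(2)] c by simp
      also have "x \<otimes> y \<otimes> (y [^] ?l \<otimes> inv z) = x \<otimes> (y \<otimes> y [^] ?l) \<otimes> inv z" using c by (simp add: m_assoc)
      also have "y \<otimes> y [^] ?l = y [^] ?l \<otimes> y" using group_commutes_pow[of y y ?l] c by simp
      finally show "y \<otimes> ?y = ?y \<otimes> y \<otimes> inv z" using c by (simp add: m_assoc)
      show "inv z [^] (p ^ (k - 1)) \<noteq> \<one>" using zM c by (simp add: nat_pow_inv)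
      have "\<kappa> z ?y = 1" using c zx zy cm j cancel[OF pow1[OF c(2) zy]] by (simp add: pows)
      then show "\<kappa> (inv z) ?y = 1" using \<kappa>i[OF yc zy'] by simp
      show "\<kappa> (inv z) y ^ i = 1 \<longleftrightarrow> p ^ r dvd i" for i
        using \<kappa>i[OF c(2) zy] r(2)[of i] by (simp add: power_inverse)
    qed (use c in auto)
  qed
qed

end

lemma proj_rep_obtain:
  assumes "group G" "proj_rep G m \<rho>"
  obtains \<alpha> where "proj_representation G \<alpha> m \<rho>"
  using assms unfolding proj_rep_def proj_representation_def proj_representation_axioms_def
    group_cocycle_def group_cocycle_axioms_def by blast


lemma faithful_irr_imp_heisenberg:
  fixes G (structure)
  assumes p: "Factorial_Ring.prime p" "odd p"
    and G: "p_group p G" "carrier G \<noteq> {\<one>}"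
    and der: "derived G (carrier G) \<subseteq> group_center G"
    and cyc: "cyclic_group (G\<lparr>carrier := group_center G\<rparr>)"
    and rep: "has_faithful_irr_proj_rep G m"
  shows "\<exists>k\<ge>1. G \<cong> heisenberg 1 (p ^ k)"
proof -
  interpret group G using G by (simp add: p_group_def)
  obtain \<rho> where \<rho>: "proj_rep G m \<rho>" "faithful_proj G m \<rho>" "irreducible_proj G m \<rho>"
    using rep by (auto simp: has_faithful_irr_proj_rep_def)
  obtain \<alpha> where "proj_representation G \<alpha> m \<rho>" using proj_rep_obtain[OF is_group \<rho>(1)] .
  then interpret proj_representation G \<alpha> m \<rho> .
  have fin: "finite (carrier G)" using G by (simp add: p_group_def)
  obtain e where e: "Coset.order G = p ^ e" using G by (auto simp: p_group_def)
  let ?Z = "group_center G" and ?C = "G\<lparr>carrier := group_center G\<rparr>"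
  have "subgroup ?Z G"
  proof (rule subgroupI)
    show "inv a \<in> ?Z" if a: "a \<in> ?Z" for a
    proof -
      have ac: "a \<in> carrier G" using a by (simp add: group_center_def)
      have "inv a \<otimes> g = g \<otimes> inv a" if g: "g \<in> carrier G" for g
      proof -
        have "inv (inv g \<otimes> a) = inv (a \<otimes> inv g)" using a g by (simp add: group_center_def)
        then show ?thesis using ac g by (simp add: inv_mult_group)
      qed
      then show ?thesis using ac by (simp add: group_center_def)
    qed
    show "a \<otimes> b \<in> ?Z" if ab: "a \<in> ?Z" "b \<in> ?Z" for a b
    proof -
      have c: "a \<in> carrier G" "b \<in> carrier G" using ab by (auto simp: group_center_def)
      have "a \<otimes> b \<otimes> g = g \<otimes> (a \<otimes> b)" if g: "g \<in> carrier G" for g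
      proof -
        have "a \<otimes> b \<otimes> g = a \<otimes> (b \<otimes> g)" using c g by (simp add: m_assoc)
        also have "b \<otimes> g = g \<otimes> b" using ab g by (simp add: group_center_def)
        also have "a \<otimes> (g \<otimes> b) = (a \<otimes> g) \<otimes> b" using c g by (simp add: m_assoc)
        also have "a \<otimes> g = g \<otimes> a" using ab g by (simp add: group_center_def)
        finally show ?thesis using c g by (simp add: m_assoc)
      qed
      then show ?thesis using c by (simp add: group_center_def)
    qed
  qed (auto simp: group_center_def)
  then interpret C: group ?C by (rule subgroup_imp_group)
  obtain \<zeta> where "\<zeta> \<in> carrier ?C" "subgroup_generated ?C {\<zeta>} = ?C"
    using cyc unfolding cyclic_group_def by blast
  then have \<zeta>: "\<zeta> \<in> ?Z" "generate ?C {\<zeta>} = ?Z"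
    by (auto simp: subgroup_generated_def dest!: arg_cong[of _ _ carrier])
  have "finite ?Z" using fin by (rule finite_subset[rotated]) (auto simp: group_center_def)
  then have "?Z = {\<zeta> [^]\<^bsub>?C\<^esub> k |k. k \<in> (UNIV :: nat set)}"
    using C.generate_pow_on_finite_carrier[of \<zeta>] \<zeta> by simp
  then have Z: "?Z = range (\<lambda>n::nat. \<zeta> [^] n)"
    unfolding nat_pow_consistent[symmetric] by blast
  have com: "\<exists>u\<in>?Z. g \<otimes> h = h \<otimes> g \<otimes> u" if gh: "g \<in> carrier G" "h \<in> carrier G" for g h
  proof
    \<comment> \<open>\<open>derived\<close> is generated by the elements
      \<open>a \<otimes> b \<otimes> inv a \<otimes> inv b\<close>, so the commutator wanted here
      arises from the inverses of \<open>g\<close> and \<open>h\<close>.\<close>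
    have "inv g \<otimes> inv h \<otimes> inv (inv g) \<otimes> inv (inv h) \<in> derived G (carrier G)"
      unfolding derived_def
      by (rule generate.incl, rule UN_I[OF inv_closed[OF gh(1)]], rule UN_I[OF inv_closed[OF gh(2)]]) simp
    then show "inv g \<otimes> inv h \<otimes> g \<otimes> h \<in> ?Z" using der gh by auto
    have "h \<otimes> g \<otimes> (inv g \<otimes> inv h \<otimes> g \<otimes> h) = h \<otimes> (g \<otimes> inv g) \<otimes> inv h \<otimes> g \<otimes> h"
      using gh by (simp only: m_assoc m_closed inv_closed)
    then show "g \<otimes> h = h \<otimes> g \<otimes> (inv g \<otimes> inv h \<otimes> g \<otimes> h)" using gh by simp
  qed
  have "\<zeta> \<in> carrier G" using \<zeta> by (simp add: group_center_def)
  from classification[OF p fin e G(2) this Z com nondegenerate[OF \<rho>(3,2)]] show ?thesis .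
qed

section \<open>Generators, commutators and powers in the Heisenberg groups\<close>

definition heis_x :: "nat \<Rightarrow> (nat \<Rightarrow> int) \<times> (nat \<Rightarrow> int) \<times> int" where
  "heis_x i = ((\<lambda>j. if j = i then 1 else 0), (\<lambda>_. 0), 0)"

definition heis_y :: "nat \<Rightarrow> (nat \<Rightarrow> int) \<times> (nat \<Rightarrow> int) \<times> int" where
  "heis_y i = ((\<lambda>_. 0), (\<lambda>j. if j = i then 1 else 0), 0)"

definition heis_z :: "(nat \<Rightarrow> int) \<times> (nat \<Rightarrow> int) \<times> int" where
  "heis_z = ((\<lambda>_. 0), (\<lambda>_. 0), 1)"

lemma heis_generators_carrier:
  assumes "N > 1"
  shows "i < n \<Longrightarrow> heis_x i \<in> carrier (heisenberg n N)" "i < n \<Longrightarrow> heis_y i \<in> carrier (heisenberg n N)"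
    "heis_z \<in> carrier (heisenberg n N)"
  using assms by (auto simp: heisenberg_carrier heis_x_def heis_y_def heis_z_def)

lemma heis_z_central:
  "heis_z \<otimes>\<^bsub>heisenberg n N\<^esub> g = g \<otimes>\<^bsub>heisenberg n N\<^esub> heis_z"
  by (simp add: heisenberg_simps heis_z_def add.commute fun_eq_iff)

lemma heis_commutator:
  assumes "N > 1" "i < n"
  shows "heis_x i \<otimes>\<^bsub>heisenberg n N\<^esub> heis_y i =
    heis_y i \<otimes>\<^bsub>heisenberg n N\<^esub> heis_x i \<otimes>\<^bsub>heisenberg n N\<^esub> heis_z"
proof -
  have "(\<Sum>j<n. (if j = i then 1 else 0) * (if j = i then 1 else 0)) = (1::int)"
    using assms(2) by (simp add: if_distrib[of "\<lambda>x. _ * x"] cong: if_cong)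
  then show ?thesis using assms by (auto simp: heisenberg_simps heis_x_def heis_y_def heis_z_def fun_eq_iff)
qed

lemma heis_commute:
  assumes "i < n"
  shows "fst (snd g) i = 0 \<Longrightarrow> heis_x i \<otimes>\<^bsub>heisenberg n N\<^esub> g = g \<otimes>\<^bsub>heisenberg n N\<^esub> heis_x i"
    and "fst g i = 0 \<Longrightarrow> heis_y i \<otimes>\<^bsub>heisenberg n N\<^esub> g = g \<otimes>\<^bsub>heisenberg n N\<^esub> heis_y i"
proof -
  have *: "(\<Sum>j<n. (if j = i then 1 else 0) * f j) = f i" "(\<Sum>j<n. f j * (if j = i then 1 else 0)) = f i"
    for f :: "nat \<Rightarrow> int"
    using assms by (simp_all add: if_distrib[of "\<lambda>x. x * _"] if_distrib[of "\<lambda>x. _ * x"] cong: if_cong)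
  show "fst (snd g) i = 0 \<Longrightarrow> heis_x i \<otimes>\<^bsub>heisenberg n N\<^esub> g = g \<otimes>\<^bsub>heisenberg n N\<^esub> heis_x i"
    by (simp add: heisenberg_simps heis_x_def * add.commute fun_eq_iff)
  show "fst g i = 0 \<Longrightarrow> heis_y i \<otimes>\<^bsub>heisenberg n N\<^esub> g = g \<otimes>\<^bsub>heisenberg n N\<^esub> heis_y i"
    by (simp add: heisenberg_simps heis_y_def * add.commute fun_eq_iff)
qed

text \<open>Multiplying the \<open>l\<close>-th power by \<open>g\<close> adds \<open>l\<close>
  copies of the sum of the a_i * b_i, hence the triangular coefficient.\<close>

lemma heis_pow:
  assumes g: "g \<in> carrier (heisenberg n N)"
  shows "g [^]\<^bsub>heisenberg n N\<^esub> (l::nat) =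
     ((\<lambda>i. if i < n then (int l * fst g i) mod int N else 0),
      (\<lambda>i. if i < n then (int l * fst (snd g) i) mod int N else 0),
      (int l * snd (snd g) + int (\<Sum>{..<l}) * (\<Sum>i<n. fst g i * fst (snd g) i)) mod int N)"
proof (induction l)
  case 0
  then show ?case by (simp add: heisenberg_simps nat_pow_def fun_eq_iff)
next
  case (Suc l)
  let ?S = "\<Sum>i<n. fst g i * fst (snd g) i"
  have "((int l * snd (snd g) + int (\<Sum>{..<l}) * ?S) mod int N + snd (snd g) +
      (\<Sum>i<n. (if i < n then (int l * fst g i) mod int N else 0) * fst (snd g) i)) mod int N
    = ((int l * snd (snd g) + int (\<Sum>{..<l}) * ?S) + snd (snd g) + (\<Sum>i<n. (int l * fst g i) * fst (snd g) i)) mod int N"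
    by (rule mod_add_cong) (simp add: mod_simps, rule mod_sum_mult_mod(1))
  also have "(\<Sum>i<n. (int l * fst g i) * fst (snd g) i) = int l * ?S"
    by (simp add: sum_distrib_left mult.assoc)
  finally show ?case using Suc
    by (simp add: nat_pow_def heisenberg_simps mod_simps algebra_simps fun_eq_iff)
qed

text \<open>Oddness makes the triangular coefficient at \<open>l = N\<close> a multiple of
  \<open>N\<close>.\<close>

lemma heis_exponent:
  assumes "odd N" and g: "g \<in> carrier (heisenberg n N)"
  shows "g [^]\<^bsub>heisenberg n N\<^esub> N = \<one>\<^bsub>heisenberg n N\<^esub>"
proof -
  have "N dvd \<Sum>{..<N}" using odd_dvd_sum_lessThan_nat[OF assms(1)] by simp
  then have "int N dvd int (\<Sum>{..<N}) * s" for s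
    by (simp add: dvd_mult2 del: of_nat_sum)
  then show ?thesis unfolding heis_pow[OF g] by (simp add: heisenberg_simps fun_eq_iff del: of_nat_sum)
qed

lemma heisenberg_degree_bound:
  assumes p: "Factorial_Ring.prime p" "odd p" and k: "k \<ge> 1"
    and rep: "has_faithful_proj_rep (heisenberg 1 (p ^ k)) m"
  shows "p ^ k \<le> m"
proof -
  let ?H = "heisenberg 1 (p ^ k)"
  have p1: "p > 1" using prime_gt_1_nat[OF p(1)] .
  then have N1: "p ^ k > 1" using one_less_power[OF p1, of k] k by simp
  have "group ?H" by (rule group_heisenberg) (use p1 in simp)
  moreover obtain \<rho> where \<rho>: "proj_rep ?H m \<rho>" "faithful_proj ?H m \<rho>"
    using rep by (auto simp: has_faithful_proj_rep_def)
  ultimately obtain \<alpha> where "proj_representation ?H \<alpha> m \<rho>" using proj_rep_obtain by blast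
  then interpret proj_representation ?H \<alpha> m \<rho> .
  show ?thesis
  proof (rule degree_bound[OF p k _ _ _ heis_commutator[OF N1, of 0] heis_z_central heis_z_central _ _ \<rho>(2)])
    have "p ^ (k - 1) < p ^ k" using p1 k by simp
    then show "heis_z [^]\<^bsub>?H\<^esub> (p ^ (k - 1)) \<noteq> \<one>\<^bsub>?H\<^esub>"
      unfolding heis_pow[OF heis_generators_carrier(3)[OF N1]]
      using p1 by (simp add: heis_z_def heisenberg_simps flip: of_nat_power)
    show "g [^]\<^bsub>?H\<^esub> (p ^ k) = \<one>\<^bsub>?H\<^esub>" if "g \<in> carrier ?H" for g
      using heis_exponent that p by simp
  qed (use heis_generators_carrier[OF N1] in auto)
qed

text \<open>Every element is a product of one commuting with \<open>x\<^sub>1, y\<^sub>1\<close> and one commuting with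
  \<open>x\<^sub>0, y\<^sub>0\<close>, so the central commutator \<open>z\<close> pairs trivially with everything.\<close>

lemma heisenberg_no_faithful_irr:
  assumes N: "N > 1" and n: "n > 1"
  shows "\<not> has_faithful_irr_proj_rep (heisenberg n N) m"
proof
  let ?H = "heisenberg n N"
  assume "has_faithful_irr_proj_rep ?H m"
  then obtain \<rho> where \<rho>: "proj_rep ?H m \<rho>" "faithful_proj ?H m \<rho>" "irreducible_proj ?H m \<rho>"
    by (auto simp: has_faithful_irr_proj_rep_def)
  have "group ?H" using group_heisenberg N by simp
  then obtain \<alpha> where "proj_representation ?H \<alpha> m \<rho>" using proj_rep_obtain \<rho> by blast
  then interpret proj_representation ?H \<alpha> m \<rho> .
  note gens = heis_generators_carrier[OF N]
  have triv: "\<kappa> heis_z g = 1" if g: "g \<in> carrier ?H" and i: "i < n" "fst g i = 0" "fst (snd g) i = 0" for g i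
    by (rule comm_scalar_commutator[OF g gens(1)[OF i(1)] gens(2)[OF i(1)] gens(3) heis_commutator[OF N i(1)]
       heis_commute(1)[OF i(1,3)] heis_commute(2)[OF i(1,2)] heis_z_central])
  have "heis_z = \<one>\<^bsub>?H\<^esub>"
  proof (rule nondegenerate[OF \<rho>(3,2)])
    show "heis_z \<in> group_center ?H" using gens(3) heis_z_central by (auto simp: group_center_def)
    fix g assume g: "g \<in> carrier ?H"
    let ?u = "((\<lambda>i. if i = 1 then 0 else fst g i), (\<lambda>i. if i = 1 then 0 else fst (snd g) i), snd (snd g))"
    let ?v = "((\<lambda>i. if i = 1 then fst g i else 0), (\<lambda>i. if i = 1 then fst (snd g) i else 0), 0)"
    have uv: "?u \<in> carrier ?H" "?v \<in> carrier ?H" using g n N by (auto simp: heisenberg_carrier)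
    have "(\<Sum>i<n. (if i = Suc 0 then 0 else fst g i) * (if i = Suc 0 then fst (snd g) i else 0)) = 0"
      by (rule sum.neutral) auto
    then have "g = ?u \<otimes>\<^bsub>?H\<^esub> ?v"
      using g by (auto simp: heisenberg_simps heisenberg_carrier prod_eq_iff fun_eq_iff not_less)
    moreover have "\<kappa> heis_z ?u = 1" "\<kappa> heis_z ?v = 1"
      using triv[OF uv(1), of 1] triv[OF uv(2), of 0] n by auto
    ultimately show "\<kappa> heis_z g = 1"
      using comm_scalar_mult_right[OF gens(3) uv heis_z_central heis_z_central] by simp
  qed
  then show False by (simp add: heis_z_def heisenberg_simps)
qed

section \<open>Monomial representations\<close>

text \<open>Scalars are carried as integer exponents, so that identities between phases become
  congruences modulo \<open>N\<close>.\<close>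

definition root_phase :: "nat \<Rightarrow> int \<Rightarrow> complex" where
  "root_phase N t = cis (2 * pi * of_int t / of_nat N)"

lemma root_phase_add: "root_phase N (s + t) = root_phase N s * root_phase N t"
  by (simp add: root_phase_def cis_mult add_divide_distrib algebra_simps)

lemma root_phase_0 [simp]: "root_phase N 0 = 1"
  by (simp add: root_phase_def)

lemma root_phase_nonzero [simp]: "root_phase N t \<noteq> 0"
  by (simp add: root_phase_def)

lemma root_phase_eq_1_iff:
  assumes "N > 0"
  shows "root_phase N t = 1 \<longleftrightarrow> int N dvd t"
proof
  assume "root_phase N t = 1"
  then have "cos (2 * pi * of_int t / of_nat N) = 1" by (simp add: root_phase_def complex_eq_iff)
  then obtain l :: int where "2 * pi * of_int t / of_nat N = of_int l * 2 * pi"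
    using cos_one_2pi_int by auto
  then have "real_of_int t = of_int l * of_nat N" using assms by (simp add: field_simps)
  also have "\<dots> = real_of_int (l * int N)" by simp
  finally have "t = l * int N" by (simp only: of_int_eq_iff)
  then show "int N dvd t" by simp
next
  assume "int N dvd t"
  then obtain l where "t = int N * l" by (elim dvdE)
  then have "2 * pi * of_int t / of_nat N = 2 * pi * of_int l" using assms by simp
  then show "root_phase N t = 1" unfolding root_phase_def by (simp only: cis_multiple_2pi[OF Ints_of_int])
qed

lemma root_phase_eq_iff:
  assumes "N > 0"
  shows "root_phase N s = root_phase N t \<longleftrightarrow> [s = t] (mod int N)"
proof -
  have "root_phase N s = root_phase N (s - t) * root_phase N t" by (simp flip: root_phase_add)
  then have "root_phase N s = root_phase N t \<longleftrightarrow> root_phase N (s - t) = 1" by auto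
  then show ?thesis using root_phase_eq_1_iff[OF assms] by (simp add: cong_iff_dvd_diff)
qed

lemma zdvd_less_imp_zero: "(n::int) dvd t \<Longrightarrow> 0 \<le> t \<Longrightarrow> t < n \<Longrightarrow> t = 0"
  using mod_pos_pos_trivial[of t n] by (simp add: dvd_eq_mod_eq_0)

text \<open>The basis vector with label \<open>s\<close> goes to \<open>\<phi> g s\<close> times the
  one with label \<open>f g s\<close>; \<open>ix\<close> numbers the labels.\<close>

definition monomial_rep ::
  "nat \<Rightarrow> (nat \<Rightarrow> 's) \<Rightarrow> ('g \<Rightarrow> 's \<Rightarrow> 's) \<Rightarrow> ('g \<Rightarrow> 's \<Rightarrow> complex) \<Rightarrow> 'g \<Rightarrow> complex mat" where
  "monomial_rep m ix f \<phi> g = mat m m (\<lambda>(i, j). if ix i = f g (ix j) then \<phi> g (ix j) else 0)"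

lemma monomial_rep_carrier [simp]: "monomial_rep m ix f \<phi> g \<in> carrier_mat m m"
  by (simp add: monomial_rep_def)

lemma monomial_rep_dims [simp]:
  "dim_row (monomial_rep m ix f \<phi> g) = m" "dim_col (monomial_rep m ix f \<phi> g) = m"
  by (simp_all add: monomial_rep_def)

lemma smult_1_mat [simp]: "1 \<cdot>\<^sub>m A = (A :: 'a::field mat)"
  by (intro eq_matI) auto

lemma monomial_rep_index:
  "i < m \<Longrightarrow> j < m \<Longrightarrow> monomial_rep m ix f \<phi> g $$ (i, j) = (if ix i = f g (ix j) then \<phi> g (ix j) else 0)"
  by (simp add: monomial_rep_def)

text \<open>\<open>\<phi>_mult\<close> compares \<open>R g * R h\<close> with
  \<open>R (g \<otimes> h)\<close> on one basis vector. Its content is that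
  \<open>\<alpha> g h\<close> does not depend on the label \<open>s\<close>; the cocycle identity is
  then automatic.\<close>

locale monomial_data = group G for G (structure) +
  fixes S :: "'s set" and m :: nat and ix :: "nat \<Rightarrow> 's"
    and f :: "'a \<Rightarrow> 's \<Rightarrow> 's" and \<phi> :: "'a \<Rightarrow> 's \<Rightarrow> complex" and \<alpha> :: "'a \<Rightarrow> 'a \<Rightarrow> complex"
  assumes m0: "0 < m" and ix: "bij_betw ix {..<m} S"
    and f_closed: "\<And>g s. g \<in> carrier G \<Longrightarrow> s \<in> S \<Longrightarrow> f g s \<in> S"
    and f_one: "\<And>s. s \<in> S \<Longrightarrow> f \<one> s = s"
    and f_mult: "\<And>g h s. g \<in> carrier G \<Longrightarrow> h \<in> carrier G \<Longrightarrow> s \<in> S \<Longrightarrow> f g (f h s) = f (g \<otimes> h) s"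
    and \<phi>_one: "\<And>s. s \<in> S \<Longrightarrow> \<phi> \<one> s = 1"
    and \<phi>_nz: "\<And>g s. g \<in> carrier G \<Longrightarrow> s \<in> S \<Longrightarrow> \<phi> g s \<noteq> 0"
    and \<phi>_mult: "\<And>g h s. g \<in> carrier G \<Longrightarrow> h \<in> carrier G \<Longrightarrow> s \<in> S \<Longrightarrow>
        \<phi> h s * \<phi> g (f h s) = \<alpha> g h * \<phi> (g \<otimes> h) s"
    and \<alpha>_nz: "\<And>g h. g \<in> carrier G \<Longrightarrow> h \<in> carrier G \<Longrightarrow> \<alpha> g h \<noteq> 0"
begin

abbreviation R where "R \<equiv> monomial_rep m ix f \<phi>"

lemma ix_mem: "i < m \<Longrightarrow> ix i \<in> S"
  using ix by (auto simp: bij_betw_def)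

lemma ix_eq_iff: "i < m \<Longrightarrow> j < m \<Longrightarrow> ix i = ix j \<longleftrightarrow> i = j"
  using ix by (auto simp: bij_betw_def inj_on_def)

lemma ix_surj: "s \<in> S \<Longrightarrow> \<exists>i<m. ix i = s"
  using ix by (auto simp: bij_betw_def)

lemma R_mult:
  assumes g: "g \<in> carrier G" and h: "h \<in> carrier G"
  shows "R g * R h = \<alpha> g h \<cdot>\<^sub>m R (g \<otimes> h)"
proof (rule eq_matI)
  fix i j assume "i < dim_row (\<alpha> g h \<cdot>\<^sub>m R (g \<otimes> h))" "j < dim_col (\<alpha> g h \<cdot>\<^sub>m R (g \<otimes> h))"
  then have ij: "i < m" "j < m" by (auto simp: monomial_rep_def)
  obtain l where l: "l < m" "ix l = f h (ix j)" using ix_surj f_closed[OF h] ix_mem ij by blast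
  have "(R g * R h) $$ (i, j) = (\<Sum>k = 0..<m. R g $$ (i, k) * R h $$ (k, j))"
    using ij by (simp add: monomial_rep_def scalar_prod_def)
  also have "\<dots> = (\<Sum>k = 0..<m. if k = l then R g $$ (i, l) * \<phi> h (ix j) else 0)"
    by (rule sum.cong) (use ij l in \<open>auto simp: monomial_rep_index simp flip: l(2) dest: ix_eq_iff[THEN iffD1, rotated 2]\<close>)
  also have "\<dots> = R g $$ (i, l) * \<phi> h (ix j)" using l by simp
  also have "\<dots> = (\<alpha> g h \<cdot>\<^sub>m R (g \<otimes> h)) $$ (i, j)"
    using ij l f_mult[OF g h ix_mem[OF ij(2)]] \<phi>_mult[OF g h ix_mem[OF ij(2)]]
    by (simp add: monomial_rep_index mult.commute)
  finally show "(R g * R h) $$ (i, j) = (\<alpha> g h \<cdot>\<^sub>m R (g \<otimes> h)) $$ (i, j)" .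
qed (simp_all add: monomial_rep_def)

lemma R_one: "R \<one> = 1\<^sub>m m"
  by (rule eq_matI) (auto simp: monomial_rep_def ix_mem f_one \<phi>_one ix_eq_iff)

lemma alpha_rep_R: "alpha_rep G \<alpha> m R"
  unfolding alpha_rep_def
proof (intro conjI ballI)
  fix g assume g: "g \<in> carrier G"
  let ?a = "\<alpha> g (inv g)"
  let ?B = "inverse ?a \<cdot>\<^sub>m R (inv g)"
  have B: "?B \<in> carrier_mat m m" by simp
  have 1: "R g * ?B = 1\<^sub>m m"
  proof -
    have "R g * ?B = inverse ?a \<cdot>\<^sub>m (?a \<cdot>\<^sub>m 1\<^sub>m m)"
      using g by (simp add: mult_smult_distrib[of _ m m _ m] R_mult R_one)
    then show ?thesis using \<alpha>_nz[of g "inv g"] g by (simp add: smult_smult_mat)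
  qed
  then have "?B * R g = 1\<^sub>m m" using mat_mult_left_right_inverse[of "R g" m ?B] by simp
  then show "invertible_mat (R g)"
    using 1 unfolding invertible_mat_def inverts_mat_def
    by (intro conjI exI[of _ ?B]) (auto simp: monomial_rep_def)
qed (simp_all add: R_one R_mult)

lemma proj_rep_R: "proj_rep G m R"
  unfolding proj_rep_def
  using m0 alpha_rep_R cocycle_alpha_rep[OF alpha_rep_R m0 \<alpha>_nz] by blast

lemma R_scalar:
  assumes g: "g \<in> carrier G" and sc: "R g = c \<cdot>\<^sub>m 1\<^sub>m m" and s: "s \<in> S"
  shows "f g s = s" "\<phi> g s = c"
proof -
  obtain j where j: "j < m" "ix j = s" using ix_surj s by blast
  obtain l where l: "l < m" "ix l = f g s" using ix_surj f_closed[OF g s] by blast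
  have "\<phi> g s = R g $$ (l, j)" using j l by (simp add: monomial_rep_index)
  also have "\<dots> = (if l = j then c else 0)" using sc j l by simp
  finally have "l = j \<and> \<phi> g s = c" using \<phi>_nz[OF g s] by (simp split: if_splits)
  then show "f g s = s" "\<phi> g s = c" using j l by auto
qed

lemma R_unit_vec:
  assumes j: "j < m" and l: "l < m" "ix l = f g (ix j)"
  shows "R g *\<^sub>v unit_vec m j = \<phi> g (ix j) \<cdot>\<^sub>v unit_vec m l"
proof (rule eq_vecI)
  fix i assume "i < dim_vec (\<phi> g (ix j) \<cdot>\<^sub>v unit_vec m l)"
  then have i: "i < m" by simp
  have "(R g *\<^sub>v unit_vec m j) $ i = R g $$ (i, j)"
    using i j by simp
  also have "\<dots> = (if i = l then \<phi> g (ix j) else 0)" using i j l ix_eq_iff by (simp add: monomial_rep_index flip: l(2))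
  finally show "(R g *\<^sub>v unit_vec m j) $ i = (\<phi> g (ix j) \<cdot>\<^sub>v unit_vec m l) $ i" using i l j by simp
qed (simp add: monomial_rep_def)

lemma R_diagonal:
  assumes i: "i < m" and v: "v \<in> carrier_vec m" and f: "\<And>s. s \<in> S \<Longrightarrow> f g s = s"
  shows "(R g *\<^sub>v v) $ i = \<phi> g (ix i) * v $ i"
proof -
  have "(R g *\<^sub>v v) $ i = (\<Sum>j = 0..<m. R g $$ (i, j) * v $ j)"
    using i v by (simp add: scalar_prod_def carrier_vecD)
  also have "\<dots> = (\<Sum>j = 0..<m. if j = i then \<phi> g (ix i) * v $ i else 0)"
    by (rule sum.cong) (use i f ix_mem in \<open>auto simp: monomial_rep_index ix_eq_iff\<close>)
  finally show ?thesis using i by simp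
qed

end

lemma subspace_unit_vecs:
  assumes W: "lin_subspace m W" and e: "\<And>i. i < m \<Longrightarrow> unit_vec m i \<in> W"
  shows "W = carrier_vec m"
proof
  show "carrier_vec m \<subseteq> W"
  proof
    fix v :: "'a vec" assume v: "v \<in> carrier_vec m"
    have "vec m (\<lambda>i. if i < k then v $ i else 0) \<in> W" if "k \<le> m" for k
      using that
    proof (induction k)
      case 0
      have "vec m (\<lambda>i. if i < 0 then v $ i else 0) = 0\<^sub>v m" by auto
      then show ?case using W by (simp add: lin_subspace_def)
    next
      case (Suc k)
      have "vec m (\<lambda>i. if i < Suc k then v $ i else 0)
        = vec m (\<lambda>i. if i < k then v $ i else 0) + v $ k \<cdot>\<^sub>v unit_vec m k"
        using Suc.prems by (intro eq_vecI) (auto simp: less_Suc_eq)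
      then show ?case using Suc W e[of k] by (simp add: lin_subspace_def)
    qed
    moreover have "v = vec m (\<lambda>i. if i < m then v $ i else 0)" using v by (intro eq_vecI) auto
    ultimately show "v \<in> W" by (metis order_refl)
  qed
qed (use W in \<open>auto simp: lin_subspace_def\<close>)

text \<open>In the basis \<open>e\<^sub>j\<close> of eigenvectors of \<open>z\<close>, the generator \<open>x\<close> shifts \<open>j\<close> and \<open>x y = y x z\<close>
  forces \<open>y\<close> to scale \<open>e\<^sub>j\<close> by the phase of \<open>- j (j - 1) / 2\<close>; below, \<open>h\<close> is the inverse of 2
  modulo \<open>N\<close>.\<close>

lemma heisenberg_faithful_irr:
  assumes N: "N > 1" "odd N"
  shows "has_faithful_irr_proj_rep (heisenberg 1 N) N"
proof -
  let ?H = "heisenberg 1 N"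
  interpret H: group ?H by (rule group_heisenberg) (use N in simp)
  define h where "h = (int N + 1) div 2"
  have h: "int N = 2 * h - 1" using N(2) by (auto simp: h_def elim!: oddE)
  let ?A = "\<lambda>g::(nat \<Rightarrow> int) \<times> (nat \<Rightarrow> int) \<times> int. fst g 0"
  let ?B = "\<lambda>g::(nat \<Rightarrow> int) \<times> (nat \<Rightarrow> int) \<times> int. fst (snd g) 0"
  let ?C = "\<lambda>g::(nat \<Rightarrow> int) \<times> (nat \<Rightarrow> int) \<times> int. snd (snd g)"
  define f where "f g j = (j + ?A g) mod int N" for g and j :: int
  \<comment> \<open>The triple (a, b, c) is y^b x^a z^c: it scales the basis vector \<open>j\<close>
    by the phase of c * j, shifts it to j + a and applies the phase of y^b there.\<close>
  define E where "E g j = ?C g * j - ?B g * (h * ((j + ?A g) * (j + ?A g - 1)))" for g and j :: int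
  define \<phi> where "\<phi> g j = root_phase N (E g j)" for g and j :: int
  define Y where "Y g k = ?C g * ?A k + 2 * h * ?A g * ?B k * ?A k + ?B k * h * ?A g * (?A g - 1)" for g k
  define \<alpha> where "\<alpha> g k = root_phase N (Y g k)" for g k
  have N0: "N > 0" using N by simp
  interpret M: monomial_data ?H "{0..<int N}" N int f \<phi> \<alpha>
  proof
    show "0 < N" by fact
    show "bij_betw int {..<N} {0..<int N}"
      by (simp add: bij_betw_def lessThan_atLeast0 image_int_atLeastLessThan)
    fix g k :: "(nat \<Rightarrow> int) \<times> (nat \<Rightarrow> int) \<times> int" and j :: int
    assume j: "j \<in> {0..<int N}"
    show "f \<one>\<^bsub>?H\<^esub> j = j" using j by (simp add: f_def heisenberg_simps)
    show "\<phi> \<one>\<^bsub>?H\<^esub> j = 1" by (simp add: \<phi>_def E_def heisenberg_simps)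
    show "f g j \<in> {0..<int N}" using N0 by (simp add: f_def)
    show "\<phi> g j \<noteq> 0" by (simp add: \<phi>_def)
    show "f g (f k j) = f (g \<otimes>\<^bsub>?H\<^esub> k) j"
      by (simp add: f_def heisenberg_simps mod_simps ac_simps)
    have 1: "[E g (f k j) = E g (j + ?A k)] (mod int N)"
      unfolding E_def f_def by (intro cong_diff cong_mult cong_add cong_refl; simp add: cong_def)
    have 2: "[E (g \<otimes>\<^bsub>?H\<^esub> k) j = (?C g + ?C k + ?A g * ?B k) * j
        - (?B g + ?B k) * (h * ((j + (?A g + ?A k)) * (j + (?A g + ?A k) - 1)))] (mod int N)"
      unfolding E_def heisenberg_simps
      by (simp, (intro cong_diff cong_mult cong_add cong_refl; simp add: cong_def))
    \<comment> \<open>Comparison with the exponent of the product leaves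
      \<open>(2 * h - 1) * ?A g * ?B k * j\<close> as the only term in \<open>j\<close>, a multiple
      of \<open>N\<close> because \<open>2 * h - 1 = N\<close>. The rest is
      \<open>Y\<close>.\<close>
    have "E k j + E g (j + ?A k) = Y g k + ((?C g + ?C k + ?A g * ?B k) * j
        - (?B g + ?B k) * (h * ((j + (?A g + ?A k)) * (j + (?A g + ?A k) - 1)))) + int N * (?A g * ?B k * j)"
      unfolding E_def Y_def h by (simp add: algebra_simps)
    then have "[E k j + E g (j + ?A k) = Y g k + ((?C g + ?C k + ?A g * ?B k) * j
        - (?B g + ?B k) * (h * ((j + (?A g + ?A k)) * (j + (?A g + ?A k) - 1))))] (mod int N)"
      by (simp add: cong_def)
    then have "[E k j + E g (f k j) = Y g k + E (g \<otimes>\<^bsub>?H\<^esub> k) j] (mod int N)"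
      using 1 2 by (meson cong_add cong_refl cong_sym cong_trans)
    then show "\<phi> k j * \<phi> g (f k j) = \<alpha> g k * \<phi> (g \<otimes>\<^bsub>?H\<^esub> k) j"
      using root_phase_eq_iff[OF N0] by (simp add: \<phi>_def \<alpha>_def flip: root_phase_add)
  qed (simp add: \<alpha>_def)
  have fa: "faithful_proj ?H N M.R"
    unfolding faithful_proj_def
  proof (intro ballI impI)
    fix g assume g: "g \<in> carrier ?H" and "\<exists>c. M.R g = c \<cdot>\<^sub>m 1\<^sub>m N"
    then obtain c where c: "M.R g = c \<cdot>\<^sub>m 1\<^sub>m N" by blast
    note sc = M.R_scalar[OF g c]
    have g': "0 \<le> ?A g" "?A g < int N" "0 \<le> ?B g" "?B g < int N" "0 \<le> ?C g" "?C g < int N"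
      "\<And>i. i \<ge> 1 \<Longrightarrow> fst g i = 0" "\<And>i. i \<ge> 1 \<Longrightarrow> fst (snd g) i = 0"
      using g by (auto simp: heisenberg_carrier)
    have N3: "N \<ge> 3" using N by (cases "N = 2") auto
    have "f g 0 = 0" using sc(1)[of 0] N by simp
    then have A: "?A g = 0" using g' by (simp add: f_def)
    \<comment> \<open>The phase of \<open>y\<close> is trivial at the labels 0 and 1, so comparing
      them isolates the \<open>z\<close>-coordinate. Label 2 then isolates the
      \<open>y\<close>-coordinate, as \<open>2 * h\<close> is 1 modulo \<open>N\<close>.\<close>
    have e: "root_phase N (E g 1) = root_phase N (E g 0)" "root_phase N (E g 2) = root_phase N (E g 0)"
      using sc(2)[of 0] sc(2)[of 1] sc(2)[of 2] N3 by (auto simp: \<phi>_def)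
    have "root_phase N (?C g) = 1" using e(1) A by (simp add: E_def)
    then have C: "?C g = 0" using zdvd_less_imp_zero g' root_phase_eq_1_iff[OF N0] by blast
    have "root_phase N (- (?B g * (h * 2))) = 1" using e(2) A C by (simp add: E_def)
    then have "int N dvd ?B g * (int N + 1)" using root_phase_eq_1_iff[OF N0] h by (simp add: mult.commute)
    then have "int N dvd ?B g" by (simp add: distrib_left dvd_add_right_iff)
    then have B: "?B g = 0" using zdvd_less_imp_zero g' by blast
    have "fst g = (\<lambda>_. 0)" "fst (snd g) = (\<lambda>_. 0)"
      using A B g'(7,8) by (auto simp: fun_eq_iff) (metis One_nat_def Suc_leI not_gr0)+
    then show "g = \<one>\<^bsub>?H\<^esub>" using C by (simp add: heisenberg_simps prod_eq_iff)
  qed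
  obtain \<alpha>' where "proj_representation ?H \<alpha>' N M.R"
    using proj_rep_obtain[OF H.is_group M.proj_rep_R] .
  then interpret P: proj_representation ?H \<alpha>' N M.R .
  have zc: "heis_z \<in> carrier ?H" using heis_generators_carrier[OF N(1)] by simp
  have irr: "irreducible_proj ?H N M.R"
    unfolding irreducible_proj_def
  proof (intro allI impI)
    fix W assume inv: "invariant_subspace ?H N M.R W"
    show "W = {0\<^sub>v N} \<or> W = carrier_vec N"
    proof (cases "W = {0\<^sub>v N}")
      case False
      have W: "lin_subspace N W" using inv by (auto simp: invariant_subspace_def lin_subspace_def)
      have WC: "w \<in> carrier_vec N" if "w \<in> W" for w using W that by (auto simp: lin_subspace_def)
      have act: "M.R g *\<^sub>v w \<in> W" if "g \<in> carrier ?H" "w \<in> W" for g w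
        using inv that by (auto simp: invariant_subspace_def)
      have sm: "c \<cdot>\<^sub>v w \<in> W" if "w \<in> W" for c w using W that by (auto simp: lin_subspace_def)
      obtain w where w: "w \<in> W" "w \<noteq> 0\<^sub>v N" using False W by (auto simp: lin_subspace_def)
      obtain d where d: "\<forall>v\<in>carrier_vec N. ((*\<^sub>v) (M.R heis_z) ^^ N) v = d \<cdot>\<^sub>v (M.R (heis_z [^]\<^bsub>?H\<^esub> N) *\<^sub>v v)"
        using P.rep_funpow[OF zc, of N] by blast
      have d': "((*\<^sub>v) (M.R heis_z) ^^ N) v = d \<cdot>\<^sub>v v" if "v \<in> W" for v
        using d WC[OF that] unfolding heis_exponent[OF N(2) zc] M.R_one by simp
      obtain v \<mu> where v: "v \<in> W" "v \<noteq> 0\<^sub>v N" "M.R heis_z *\<^sub>v v = \<mu> \<cdot>\<^sub>v v"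
        using eigenvector_in_subspace[OF monomial_rep_carrier W act[OF zc] d' N0 w] by blast
      \<comment> \<open>\<open>heis_z\<close> acts diagonally with distinct eigenvalues, so an
        eigenvector in \<open>W\<close> is a multiple of one unit vector; powers of \<open>x\<close>
        then move it to all the others.\<close>
      have ev: "root_phase N (int i) * v $ i = \<mu> * v $ i" if i: "i < N" for i
      proof -
        have "\<phi> heis_z (int i) * v $ i = (M.R heis_z *\<^sub>v v) $ i"
          by (rule M.R_diagonal[symmetric, OF i WC[OF v(1)]]) (simp add: f_def heis_z_def)
        also have "\<dots> = \<mu> * v $ i" using v(3) i WC[OF v(1)] by simp
        finally show ?thesis by (simp add: \<phi>_def E_def heis_z_def)
      qed
      obtain j where j: "j < N" "v $ j \<noteq> 0"
        using v(2) WC[OF v(1)] by (metis carrier_vecD eq_vecI index_zero_vec)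
      have \<mu>: "\<mu> = root_phase N (int j)" using ev[OF j(1)] j by simp
      have "v $ i = 0" if i: "i < N" "i \<noteq> j" for i
      proof (rule ccontr)
        assume "v $ i \<noteq> 0"
        then have "root_phase N (int i) = root_phase N (int j)" using ev[OF i(1)] \<mu> by simp
        then have "[int i = int j] (mod int N)" using root_phase_eq_iff[OF N0] by simp
        then show False using i j by (simp add: cong_def)
      qed
      then have "inverse (v $ j) \<cdot>\<^sub>v v = unit_vec N j"
        using j WC[OF v(1)] by (intro eq_vecI) auto
      then have ej: "unit_vec N j \<in> W" using sm[OF v(1)] by metis
      have "unit_vec N i \<in> W" if i: "i < N" for i
      proof -
        let ?g = "((\<lambda>l::nat. if l = 0 then (int i - int j) mod int N else 0), (\<lambda>_::nat. 0::int), 0::int)"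
        have g: "?g \<in> carrier ?H" using N0 by (simp add: heisenberg_carrier)
        have "int i = f ?g (int j)" using i by (simp add: f_def mod_simps)
        then have *: "M.R ?g *\<^sub>v unit_vec N j = \<phi> ?g (int j) \<cdot>\<^sub>v unit_vec N i"
          using M.R_unit_vec[OF j(1) i] by simp
        have "inverse (\<phi> ?g (int j)) \<cdot>\<^sub>v (M.R ?g *\<^sub>v unit_vec N j) = unit_vec N i"
          unfolding * by (simp add: smult_smult_assoc \<phi>_def)
        then show ?thesis using sm[OF act[OF g ej]] by metis
      qed
      then show ?thesis using subspace_unit_vecs[OF W] by blast
    qed simp
  qed
  show ?thesis using M.proj_rep_R fa irr by (auto simp: has_faithful_irr_proj_rep_def)
qed


text \<open>The two summands (\<open>l\<close> false or true) carry opposite phases for \<open>y\<^sub>i\<close>, and only the second one sees \<open>z\<close>: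
  this makes their cocycles agree.\<close>

lemma heisenberg_faithful_sum:
  assumes N: "N > 1" and k: "k \<le> n"
  shows "has_faithful_proj_rep (heisenberg n N) (N ^ k + N ^ (n - k))"
proof -
  let ?H = "heisenberg n N" and ?m = "N ^ k + N ^ (n - k)"
  have N0: "N > 0" using N by simp
  interpret H: group ?H by (rule group_heisenberg[OF N0])
  define I where "I l = (if l then {k..<n} else {..<k})" for l
  have I_less: "i < n" if "i \<in> I l" for i l using that k by (auto simp: I_def split: if_splits)
  have I_fin: "finite (I l)" for l by (simp add: I_def)
  \<comment> \<open>The labels form a disjoint union, and \<open>f\<close> preserves the tag
    \<open>l\<close>; the monomial representation is thus the direct sum of pieces of degrees
    \<open>N ^ k\<close> and \<open>N ^ (n - k)\<close>.\<close>
  define S where "S = (SIGMA l:(UNIV::bool set). PiE (I l) (\<lambda>_. {0..<int N}))"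
  define f where "f g s = (fst s, \<lambda>i\<in>I (fst s). (snd s i + fst g i) mod int N)"
    for g :: "(nat \<Rightarrow> int) \<times> (nat \<Rightarrow> int) \<times> int" and s :: "bool \<times> (nat \<Rightarrow> int)"
  define E where "E g s = (if fst s then snd (snd g) - (\<Sum>i\<in>I True. fst (snd g) i * (snd s i + fst g i))
      else (\<Sum>i\<in>I False. fst (snd g) i * (snd s i + fst g i)))"
    for g :: "(nat \<Rightarrow> int) \<times> (nat \<Rightarrow> int) \<times> int" and s :: "bool \<times> (nat \<Rightarrow> int)"
  define \<phi> where "\<phi> g s = root_phase N (E g s)" for g s
  \<comment> \<open>On the summand with \<open>l\<close> false the phases of the
    \<open>y\<close>-part produce exactly this exponent. On the other one their opposite signs
    absorb the part of the bilinear term over \<open>I True\<close>, and \<open>Y\<close>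
    compensates the part over \<open>I False\<close>.\<close>
  define Y where "Y g h = - (\<Sum>i\<in>I False. fst g i * fst (snd h) i)"
    for g h :: "(nat \<Rightarrow> int) \<times> (nat \<Rightarrow> int) \<times> int"
  define \<alpha> where "\<alpha> g h = root_phase N (Y g h)" for g h
  have cardS: "card S = ?m"
    by (simp add: S_def card_SigmaI card_PiE I_fin finite_PiE UNIV_bool I_def)
  have finS: "finite S" by (simp add: S_def finite_SigmaI finite_PiE I_fin)
  obtain ix where "bij_betw ix {..<?m} S"
    using ex_bij_betw_nat_finite[OF finS] cardS by (metis lessThan_atLeast0)
  have sum_split: "(\<Sum>i<n. t i) = (\<Sum>i\<in>I False. t i) + (\<Sum>i\<in>I True. t i)" for t :: "nat \<Rightarrow> int"
  proof -
    have "{..<n} = I False \<union> I True" "I False \<inter> I True = {}" using k by (auto simp: I_def)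
    then show ?thesis using sum.union_disjoint[OF I_fin I_fin] by metis
  qed
  interpret M: monomial_data ?H S ?m ix f \<phi> \<alpha>
  proof
    show "0 < ?m" using N0 by simp
    show "bij_betw ix {..<?m} S" by fact
    fix g h :: "(nat \<Rightarrow> int) \<times> (nat \<Rightarrow> int) \<times> int" and s :: "bool \<times> (nat \<Rightarrow> int)"
    assume s: "s \<in> S"
    obtain l u where lu: "s = (l, u)" and u: "u \<in> PiE (I l) (\<lambda>_. {0..<int N})"
      using s by (auto simp: S_def)
    show "f \<one>\<^bsub>?H\<^esub> s = s" using u
      by (auto simp: f_def lu heisenberg_simps fun_eq_iff PiE_iff extensional_def)
    show "\<phi> \<one>\<^bsub>?H\<^esub> s = 1" by (simp add: \<phi>_def E_def heisenberg_simps)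
    show "f g s \<in> S" using N0 by (auto simp: f_def S_def)
    show "\<phi> g s \<noteq> 0" by (simp add: \<phi>_def)
    show "f g (f h s) = f (g \<otimes>\<^bsub>?H\<^esub> h) s"
      using I_less by (auto simp: f_def heisenberg_simps fun_eq_iff mod_simps ac_simps)
    let ?a = "fst g" and ?b = "fst (snd g)" and ?c = "snd (snd g)"
    let ?a' = "fst h" and ?b' = "fst (snd h)" and ?c' = "snd (snd h)"
    have 1: "[(\<Sum>i\<in>I l. ?b i * (snd (f h s) i + ?a i)) = (\<Sum>i\<in>I l. ?b i * (u i + ?a' i + ?a i))] (mod int N)"
      by (rule cong_sum, intro cong_mult cong_add cong_refl) (simp add: f_def lu cong_def)
    have 2: "[(\<Sum>i\<in>I l. fst (snd (g \<otimes>\<^bsub>?H\<^esub> h)) i * (u i + fst (g \<otimes>\<^bsub>?H\<^esub> h) i))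
      = (\<Sum>i\<in>I l. (?b i + ?b' i) * (u i + (?a i + ?a' i)))] (mod int N)"
      by (rule cong_sum, intro cong_mult cong_add cong_refl) (simp_all add: heisenberg_simps I_less cong_def)
    have "[E h s + E g (f h s) = Y g h + E (g \<otimes>\<^bsub>?H\<^esub> h) s] (mod int N)"
    proof (cases l)
      case False
      have e1: "[E h s + E g (f h s) = (\<Sum>i\<in>I l. ?b' i * (u i + ?a' i)) + (\<Sum>i\<in>I l. ?b i * (u i + ?a' i + ?a i))] (mod int N)"
        using cong_add[OF cong_refl 1] False by (simp add: E_def f_def lu)
      have e2: "[Y g h + E (g \<otimes>\<^bsub>?H\<^esub> h) s = Y g h + (\<Sum>i\<in>I l. (?b i + ?b' i) * (u i + (?a i + ?a' i)))] (mod int N)"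
        using cong_add[OF cong_refl 2] False by (simp add: E_def lu)
      have e3: "(\<Sum>i\<in>I l. ?b' i * (u i + ?a' i)) + (\<Sum>i\<in>I l. ?b i * (u i + ?a' i + ?a i))
         = Y g h + (\<Sum>i\<in>I l. (?b i + ?b' i) * (u i + (?a i + ?a' i)))"
        using False by (simp add: Y_def algebra_simps sum.distrib)
      show ?thesis by (rule cong_trans[OF e1 cong_sym[OF e2, folded e3]])
    next
      case True
      have e1: "[E h s + E g (f h s) = ?c' - (\<Sum>i\<in>I l. ?b' i * (u i + ?a' i)) + (?c - (\<Sum>i\<in>I l. ?b i * (u i + ?a' i + ?a i)))] (mod int N)"
        using cong_add[OF cong_refl cong_diff[OF cong_refl 1]] True by (simp add: E_def f_def lu)
      have "[snd (snd (g \<otimes>\<^bsub>?H\<^esub> h)) = ?c + ?c' + ((\<Sum>i\<in>I False. ?a i * ?b' i) + (\<Sum>i\<in>I True. ?a i * ?b' i))] (mod int N)"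
        by (simp add: heisenberg_simps sum_split cong_def)
      then have e2: "[Y g h + E (g \<otimes>\<^bsub>?H\<^esub> h) s = Y g h + (?c + ?c' + ((\<Sum>i\<in>I False. ?a i * ?b' i) + (\<Sum>i\<in>I True. ?a i * ?b' i))
            - (\<Sum>i\<in>I l. (?b i + ?b' i) * (u i + (?a i + ?a' i))))] (mod int N)"
        using cong_add[OF cong_refl cong_diff[OF _ 2]] True by (simp add: E_def lu)
      have e3: "?c' - (\<Sum>i\<in>I l. ?b' i * (u i + ?a' i)) + (?c - (\<Sum>i\<in>I l. ?b i * (u i + ?a' i + ?a i)))
         = Y g h + (?c + ?c' + ((\<Sum>i\<in>I False. ?a i * ?b' i) + (\<Sum>i\<in>I True. ?a i * ?b' i))
            - (\<Sum>i\<in>I l. (?b i + ?b' i) * (u i + (?a i + ?a' i))))"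
        using True by (simp add: Y_def algebra_simps sum.distrib)
      show ?thesis by (rule cong_trans[OF e1 cong_sym[OF e2, folded e3]])
    qed
    then show "\<phi> h s * \<phi> g (f h s) = \<alpha> g h * \<phi> (g \<otimes>\<^bsub>?H\<^esub> h) s"
      using root_phase_eq_iff[OF N0] by (simp add: \<phi>_def \<alpha>_def flip: root_phase_add)
  qed (simp add: \<alpha>_def)
  have "faithful_proj ?H ?m M.R"
    unfolding faithful_proj_def
  proof (intro ballI impI)
    fix g assume g: "g \<in> carrier ?H" and "\<exists>c. M.R g = c \<cdot>\<^sub>m 1\<^sub>m ?m"
    then obtain c where c: "M.R g = c \<cdot>\<^sub>m 1\<^sub>m ?m" by blast
    note sc = M.R_scalar[OF g c]
    have g': "\<And>i. i < n \<Longrightarrow> 0 \<le> fst g i \<and> fst g i < int N" "\<And>i. i < n \<Longrightarrow> 0 \<le> fst (snd g) i \<and> fst (snd g) i < int N"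
      "0 \<le> snd (snd g)" "snd (snd g) < int N" "\<And>i. i \<ge> n \<Longrightarrow> fst g i = 0" "\<And>i. i \<ge> n \<Longrightarrow> fst (snd g) i = 0"
      using g by (auto simp: heisenberg_carrier)
    have I_cover: "\<exists>l. i \<in> I l" if "i < n" for i using that by (cases "i < k") (auto simp: I_def)
    \<comment> \<open>Test labels: \<open>\<delta> l j\<close> is zero if \<open>j\<close> lies
      outside \<open>I l\<close>. The choice \<open>j = n\<close>, outside both index sets, gives
      the zero label of either summand.\<close>
    define \<delta> where "\<delta> l j = (l, \<lambda>i\<in>I l. if i = j then 1 else 0 :: int)" for l and j :: nat
    have \<delta>S: "\<delta> l j \<in> S" for l j using N by (auto simp: \<delta>_def S_def)
    have A: "fst g i = 0" for i
    proof (cases "i < n")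
      case True
      then obtain l where l: "i \<in> I l" using I_cover by blast
      have "snd (f g (\<delta> l n)) i = snd (\<delta> l n) i" using sc(1)[OF \<delta>S] by simp
      then show ?thesis using l True g'(1)[OF True] by (simp add: f_def \<delta>_def)
    qed (use g' in auto)
    have E: "E g (\<delta> l j) = (if l then snd (snd g) - (if j \<in> I l then fst (snd g) j else 0)
        else (if j \<in> I l then fst (snd g) j else 0))" for l j
      using A by (auto simp: E_def \<delta>_def I_fin sum.delta if_distrib[of "\<lambda>x. _ * x"] cong: if_cong)
    have nI: "n \<notin> I l" for l using I_less by blast
    \<comment> \<open>The scalar is read off at the zero label of the first summand, where the phase
      is 1 because \<open>z\<close> acts trivially there.\<close>
    have eq: "root_phase N (E g (\<delta> l j)) = 1" for l j
      using sc(2)[OF \<delta>S[of l j]] sc(2)[OF \<delta>S[of False n]] nI by (simp add: \<phi>_def E)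
    have "int N dvd snd (snd g)"
      using eq[of True n] nI root_phase_eq_1_iff[OF N0] by (simp add: E)
    then have C: "snd (snd g) = 0" using zdvd_less_imp_zero g' by blast
    have B: "fst (snd g) i = 0" for i
    proof (cases "i < n")
      case True
      then obtain l where l: "i \<in> I l" using I_cover by blast
      have "int N dvd fst (snd g) i"
        using eq[of l i] l root_phase_eq_1_iff[OF N0] C by (cases l) (simp_all add: E)
      then show ?thesis using zdvd_less_imp_zero g'(2)[OF True] by blast
    qed (use g' in auto)
    show "g = \<one>\<^bsub>?H\<^esub>" using A B C by (auto simp: heisenberg_simps prod_eq_iff fun_eq_iff)
  qed
  then show ?thesis using M.proj_rep_R by (auto simp: has_faithful_proj_rep_def)
qed

theorem theorem4p12:
  fixes p :: nat
  assumes "Factorial_Ring.prime p" and "odd p"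
  shows
    "(\<forall>(G :: ('a, 'b) monoid_scheme).
        p_group p G \<and> carrier G \<noteq> {\<one>\<^bsub>G\<^esub>} \<and>
        derived G (carrier G) \<subseteq> group_center G \<and>
        cyclic_group (G\<lparr>carrier := group_center G\<rparr>) \<and>
        (\<exists>m. has_faithful_irr_proj_rep G m)
        \<longrightarrow> (\<exists>k\<ge>1. G \<cong> heisenberg 1 (p ^ k)))
     \<and> (\<forall>k\<ge>1. tau_irr (heisenberg 1 (p ^ k)) = p ^ k \<and> tau (heisenberg 1 (p ^ k)) = p ^ k)
     \<and> (\<forall>n k. n > 1 \<and> k \<ge> 1 \<longrightarrow>
          (\<forall>m. \<not> has_faithful_irr_proj_rep (heisenberg n (p ^ k)) m) \<and>
          tau (heisenberg n (p ^ k)) \<le> p ^ (k * (n div 2)) + p ^ (k * ((n + 1) div 2)))"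
proof (intro conjI allI impI)
  fix G :: "('a, 'b) monoid_scheme"
  assume "p_group p G \<and> carrier G \<noteq> {\<one>\<^bsub>G\<^esub>} \<and> derived G (carrier G) \<subseteq> group_center G \<and>
        cyclic_group (G\<lparr>carrier := group_center G\<rparr>) \<and> (\<exists>m. has_faithful_irr_proj_rep G m)"
  then show "\<exists>k\<ge>1. G \<cong> heisenberg 1 (p ^ k)"
    using faithful_irr_imp_heisenberg[OF assms] by blast
next
  have N1: "p ^ k > 1" if "k \<ge> 1" for k
    using one_less_power[OF prime_gt_1_nat[OF assms(1)], of k] that by simp
  {
    fix k :: nat assume k: "k \<ge> 1"
    have irr: "has_faithful_irr_proj_rep (heisenberg 1 (p ^ k)) (p ^ k)"
      by (rule heisenberg_faithful_irr[OF N1[OF k]]) (use assms in simp)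
    have imp: "has_faithful_proj_rep (heisenberg 1 (p ^ k)) m"
      if "has_faithful_irr_proj_rep (heisenberg 1 (p ^ k)) m" for m
      using that by (auto simp: has_faithful_proj_rep_def has_faithful_irr_proj_rep_def)
    \<comment> \<open>The lower bound holds for every faithful representation, so one irreducible
      example settles both minima.\<close>
    note low = heisenberg_degree_bound[OF assms k]
    show "tau_irr (heisenberg 1 (p ^ k)) = p ^ k"
      unfolding tau_irr_def using irr imp low by (intro Least_equality) blast+
    show "tau (heisenberg 1 (p ^ k)) = p ^ k"
      unfolding tau_def using irr imp low by (intro Least_equality) blast+
  }
  fix n k :: nat assume nk: "n > 1 \<and> k \<ge> 1"
  show "\<not> has_faithful_irr_proj_rep (heisenberg n (p ^ k)) m" for m
    using heisenberg_no_faithful_irr[OF N1] nk by blast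
  have "n - n div 2 = (n + 1) div 2" by presburger
  then have "has_faithful_proj_rep (heisenberg n (p ^ k)) (p ^ (k * (n div 2)) + p ^ (k * ((n + 1) div 2)))"
    using heisenberg_faithful_sum[OF N1, of k "n div 2" n] nk by (simp add: power_mult)
  then show "tau (heisenberg n (p ^ k)) \<le> p ^ (k * (n div 2)) + p ^ (k * ((n + 1) div 2))"
    unfolding tau_def by (rule Least_le)
qed

end
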